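(* Let $F/\mathbf{Q}$ be a totally real number field of degree $k$ with ring of integers $\mathcal{O}$, $p$ a rational prime, and $\mathcal{N}\ne\mathcal{O}$ a nonzero ideal prime to $p$ with $\mathcal{O}/\mathcal{N}\simeq\mathbf{Z}/N$, $N=\mathrm{Nm}(\mathcal{N})$. Let $x\in F$ be integral at all primes dividing $\mathcal{N}p$, and let $V=\{v_1,\dots,v_k\}$ be a $\mathbf{Q}$-basis of $F$ consisting of totally positive elements of $\mathcal{O}$ that are prime to $\mathcal{N}$. Let $\chi:\mathrm{Cl}_+(\mathcal{N})\to\bar{\mathbf{Q}}^\times$ be a character of nontrivial narrow modulus, i.e. nontrivial on the image of $(\mathcal{O}/\mathcal{N})^\times$. Then the attached $p$-adic measure $\mu_{V,x,\chi}$ on $\mathcal{O}_{V^\dagger,p}$ (see context) is valued in $\mathbf{Z}[1/N,\mathrm{im}(\chi)]$, and $$\mu_{V,x,\chi}(x+l\cdot v+p^n\mathcal{O}_{V,p})=\frac{(-1)^k}{N^k}\sum_{0\le d_1,\dots,d_k<N}\chi\bigl(x+(l+p^nd)\cdot v\bigr)\prod_{1\le i\le k}d_i$$ for all $n\in\mathbf{Z}_{\ge0}$ and $l=(l_1,\dots,l_k)\in\mathbf{Z}^k$ with $0\le l_1,\dots,l_k<p^n$. Moreover, when $p^n\equiv1\bmod\mathcal{N}$, $$\mu_{V,x,\chi}(x+l\cdot v+p^n\mathcal{O}_{V,p})=(-1)^k\sum_{S\subseteq\{1,\dots,k\}}N^{-|S|}\sum_{\substack{0\le d_i<N\\ i\in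 S}}\ \sum_{\substack{0\le d_j<l_j\\ j\notin S}}\chi(x+d\cdot v)\prod_{i\in S}d_i$$ for the same $l$, where $d=(d_1,\dots,d_k)$.
   Context: Notation: for integer tuples, $l\cdot v=\sum_i l_iv_i$ and $(l+p^nd)\cdot v=\sum_i(l_i+p^nd_i)v_i$; $F_p=F\otimes_{\mathbf{Q}}\mathbf{Q}_p$, which has $V$ as a $\mathbf{Q}_p$-basis; $\mathcal{O}_{V,p}=\mathbf{Z}_pv_1+\cdots+\mathbf{Z}_pv_k\subset F_p$. Choose $r\in\mathbf{Z}_{\ge0}$ with $x\in p^{-r}\mathcal{O}_{V,p}$, put $v_i'=p^{-r}v_i$, $V^\dagger=\{v_1',\dots,v_k'\}$ and $\mathcal{O}_{V^\dagger,p}=p^{-r}\mathcal{O}_{V,p}=\bigoplus_i\mathbf{Z}_pv_i'$. $\mathrm{Cl}_+(\mathcal{N})$ is the narrow ray class group of modulus $\mathcal{N}$; the natural map $(\mathcal{O}/\mathcal{N})^\times\to\mathrm{Cl}_+(\mathcal{N})$ sends the class of a totally positive element $y$ prime to $\mathcal{N}$ to the class of $(y)$. For $y\in F$ integral at the primes dividing $\mathcal{N}$, $\chi(y)$ denotes the value of $\chi$ on the image of $y\bmod\mathcal{N}$ if $y$ is prime to $\mathcal{N}$, and $0$ otherwise. $\bar{\mathbf{Q}}$ is embedded in $\mathbf{C}_p$. Let $R$ be a sufficiently large finite flat extension of $\mathbf{Z}_p$ (ring of integers of a finite extension of $\mathbf{Q}_p$ containing $\mathrm{im}(\chi)$). $R$-valued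 measures $\mu$ on $\mathcal{O}_{V^\dagger,p}$ correspond bijectively to power series in $\mathcal{A}_{V^\dagger}=R[[t_1-1,\dots,t_k-1]]$ via the Amice transform $\mu\mapsto\int_{\mathcal{O}_{V^\dagger,p}}t^\alpha\,\mu(\alpha)$, where $t^\alpha=t_1^{\alpha_1'}\cdots t_k^{\alpha_k'}$ for $\alpha=\sum_i\alpha_i'v_i'$, $\alpha_i'\in\mathbf{Z}_p$ (so $t^{Nv_i}=t_i^{Np^r}$). The measure $\mu_{V,x,\chi}$ is the one corresponding to $$f_{V,x,\chi}(t)=\sum_{0\le d_1,\dots,d_k<N}\chi(x+d\cdot v)\frac{t^{x+d\cdot v}}{\prod_{1\le i\le k}(1-t^{Nv_i})},$$ which a priori lies in the fraction field of $\mathcal{A}_{V^\dagger}$ but in fact belongs to $\mathcal{A}_{V^\dagger}$. *)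

theory Defs
  imports
    "HOL-Analysis.Analysis"
    "HOL-Algebra.Algebra"
    "HOL-Algebra.Algebraic_Closure_Type"
begin

hide_const (open) Divisibility.prime

section \<open>Number fields\<close>

text \<open>The number field \<open>F\<close> is a type; subrings, ideals and quotients are taken from HOL-Algebra,
  applied to the record of all of \<open>F\<close>.\<close>

abbreviation whole :: "'a::ring_1 ring" where
  "whole \<equiv> ring_of_type_algebra"

definition \<O> :: "'f::field_char_0 ring" where
  "\<O> = whole\<lparr>carrier := {y. algebraic_int y}\<rparr>"

definition rat_scale :: "rat \<Rightarrow> 'f::field_char_0 \<Rightarrow> 'f" where
  "rat_scale q y = of_rat q * y"

global_interpretation rat_vs: vector_space "rat_scale :: rat \<Rightarrow> 'f::field_char_0 \<Rightarrow> 'f"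
  by unfold_locales (auto simp: rat_scale_def algebra_simps of_rat_add of_rat_mult)

text \<open>\<open>dim\<close> is \<open>0\<close> for infinite-dimensional spaces, so for \<open>k > 0\<close> this includes finiteness.\<close>

definition totally_real_field :: "'f::field_char_0 itself \<Rightarrow> nat \<Rightarrow> bool" where
  "totally_real_field _ k \<longleftrightarrow>
     k > 0 \<and> rat_vs.dim (UNIV :: 'f set) = k \<and>
     (\<forall>\<sigma> \<in> ring_hom (whole :: 'f ring) (whole :: complex ring). range \<sigma> \<subseteq> \<real>)"

definition totally_positive :: "'f::field_char_0 \<Rightarrow> bool" where
  "totally_positive y \<longleftrightarrow> (\<forall>\<sigma> \<in> ring_hom (whole :: 'f ring) (whole :: real ring). \<sigma> y > 0)"

definition rat_basis :: "('k::finite \<Rightarrow> 'f::field_char_0) \<Rightarrow> bool" where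
  "rat_basis v \<longleftrightarrow> inj v \<and> rat_vs.independent (range v) \<and> rat_vs.span (range v) = UNIV"

definition ideal_norm :: "'f::field_char_0 set \<Rightarrow> nat" where
  "ideal_norm J = card (carrier (\<O> Quot J))"

definition coprime_ideals :: "'f::field_char_0 set \<Rightarrow> 'f set \<Rightarrow> bool" where
  "coprime_ideals A B \<longleftrightarrow> A <+>\<^bsub>\<O>\<^esub> B = carrier \<O>"

text \<open>For a nonzero ideal \<open>J\<close> these are the primes dividing \<open>J\<close>: to divide is to contain.\<close>

definition primes_dividing :: "'f::field_char_0 set \<Rightarrow> 'f set set" where
  "primes_dividing J = {Q. primeideal Q \<O> \<and> J \<subseteq> Q}"

text \<open>Membership in the local ring of \<open>\<O>\<close> at \<open>Q\<close>, and in its unit group.\<close>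

definition integral_at :: "'f::field_char_0 set \<Rightarrow> 'f \<Rightarrow> bool" where
  "integral_at Q y \<longleftrightarrow> (\<exists>a \<in> carrier \<O>. \<exists>b \<in> carrier \<O> - Q. y = a / b)"

definition unit_at :: "'f::field_char_0 set \<Rightarrow> 'f \<Rightarrow> bool" where
  "unit_at Q y \<longleftrightarrow> (\<exists>a \<in> carrier \<O> - Q. \<exists>b \<in> carrier \<O> - Q. y = a / b)"

definition prime_to :: "'f::field_char_0 set \<Rightarrow> 'f \<Rightarrow> bool" where
  "prime_to J y \<longleftrightarrow> (\<forall>Q \<in> primes_dividing J. unit_at Q y)"

text \<open>Congruence modulo \<open>J\<close> of elements of \<open>F\<close> that are integral at the primes dividing \<open>J\<close>:
  the difference lies in the extension of \<open>J\<close> to the semilocal ring at these primes.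
  For \<open>z = 1\<close> this is the multiplicative congruence of class field theory.\<close>

definition cong_ideal :: "'f::field_char_0 set \<Rightarrow> 'f \<Rightarrow> 'f \<Rightarrow> bool" where
  "cong_ideal J y z \<longleftrightarrow> (\<exists>a \<in> J. \<exists>b \<in> carrier \<O>. prime_to J b \<and> y - z = a / b)"

subsection \<open>The narrow ray class group\<close>

definition fractional_ideal :: "'f::field_char_0 set \<Rightarrow> bool" where
  "fractional_ideal A \<longleftrightarrow>
     subgroup A (add_monoid whole) \<and> A \<noteq> {0} \<and>
     (\<forall>a \<in> carrier \<O>. \<forall>y \<in> A. a * y \<in> A) \<and>
     (\<exists>c \<in> carrier \<O> - {0}. \<forall>y \<in> A. c * y \<in> carrier \<O>)"

text \<open>The product of fractional ideals is \<open>ideal_prod\<close> computed in the field: all finite sums of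
  products. A fractional ideal is prime to \<open>J\<close> if it is a quotient of integral ideals coprime
  to \<open>J\<close>.\<close>

definition ray_ideals :: "'f::field_char_0 set \<Rightarrow> 'f set monoid" where
  "ray_ideals J = \<lparr>carrier = {A. fractional_ideal A \<and>
       (\<exists>B C. ideal B \<O> \<and> ideal C \<O> \<and> coprime_ideals B J \<and> coprime_ideals C J \<and>
              ideal_prod whole A C = B)},
     monoid.mult = ideal_prod whole, one = carrier \<O>\<rparr>"

definition principal :: "'f::field_char_0 \<Rightarrow> 'f set" where
  "principal y = (\<lambda>a. y * a) ` carrier \<O>"

definition narrow_ray :: "'f::field_char_0 set \<Rightarrow> 'f set set" where
  "narrow_ray J = {principal y | y. y \<noteq> 0 \<and> totally_positive y \<and> cong_ideal J y 1}"

definition Cl_plus :: "'f::field_char_0 set \<Rightarrow> 'f set set monoid" where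
  "Cl_plus J = ray_ideals J Mod narrow_ray J"

text \<open>The image of \<open>y mod J\<close> under the natural map from the units modulo \<open>J\<close> to the narrow ray
  class group, for \<open>y\<close> prime to \<open>J\<close>.\<close>

definition unit_class :: "'f::field_char_0 set \<Rightarrow> 'f \<Rightarrow> 'f set set" where
  "unit_class J y = (THE C. \<exists>z \<in> carrier \<O>. totally_positive z \<and> cong_ideal J z y \<and>
     C = narrow_ray J #>\<^bsub>ray_ideals J\<^esub> principal z)"

definition chi_val :: "('f::field_char_0 set set \<Rightarrow> 'c::field_char_0) \<Rightarrow> 'f set \<Rightarrow> 'f \<Rightarrow> 'c" where
  "chi_val chi J y = (if prime_to J y then chi (unit_class J y) else 0)"

definition nontrivial_narrow_modulus ::
  "('f::field_char_0 set set \<Rightarrow> 'c::field_char_0) \<Rightarrow> 'f set \<Rightarrow> bool" where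
  "nontrivial_narrow_modulus chi J \<longleftrightarrow>
     (\<exists>y \<in> carrier \<O>. prime_to J y \<and> chi (unit_class J y) \<noteq> 1)"

section \<open>The field of p-adic complex numbers\<close>

text \<open>The metric of the type is to be that of the absolute value \<open>cp_abs\<close>.\<close>

definition cp_abs :: "'c::{field_char_0,metric_space} \<Rightarrow> real" where
  "cp_abs z = dist z 0"

definition Qp :: "'c::{field_char_0,metric_space} set" where
  "Qp = closure \<rat>"

definition Zp :: "'c::{field_char_0,metric_space} set" where
  "Zp = {a \<in> Qp. cp_abs a \<le> 1}"

definition Qp_bar :: "'c::{field_char_0,metric_space} set" where
  "Qp_bar = {z. \<exists>q. q \<noteq> 0 \<and> (\<forall>i. poly.coeff q i \<in> Qp) \<and> poly q z = 0}"

text \<open>Completion of an algebraic closure of the completion of the rationals at \<open>p\<close>.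
  Completeness is part of the sort. This determines \<open>'c\<close> up to isometric isomorphism.\<close>

definition is_C_p :: "'c::{field_char_0,complete_space} itself \<Rightarrow> nat \<Rightarrow> bool" where
  "is_C_p _ p \<longleftrightarrow>
     (\<forall>y z :: 'c. dist y z = cp_abs (y - z)) \<and>
     (\<forall>y z :: 'c. cp_abs (y * z) = cp_abs y * cp_abs z) \<and>
     (\<forall>y z :: 'c. cp_abs (y + z) \<le> max (cp_abs y) (cp_abs z)) \<and>
     cp_abs (of_nat p :: 'c) = 1 / real p \<and>
     (\<forall>q :: 'c poly. (\<forall>i. poly.coeff q i \<in> Qp_bar) \<and> Polynomial.degree q > 0 \<longrightarrow> (\<exists>z. poly q z = 0)) \<and>
     closure (Qp_bar :: 'c set) = UNIV"

definition finite_ext_Qp :: "'c::{field_char_0,metric_space} set \<Rightarrow> bool" where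
  "finite_ext_Qp K \<longleftrightarrow> subfield K whole \<and> Qp \<subseteq> K \<and> ring.finite_dimension whole Qp K"

definition integer_ring :: "'c::{field_char_0,metric_space} set \<Rightarrow> 'c set" where
  "integer_ring K = {a \<in> K. cp_abs a \<le> 1}"

definition Qbar :: "'c::field_char_0 ring" where
  "Qbar = whole\<lparr>carrier := {z. algebraic z}\<rparr>"

subsection \<open>The local algebra and its lattices\<close>

text \<open>An element of the tensor product of \<open>F\<close> with the p-adic numbers is represented by its
  coordinates in \<open>Qp\<close> with respect to the basis \<open>v\<close>. The topology is the product topology.\<close>

definition emb :: "('k::finite \<Rightarrow> 'f::field_char_0) \<Rightarrow> 'f \<Rightarrow> 'k \<Rightarrow> 'c::field_char_0" where
  "emb v y = (\<lambda>i. of_rat (rat_vs.representation (range v) y (v i)))"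

definition lin :: "('k::finite \<Rightarrow> 'f::field_char_0) \<Rightarrow> ('k \<Rightarrow> nat) \<Rightarrow> 'f" where
  "lin v d = (\<Sum>i\<in>UNIV. of_nat (d i) * v i)"

text \<open>The coset \<open>\<alpha> + c O\<close> for \<open>O\<close> the \<open>Zp\<close>-lattice spanned by the basis.\<close>

definition lattice_coset ::
  "('k::finite \<Rightarrow> 'c::{field_char_0,metric_space}) \<Rightarrow> 'c \<Rightarrow> ('k \<Rightarrow> 'c) set" where
  "lattice_coset \<alpha> c = {\<gamma>. \<exists>\<beta>. (\<forall>i. \<beta> i \<in> Zp) \<and> \<gamma> = (\<lambda>i. \<alpha> i + c * \<beta> i)}"

definition O_dagger :: "nat \<Rightarrow> nat \<Rightarrow> ('k::finite \<Rightarrow> 'c::{field_char_0,metric_space}) set" where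
  "O_dagger p r = lattice_coset (\<lambda>_. 0) (1 / of_nat p ^ r)"

section \<open>Formal power series in several variables\<close>

typedef ('k, 'a) mfps = "UNIV :: (('k::finite \<Rightarrow> nat) \<Rightarrow> 'a) set"
  morphisms mcoeff Abs_mfps ..

lemma mcoeff_Abs [simp]: "mcoeff (Abs_mfps f) = f"
  by (simp add: Abs_mfps_inverse)

lemma mfps_eqI: "(\<And>m. mcoeff f m = mcoeff g m) \<Longrightarrow> f = g"
  by (metis mcoeff_inject ext)

lemma finite_le_fun: "finite {a :: 'k::finite \<Rightarrow> nat. \<forall>i. a i \<le> m i}"
proof -
  have "{a :: 'k \<Rightarrow> nat. \<forall>i. a i \<le> m i} = PiE UNIV (\<lambda>i. {..m i})"
    by (auto simp: PiE_def Pi_def)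
  thus ?thesis by (simp add: finite_PiE)
qed

instantiation mfps :: (finite, comm_ring_1) comm_ring_1
begin

definition "0 = Abs_mfps (\<lambda>_. 0)"
definition "1 = Abs_mfps (\<lambda>m. if m = (\<lambda>_. 0) then 1 else 0)"
definition "f + g = Abs_mfps (\<lambda>m. mcoeff f m + mcoeff g m)"
definition "f - g = Abs_mfps (\<lambda>m. mcoeff f m - mcoeff g m)"
definition "- f = Abs_mfps (\<lambda>m. - mcoeff f m)"
definition "f * g = Abs_mfps (\<lambda>m. \<Sum>a | \<forall>i. a i \<le> m i. mcoeff f a * mcoeff g (\<lambda>i. m i - a i))"

instance
proof
  fix f g h :: "('a, 'b) mfps"
  show "f * g * h = f * (g * h)"
  proof (rule mfps_eqI)
    fix m :: "'a \<Rightarrow> nat"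
    let ?L = "SIGMA a:{a. \<forall>i. a i \<le> m i}. {b. \<forall>i. b i \<le> a i}"
    let ?R = "SIGMA b:{b. \<forall>i. b i \<le> m i}. {c. \<forall>i. c i \<le> m i - b i}"
    have "mcoeff (f * g * h) m =
      (\<Sum>(a, b)\<in>?L. mcoeff f b * mcoeff g (\<lambda>i. a i - b i) * mcoeff h (\<lambda>i. m i - a i))"
      by (simp add: times_mfps_def sum_distrib_right sum.Sigma finite_le_fun)
    also have "\<dots> = (\<Sum>(b, c)\<in>?R. mcoeff f b * mcoeff g c * mcoeff h (\<lambda>i. m i - b i - c i))"
    proof (rule sum.reindex_bij_witness[where
          j = "\<lambda>(a, b). (b, \<lambda>i. a i - b i)" and i = "\<lambda>(b, c). (\<lambda>i. b i + c i, b)"])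
      fix z assume "z \<in> ?L"
      then obtain a b where z: "z = (a, b)" "\<And>i. a i \<le> m i" "\<And>i. b i \<le> a i" by auto
      have "b i \<le> m i" "b i + (a i - b i) = a i" "m i - b i - (a i - b i) = m i - a i" for i
        using z(2,3)[of i] by auto
      then show "(case (case z of (a, b) \<Rightarrow> (b, \<lambda>i. a i - b i)) of (b, c) \<Rightarrow> (\<lambda>i. b i + c i, b)) = z"
        and "(case z of (a, b) \<Rightarrow> (b, \<lambda>i. a i - b i)) \<in> ?R"
        and "(case (case z of (a, b) \<Rightarrow> (b, \<lambda>i. a i - b i)) of
            (b, c) \<Rightarrow> mcoeff f b * mcoeff g c * mcoeff h (\<lambda>i. m i - b i - c i)) =
          (case z of (a, b) \<Rightarrow>
            mcoeff f b * mcoeff g (\<lambda>i. a i - b i) * mcoeff h (\<lambda>i. m i - a i))"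
        using z by (auto simp: diff_le_mono)
    next
      fix z assume "z \<in> ?R"
      then obtain b c where z: "z = (b, c)" "\<And>i. b i \<le> m i" "\<And>i. c i \<le> m i - b i" by auto
      have "b i + c i \<le> m i" for i using z(2,3)[of i] by auto
      then show "(case (case z of (b, c) \<Rightarrow> (\<lambda>i. b i + c i, b)) of (a, b) \<Rightarrow> (b, \<lambda>i. a i - b i)) = z"
        and "(case z of (b, c) \<Rightarrow> (\<lambda>i. b i + c i, b)) \<in> ?L"
        using z by auto
    qed
    also have "\<dots> = mcoeff (f * (g * h)) m"
      by (simp add: times_mfps_def sum_distrib_left sum.Sigma finite_le_fun mult.assoc)
    finally show "mcoeff (f * g * h) m = mcoeff (f * (g * h)) m" .
  qed
  show "f * g = g * f"
  proof (rule mfps_eqI)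
    fix m :: "'a \<Rightarrow> nat"
    show "mcoeff (f * g) m = mcoeff (g * f) m"
      unfolding times_mfps_def mcoeff_Abs
      by (rule sum.reindex_bij_witness[where i = "\<lambda>a i. m i - a i" and j = "\<lambda>a i. m i - a i"])
         (auto simp: mult.commute)
  qed
  show "1 * f = f"
  proof (rule mfps_eqI)
    fix m :: "'a \<Rightarrow> nat"
    have "mcoeff (1 * f) m = (\<Sum>a | \<forall>i. a i \<le> m i. if a = (\<lambda>_. 0) then mcoeff f m else 0)"
      unfolding times_mfps_def one_mfps_def mcoeff_Abs by (rule sum.cong) auto
    also have "\<dots> = mcoeff f m" by (simp add: sum.delta finite_le_fun)
    finally show "mcoeff (1 * f) m = mcoeff f m" .
  qed
  show "(f + g) * h = f * h + g * h"
    by (rule mfps_eqI) (simp add: times_mfps_def plus_mfps_def distrib_right sum.distrib)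
  show "f + g + h = f + (g + h)" "f + g = g + f" "0 + f = f" "- f + f = 0" "f - g = f + - g"
    by (rule mfps_eqI; simp add: plus_mfps_def zero_mfps_def uminus_mfps_def minus_mfps_def
        algebra_simps)+
  show "(0 :: ('a, 'b) mfps) \<noteq> 1"
  proof
    assume "(0 :: ('a, 'b) mfps) = 1"
    then have "mcoeff (0 :: ('a, 'b) mfps) (\<lambda>_. 0) = mcoeff 1 (\<lambda>_. 0)" by (rule arg_cong)
    then show False by (simp add: zero_mfps_def one_mfps_def)
  qed
qed

end

definition mconst :: "'a::zero \<Rightarrow> ('k::finite, 'a) mfps" where
  "mconst c = Abs_mfps (\<lambda>m. if m = (\<lambda>_. 0) then c else 0)"

definition power_series_over :: "'a set \<Rightarrow> ('k::finite, 'a) mfps set" where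
  "power_series_over R = {f. \<forall>m. mcoeff f m \<in> R}"

section \<open>Measures and the Amice transform\<close>

text \<open>The variables of the power series are \<open>t\<^sub>i - 1\<close>. The coordinates of \<open>\<alpha>\<close> with respect to the
  vectors \<open>v\<^sub>i / p ^ r\<close> are \<open>p ^ r \<alpha>\<^sub>i\<close>, so \<open>t\<^sup>\<alpha>\<close> is the product of the binomial series
  \<open>(1 + (t\<^sub>i - 1)) powr (p ^ r \<alpha>\<^sub>i)\<close>.\<close>

definition tpow :: "nat \<Rightarrow> nat \<Rightarrow> ('k::finite \<Rightarrow> 'c::field_char_0) \<Rightarrow> ('k, 'c) mfps" where
  "tpow p r \<alpha> = Abs_mfps (\<lambda>m. \<Prod>i\<in>UNIV. (of_nat p ^ r * \<alpha> i) gchoose (m i))"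

definition compact_opens :: "'x::topological_space set \<Rightarrow> 'x set set" where
  "compact_opens T = {U. U \<subseteq> T \<and> compact U \<and> openin (top_of_set T) U}"

text \<open>An \<open>R\<close>-valued measure is a finitely additive \<open>R\<close>-valued function on the compact open subsets;
  outside of these it takes the value \<open>undefined\<close>.\<close>

definition is_measure :: "'c::comm_ring_1 set \<Rightarrow> 'x::topological_space set \<Rightarrow> ('x set \<Rightarrow> 'c) \<Rightarrow> bool" where
  "is_measure R T mu \<longleftrightarrow>
     mu \<in> extensional (compact_opens T) \<and>
     (\<forall>U \<in> compact_opens T. mu U \<in> R) \<and>
     (\<forall>U \<in> compact_opens T. \<forall>W \<in> compact_opens T. U \<inter> W = {} \<longrightarrow> mu (U \<union> W) = mu U + mu W)"

text \<open>Integral over \<open>O_dagger p r\<close> of a continuous function, as the limit of the Riemann sums for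
  the partitions into cosets of \<open>p ^ n\<close> times this lattice.\<close>

definition measure_integral :: "nat \<Rightarrow> nat \<Rightarrow> (('k::finite \<Rightarrow> 'c::{field_char_0,metric_space}) set \<Rightarrow> 'c)
    \<Rightarrow> (('k \<Rightarrow> 'c) \<Rightarrow> 'c) \<Rightarrow> 'c" where
  "measure_integral p r mu g = lim (\<lambda>n. \<Sum>a | \<forall>i. a i < p ^ n.
     let \<alpha> = (\<lambda>i. of_nat (a i) / of_nat p ^ r)
     in g \<alpha> * mu (lattice_coset \<alpha> (of_nat p ^ n / of_nat p ^ r)))"

definition amice :: "nat \<Rightarrow> nat \<Rightarrow> (('k::finite \<Rightarrow> 'c::{field_char_0,metric_space}) set \<Rightarrow> 'c)
    \<Rightarrow> ('k, 'c) mfps" where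
  "amice p r mu = Abs_mfps (\<lambda>m. measure_integral p r mu (\<lambda>\<alpha>. mcoeff (tpow p r \<alpha>) m))"

definition f_num :: "nat \<Rightarrow> nat \<Rightarrow> nat \<Rightarrow> ('k::finite \<Rightarrow> 'f::field_char_0) \<Rightarrow> 'f \<Rightarrow>
    ('f \<Rightarrow> 'c::field_char_0) \<Rightarrow> ('k, 'c) mfps" where
  "f_num p r N v x \<psi> =
     (\<Sum>d | \<forall>i. d i < N. mconst (\<psi> (x + lin v d)) * tpow p r (emb v (x + lin v d)))"

definition f_den :: "nat \<Rightarrow> nat \<Rightarrow> nat \<Rightarrow> ('k::finite \<Rightarrow> 'f::field_char_0) \<Rightarrow> ('k, 'c::field_char_0) mfps" where
  "f_den p r N v = (\<Prod>i\<in>UNIV. 1 - tpow p r (emb v (of_nat N * v i)))"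

text \<open>The fraction \<open>f_num / f_den\<close>, which lies in the ring of power series over \<open>R\<close>; division is
  expressed by cancellation since this ring is a domain.\<close>

definition f_series :: "'c::field_char_0 set \<Rightarrow> nat \<Rightarrow> nat \<Rightarrow> nat \<Rightarrow> ('k::finite \<Rightarrow> 'f::field_char_0) \<Rightarrow> 'f \<Rightarrow>
    ('f \<Rightarrow> 'c) \<Rightarrow> ('k, 'c) mfps" where
  "f_series R p r N v x \<psi> =
     (THE f. f \<in> power_series_over R \<and> f * f_den p r N v = f_num p r N v x \<psi>)"

definition mu_measure :: "'c::{field_char_0,metric_space} set \<Rightarrow> nat \<Rightarrow> nat \<Rightarrow> nat \<Rightarrow>
    ('k::finite \<Rightarrow> 'f::field_char_0) \<Rightarrow> 'f \<Rightarrow> ('f \<Rightarrow> 'c) \<Rightarrow> ('k \<Rightarrow> 'c) set \<Rightarrow> 'c" where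
  "mu_measure R p r N v x \<psi> =
     (THE mu. is_measure R (O_dagger p r) mu \<and> amice p r mu = f_series R p r N v x \<psi>)"

end

(* The reduction of F at the primes dividing the ideal identifies chi with a nontrivial Dirichlet
   character mod N, so g(d) = chi(x + d.v) is N-periodic in each coordinate and sums to 0 over each
   coordinate. Hence g is a combination of products of one-variable functions
   e_c = [d = c] - [d = 0] (mod N), and everything reduces to dimension one. There the measure of
   l + p^n Z_p is -(1/N) sum_d d e_c(l + p^n d), and its Riemann sums against U^l, multiplied by
   1 - U^N, differ from U^c - 1 by an exact expression in W = U^(p^n) that tends to 0 as W tends
   to 1. Measures are determined by their Amice transforms because the indicator functions of
   residue classes mod p^n have integral Mahler expansions: the p^n-th difference of a p^n-periodic
   integer function is divisible by p. The second formula for the measure follows from the first by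
   shifting the window of summation in each coordinate. *)

theory Submission
  imports Defs "HOL-Number_Theory.Number_Theory"
begin

text \<open>The quotient is not formed by division in R[[t_1 - 1, ..., t_k - 1]]: the linear
  coefficient of 1 - t_i^(N p^r) is -N p^r, a nonunit of R as soon as r > 0. Division takes place
  over the field, as a recursion on coefficients that respects limits; integrality is read off from
  the measure, whose Riemann sums are integral. The term [d = 0] in e_c answers a pole: with U =
  t_i^(p^r), U^c / (1 - U^N) has a pole at t_i = 1, while (U^c - 1) / (1 - U^N) has none, and the
  vanishing of the coordinate sums makes the change free. In coefficients, W tends to 1 because
  those of positive degree m are at most p^(-n) / |m!|, a bound uniform only up to a fixed degree.
  The denominator p^r in the coordinates of x shifts levels: the one-dimensional measures are pushed
  forward along l -> a + p^r l, and cosets of p^n O_V become cells of level n + r. On the arithmetic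
  side O/I = Z/N lets positive rational integers represent all classes, so total positivity calls
  for no approximation theorem.\<close>

lemma ring_of_type_algebra_simps [simp]:
  "carrier whole = UNIV" "monoid.mult whole = (*)" "monoid.one whole = 1" "ring.zero whole = 0" "ring.add whole = (+)"
  by (simp_all add: ring_of_type_algebra_def)

lemma ring_of_integers_simps [simp]:
  "monoid.mult \<O> = (*)" "monoid.one \<O> = 1" "ring.zero \<O> = 0" "ring.add \<O> = (+)"
  by (simp_all add: \<O>_def)

lemma mem_carrier_O: "y \<in> carrier \<O> \<longleftrightarrow> algebraic_int y"
  by (simp add: \<O>_def)

subsection \<open>Residues and narrow ray classes\<close>

text \<open>Packages O/I = Z/N as two facts: I meets Z in NZ, and every algebraic integer of the
  field is congruent to a rational one. Arithmetic modulo I thereby reduces to integers modulo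
  N.\<close>

locale ray_modulus =
  fixes I :: "'f::field_char_0 set" and N :: nat
  assumes ideal: "ideal I \<O>" and N_gt_1: "N > 1"
    and of_int_mem_iff: "\<And>m. of_int m \<in> I \<longleftrightarrow> int N dvd m"
    and int_rep: "\<And>y. y \<in> carrier \<O> \<Longrightarrow> \<exists>m. y - of_int m \<in> I"
begin

interpretation I: ideal I \<O> by (rule ideal)

lemma O_closed:
  fixes a b :: 'f
  shows "of_int m \<in> carrier (\<O> :: 'f ring)" "0 \<in> carrier (\<O> :: 'f ring)" "1 \<in> carrier (\<O> :: 'f ring)"
    and "a \<in> carrier \<O> \<Longrightarrow> b \<in> carrier \<O> \<Longrightarrow> a + b \<in> carrier \<O>"
    and "a \<in> carrier \<O> \<Longrightarrow> b \<in> carrier \<O> \<Longrightarrow> a * b \<in> carrier \<O>"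
    and "a \<in> carrier \<O> \<Longrightarrow> - a \<in> carrier \<O>"
    and "a \<in> carrier \<O> \<Longrightarrow> b \<in> carrier \<O> \<Longrightarrow> a - b \<in> carrier \<O>"
proof -
  show of_int: "of_int m \<in> carrier (\<O> :: 'f ring)" for m by (simp add: mem_carrier_O)
  show mult: "a \<in> carrier \<O> \<Longrightarrow> b \<in> carrier \<O> \<Longrightarrow> a * b \<in> carrier \<O>" for a b :: 'f
    using I.m_closed[of a b] by simp
  show add: "a \<in> carrier \<O> \<Longrightarrow> b \<in> carrier \<O> \<Longrightarrow> a + b \<in> carrier \<O>" for a b :: 'f
    using I.add.m_closed[of a b] by simp
  show uminus: "a \<in> carrier \<O> \<Longrightarrow> - a \<in> carrier \<O>" for a :: 'f
    using mult[OF of_int[of "-1"], of a] by simp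
  show "a \<in> carrier \<O> \<Longrightarrow> b \<in> carrier \<O> \<Longrightarrow> a - b \<in> carrier \<O>"
    using add[OF _ uminus, of a b] by simp
qed (simp_all add: mem_carrier_O)

lemma I_subset: "a \<in> I \<Longrightarrow> a \<in> carrier \<O>"
  by (rule I.Icarr)

lemma I_closed:
  shows "0 \<in> I" and "a \<in> I \<Longrightarrow> b \<in> I \<Longrightarrow> a + b \<in> I" and "a \<in> I \<Longrightarrow> b \<in> carrier \<O> \<Longrightarrow> b * a \<in> I"
    and "a \<in> I \<Longrightarrow> b \<in> carrier \<O> \<Longrightarrow> a * b \<in> I"
    and "a \<in> I \<Longrightarrow> - a \<in> I" and "a \<in> I \<Longrightarrow> b \<in> I \<Longrightarrow> a - b \<in> I"
proof -
  show "0 \<in> I" using additive_subgroup.zero_closed[OF I.is_additive_subgroup] by simp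
  show add: "a \<in> I \<Longrightarrow> b \<in> I \<Longrightarrow> a + b \<in> I" for a b 
    using additive_subgroup.a_closed[OF I.is_additive_subgroup, of a b] by simp
  show mult: "a \<in> I \<Longrightarrow> b \<in> carrier \<O> \<Longrightarrow> b * a \<in> I" for a b using I.I_l_closed[of a b] by simp
  show "a \<in> I \<Longrightarrow> b \<in> carrier \<O> \<Longrightarrow> a * b \<in> I" using mult[of a b] by (simp add: mult.commute)
  show uminus: "a \<in> I \<Longrightarrow> - a \<in> I" for a
    using mult[of a "-1"] O_closed(1)[of "-1"] by simp
  show "a \<in> I \<Longrightarrow> b \<in> I \<Longrightarrow> a - b \<in> I" using add[OF _ uminus, of a b] by simp
qed

text \<open>Congruence of \<open>y\<close> to \<open>n\<close> in the semilocal ring at \<open>I\<close>, with the denominator normalised to be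
  congruent to 1.\<close>

definition residue :: "'f \<Rightarrow> int \<Rightarrow> bool" where
  "residue y n \<longleftrightarrow> (\<exists>b \<in> carrier \<O>. b - 1 \<in> I \<and> b * y \<in> carrier \<O> \<and> b * y - of_int n \<in> I)"

lemma residueE:
  assumes "residue y n"
  obtains a b where "a \<in> carrier \<O>" "b \<in> carrier \<O>" "b - 1 \<in> I" "b \<noteq> 0" "y = a / b" "a - of_int n \<in> I"
proof -
  obtain b where b: "b \<in> carrier \<O>" "b - 1 \<in> I" "b * y \<in> carrier \<O>" "b * y - of_int n \<in> I"
    using assms by (auto simp: residue_def)
  have "b \<noteq> 0"
  proof
    assume "b = 0"
    then have "of_int (-1) \<in> I" using b by simp
    then show False using N_gt_1 by (simp only: of_int_mem_iff) simp
  qed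
  then show ?thesis using that[of "b * y" b] b by auto
qed

lemma residueI:
  assumes "a \<in> carrier \<O>" "b \<in> carrier \<O>" "b - 1 \<in> I" "b \<noteq> 0" "y = a / b" "a - of_int n \<in> I"
  shows "residue y n"
  unfolding residue_def using assms by (intro bexI[of _ b]) auto

lemma residue_integral:
  assumes "a \<in> carrier \<O>" "a - of_int n \<in> I" shows "residue a n"
  using assms I_closed(1) O_closed(3) by (intro residueI[of a 1]) auto

lemma residue_of_int: "residue (of_int n) n"
  using I_closed(1) O_closed(1) by (intro residue_integral) auto

lemma one_cong_mult:
  assumes "b \<in> carrier \<O>" "b - 1 \<in> I" "c \<in> carrier \<O>" "c - 1 \<in> I"
  shows "b * c - 1 \<in> I"
proof -
  have "b * c - 1 = b * (c - 1) + (b - 1)" by (simp add: algebra_simps)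
  also have "\<dots> \<in> I" using assms by (blast intro: I_closed(2-4))
  finally show ?thesis .
qed

lemma residue_add:
  assumes "residue y n" "residue z m" shows "residue (y + z) (n + m)"
proof -
  obtain a b where ab: "a \<in> carrier \<O>" "b \<in> carrier \<O>" "b - 1 \<in> I" "b \<noteq> 0" "y = a / b" "a - of_int n \<in> I"
    using assms(1) by (rule residueE)
  obtain c d where cd: "c \<in> carrier \<O>" "d \<in> carrier \<O>" "d - 1 \<in> I" "d \<noteq> 0" "z = c / d" "c - of_int m \<in> I"
    using assms(2) by (rule residueE)
  have "a * d + c * b - of_int (n + m)
      = a * (d - 1) + c * (b - 1) + (a - of_int n) + (c - of_int m)"
    by (simp add: algebra_simps)
  also have "\<dots> \<in> I" using ab cd by (blast intro: I_closed(2-4))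
  finally show ?thesis
    using ab cd O_closed one_cong_mult[of b d]
    by (intro residueI[of "a * d + c * b" "b * d"]) (auto simp: field_simps)
qed

lemma residue_mult:
  assumes "residue y n" "residue z m" shows "residue (y * z) (n * m)"
proof -
  obtain a b where ab: "a \<in> carrier \<O>" "b \<in> carrier \<O>" "b - 1 \<in> I" "b \<noteq> 0" "y = a / b" "a - of_int n \<in> I"
    using assms(1) by (rule residueE)
  obtain c d where cd: "c \<in> carrier \<O>" "d \<in> carrier \<O>" "d - 1 \<in> I" "d \<noteq> 0" "z = c / d" "c - of_int m \<in> I"
    using assms(2) by (rule residueE)
  have "a * c - of_int (n * m) = a * (c - of_int m) + of_int m * (a - of_int n)"
    by (simp add: algebra_simps)
  also have "\<dots> \<in> I" using ab cd by (blast intro: I_closed(2-4) O_closed(1))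
  finally show ?thesis
    using ab cd O_closed one_cong_mult[of b d]
    by (intro residueI[of "a * c" "b * d"]) (auto simp: field_simps)
qed

lemma residue_diff:
  assumes "residue y n" "residue z m" shows "residue (y - z) (n - m)"
  using residue_add[OF assms(1) residue_mult[OF residue_of_int[of "-1"] assms(2)]] by simp

lemma residue_unique:
  assumes "residue y n" "residue y m" shows "[n = m] (mod int N)"
proof -
  have "residue 0 (n - m)" using residue_diff[OF assms] by simp
  then obtain a b where ab: "b \<noteq> 0" "0 = a / b" "a - of_int (n - m) \<in> I"
    by (rule residueE)
  then have "of_int (- (n - m)) \<in> I" by simp
  then have "int N dvd - (n - m)" by (simp only: of_int_mem_iff)
  then show ?thesis by (simp add: cong_iff_dvd_diff dvd_diff_commute)
qed

lemma residue_cong: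
  assumes "residue y n" "[n = m] (mod int N)" shows "residue y m"
proof -
  have "residue 0 (m - n)"
    using assms(2) of_int_mem_iff[of "n - m"]
    by (intro residue_integral O_closed(2)) (simp add: cong_iff_dvd_diff)
  then show ?thesis using residue_add[OF assms(1), of 0 "m - n"] by simp
qed

text \<open>Write y = a / b. In 1 / y = b / a the denominator is only congruent to n, so numerator
  and denominator are multiplied by m; the new denominator is congruent to 1, as
  \<open>residue\<close> requires.\<close>

lemma residue_inverse:
  assumes "residue y n" "[n * m = 1] (mod int N)" shows "y \<noteq> 0" "residue (1 / y) m"
proof -
  show "y \<noteq> 0"
  proof
    assume "y = 0"
    then have "[n = 0] (mod int N)" using residue_unique[OF assms(1), of 0] residue_of_int[of 0] by simp
    then have "[0 = 1] (mod int N)"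
      using assms(2) by (metis cong_scalar_right cong_sym cong_trans mult_zero_left)
    then show False using N_gt_1 by (simp add: cong_def)
  qed
  obtain a b where ab: "a \<in> carrier \<O>" "b \<in> carrier \<O>" "b - 1 \<in> I" "b \<noteq> 0" "y = a / b"
    "a - of_int n \<in> I"
    using assms(1) by (rule residueE)
  then have "a \<noteq> 0" using \<open>y \<noteq> 0\<close> by auto
  have "a * of_int m - 1 = (a - of_int n) * of_int m + of_int (n * m - 1)"
    by (simp add: algebra_simps)
  also have "\<dots> \<in> I"
    using ab assms(2) of_int_mem_iff[of "n * m - 1"]
    by (intro I_closed(2,4) O_closed(1)) (simp_all only: cong_iff_dvd_diff)
  finally have am: "a * of_int m - 1 \<in> I" .
  have "m \<noteq> 0" using assms(2) N_gt_1 by (auto simp: cong_def)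
  have "b * of_int m - of_int m = (b - 1) * of_int m" by (simp add: algebra_simps)
  also have "\<dots> \<in> I" using ab by (blast intro: I_closed(2-4) O_closed(1))
  finally have "b * of_int m - of_int m \<in> I" .
  then show "residue (1 / y) m"
    using ab am \<open>m \<noteq> 0\<close> \<open>a \<noteq> 0\<close>
    by (intro residueI[of "b * of_int m" "a * of_int m"] O_closed(1,5)) auto
qed

lemma residue_O_exists: "a \<in> carrier \<O> \<Longrightarrow> \<exists>n. residue a n"
  using int_rep residue_integral by blast

text \<open>Q is the preimage of (q) under O -> O/I = Z/N; divisibility of a residue by q does not
  depend on its choice because q divides N. These primes turn local conditions at the primes
  dividing I into divisibility of residues.\<close>

lemma primeideal_over:
  assumes q: "Factorial_Ring.prime q" "q dvd N"
  defines "Q \<equiv> {y \<in> carrier \<O>. \<exists>m. int q dvd m \<and> residue y m}"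
  shows "primeideal Q \<O>" "I \<subseteq> Q"
proof -
  have dvd_unique: "int q dvd n" if "residue y m" "int q dvd m" "residue y n" for y m n
  proof -
    have "[m = n] (mod int q)"
      using residue_unique[OF that(1,3)] by (rule cong_dvd_modulus) (use q(2) in simp)
    then show ?thesis using that(2) by (simp add: cong_dvd_iff)
  qed
  show "I \<subseteq> Q"
    using I_subset residue_integral[of _ 0] by (auto simp: Q_def intro!: exI[of _ 0])
  show "primeideal Q \<O>"
  proof (rule primeidealI)
    show "ideal Q \<O>"
    proof (rule idealI)
      show "ring (\<O> :: 'f ring)" by (rule I.ring_axioms)
      show "subgroup Q (add_monoid \<O>)"
      proof (rule I.add.subgroupI)
        show "Q \<noteq> {}" using O_closed(2) residue_of_int[of 0] by (auto simp: Q_def)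
        show "\<ominus>\<^bsub>\<O>\<^esub> a \<in> Q" if a: "a \<in> Q" for a
        proof -
          have "a \<in> carrier \<O>" using that by (simp add: Q_def)
          then have "\<ominus>\<^bsub>\<O>\<^esub> a = - a"
            using I.minus_equality[of "- a" a] O_closed(6) by simp
          moreover have "- a \<in> Q"
          proof -
            obtain m where "int q dvd m" "residue a m" using a by (auto simp: Q_def)
            then have "- a \<in> carrier \<O> \<and> int q dvd - m \<and> residue (- a) (- m)"
              using residue_diff[OF residue_of_int[of 0], of a m] O_closed(6)[OF \<open>a \<in> carrier \<O>\<close>]
              by simp
            then show ?thesis unfolding Q_def by blast
          qed
          ultimately show ?thesis by simp
        qed
        show "a \<oplus>\<^bsub>\<O>\<^esub> b \<in> Q" if ab: "a \<in> Q" "b \<in> Q" for a b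
        proof -
          obtain m n where "int q dvd m" "residue a m" "int q dvd n" "residue b n"
            using ab by (auto simp: Q_def)
          then have "a + b \<in> carrier \<O> \<and> int q dvd m + n \<and> residue (a + b) (m + n)"
            using residue_add O_closed(4) ab by (simp add: Q_def)
          then have "a + b \<in> Q" unfolding Q_def by blast
          then show ?thesis by simp
        qed
      qed (auto simp: Q_def)
      show "x \<otimes>\<^bsub>\<O>\<^esub> a \<in> Q" "a \<otimes>\<^bsub>\<O>\<^esub> x \<in> Q" if "a \<in> Q" "x \<in> carrier \<O>" for a x
      proof -
        obtain m n where "residue a m" "int q dvd m" "residue x n"
          using \<open>a \<in> Q\<close> residue_O_exists[OF \<open>x \<in> carrier \<O>\<close>] by (auto simp: Q_def)
        then have "a * x \<in> carrier \<O> \<and> int q dvd m * n \<and> residue (a * x) (m * n)"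
          using residue_mult O_closed(5) that by (simp add: Q_def)
        then have "a * x \<in> Q" unfolding Q_def by blast
        then show "x \<otimes>\<^bsub>\<O>\<^esub> a \<in> Q" "a \<otimes>\<^bsub>\<O>\<^esub> x \<in> Q" by (auto simp: mult.commute)
      qed
    qed
    show "cring (\<O> :: 'f ring)"
      by (rule cring.intro[OF I.ring_axioms])
         (auto intro!: comm_monoid.intro comm_monoid_axioms.intro I.monoid_axioms simp: mult.commute)
    show "carrier \<O> \<noteq> Q"
    proof
      assume "carrier \<O> = Q"
      then have "1 \<in> Q" using O_closed(3) by simp
      then obtain k where k: "int q dvd k" "residue 1 k" by (auto simp: Q_def)
      then have "int q dvd 1" using dvd_unique[OF k(2,1), of 1] residue_of_int[of 1] by simp
      then show False using q(1) not_prime_unit by auto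
    qed
    show "a \<in> Q \<or> b \<in> Q" if a: "a \<in> carrier \<O>" and b: "b \<in> carrier \<O>" and ab: "a \<otimes>\<^bsub>\<O>\<^esub> b \<in> Q" for a b
    proof -
      obtain m n where mn: "residue a m" "residue b n" using residue_O_exists a b by blast
      moreover obtain k where k: "int q dvd k" "residue (a * b) k"
        using ab by (auto simp: Q_def)
      ultimately have "int q dvd m * n"
        using dvd_unique[OF k(2,1) residue_mult[OF mn]] by simp
      then show ?thesis using mn a b q(1) by (auto simp: Q_def prime_dvd_mult_iff)
    qed
  qed
qed

text \<open>With m inverse to n modulo N, a * m - 1 lies in I and hence in Q; a in Q would then put
  1 in Q.\<close>

lemma residue_coprime_not_mem:
  assumes "Q \<in> primes_dividing I" "a \<in> carrier \<O>" "residue a n" "coprime n (int N)"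
  shows "a \<notin> Q"
proof
  assume "a \<in> Q"
  interpret Q: primeideal Q \<O> using assms(1) by (simp add: primes_dividing_def)
  obtain m where m: "[n * m = 1] (mod int N)" using cong_solve_coprime_int[OF assms(4)] by auto
  obtain c b where cb: "c \<in> carrier \<O>" "b \<in> carrier \<O>" "b \<noteq> 0" "b - 1 \<in> I" "a = c / b" "c - of_int n \<in> I"
    using assms(3) by (rule residueE)
  have "a * of_int m - 1 \<in> I"
  proof -
    have "a * of_int m - 1 = (c - of_int n) * of_int m + of_int (n * m - 1) - (b - 1) * a * of_int m"
      using cb by (simp add: field_simps)
    also have "\<dots> \<in> I"
      using cb(4,6) m assms(2) of_int_mem_iff[of "n * m - 1"]
      by (intro I_closed(6)[of _ "_ * _"] I_closed(2,4) O_closed(1)) (simp_all only: cong_iff_dvd_diff)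
    finally show ?thesis .
  qed
  then have "- (a * of_int m - 1) \<in> I" by (rule I_closed(5))
  then have "- (a * of_int m - 1) \<in> Q" using assms(1) unfolding primes_dividing_def by blast
  moreover have "a * of_int m \<in> Q"
    using Q.I_r_closed[OF \<open>a \<in> Q\<close> O_closed(1)[of m]] by simp
  ultimately have "1 \<in> Q" using additive_subgroup.a_closed[OF Q.is_additive_subgroup, of "a * of_int m" "- (a * of_int m - 1)"] by simp
  then show False using Q.one_imp_carrier Q.I_notcarr by simp
qed

text \<open>A common prime factor q of n and N yields the prime Q of \<open>primeideal_over\<close>:
  every integral multiple b * y has residue divisible by q, so y cannot be a unit at Q. Conversely,
  a numerator and a denominator with residues coprime to N avoid all primes over I.\<close>

lemma prime_to_iff:
  assumes "residue y n" shows "prime_to I y \<longleftrightarrow> coprime n (int N)"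
proof
  assume y: "prime_to I y"
  show "coprime n (int N)"
  proof (rule ccontr)
    assume "\<not> coprime n (int N)"
    then have "gcd n (int N) \<noteq> 1" unfolding coprime_iff_gcd_eq_1 .
    moreover have "gcd n (int N) = int (gcd (nat \<bar>n\<bar>) N)"
      by (simp only: gcd_int_def abs_of_nat nat_int)
    ultimately have "gcd (nat \<bar>n\<bar>) N \<noteq> 1" by (metis of_nat_1)
    then obtain q where q: "Factorial_Ring.prime q" "q dvd nat \<bar>n\<bar>" "q dvd N"
      using prime_factor_nat[of "gcd (nat \<bar>n\<bar>) N"] by (metis gcd_nat.boundedE)
    then have "int q dvd n" using int_dvd_int_iff[of q "nat \<bar>n\<bar>"] by simp
    define Q where "Q = {y \<in> carrier \<O>. \<exists>m. int q dvd m \<and> residue y m}"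
    have "Q \<in> primes_dividing I"
      using primeideal_over[OF q(1,3)] by (simp add: primes_dividing_def Q_def)
    then have "unit_at Q y" using y by (simp add: prime_to_def)
    then obtain a b where ab: "a \<in> carrier \<O>" "a \<notin> Q" "b \<in> carrier \<O>" "b \<notin> Q" "y = a / b"
      by (auto simp: unit_at_def)
    obtain m where m: "residue b m" using residue_O_exists ab(3) by blast
    have "b \<noteq> 0" using \<open>b \<notin> Q\<close> residue_of_int[of 0] O_closed(2) by (auto simp: Q_def)
    then have "residue a (m * n)" using residue_mult[OF m assms] ab(5) by simp
    then show False using ab(1,2) \<open>int q dvd n\<close> by (auto simp: Q_def)
  qed
next
  assume cop: "coprime n (int N)"
  obtain a b where ab: "a \<in> carrier \<O>" "b \<in> carrier \<O>" "b - 1 \<in> I" "b \<noteq> 0" "y = a / b" "a - of_int n \<in> I"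
    using assms by (rule residueE)
  then have "residue a n" "residue b 1" by (auto intro!: residue_integral)
  then have "a \<notin> Q \<and> b \<notin> Q" if "Q \<in> primes_dividing I" for Q
    using residue_coprime_not_mem[OF that] ab(1,2) cop by auto
  then show "prime_to I y" using ab(1,2,5) unfolding prime_to_def unit_at_def by blast
qed

lemma cong_ideal_iff: "cong_ideal I y z \<longleftrightarrow> residue (y - z) 0"
proof
  assume "cong_ideal I y z"
  then obtain a b where ab: "a \<in> I" "b \<in> carrier \<O>" "prime_to I b" "y - z = a / b"
    by (auto simp: cong_ideal_def)
  obtain n where n: "residue b n" using residue_O_exists ab(2) by blast
  obtain m where m: "[n * m = 1] (mod int N)"
    using prime_to_iff[OF n] ab(3) cong_solve_coprime_int by blast
  have "residue a 0" using I_subset ab(1) by (intro residue_integral) auto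
  then show "residue (y - z) 0" using residue_mult[OF _ residue_inverse(2)[OF n m], of a 0] ab(4) by simp
next
  assume "residue (y - z) 0"
  then obtain a b where ab: "a \<in> carrier \<O>" "b \<in> carrier \<O>" "b - 1 \<in> I" "b \<noteq> 0" "y - z = a / b"
    "a - of_int 0 \<in> I"
    by (rule residueE)
  moreover have "prime_to I b" using ab prime_to_iff[of b 1] residue_integral[of b 1] by simp
  ultimately show "cong_ideal I y z" by (auto simp: cong_ideal_def)
qed

text \<open>The residues of denominators of y form an ideal D of Z. If a prime q divided its
  generator, integrality of y at the prime over q would give a denominator outside that prime, so
  with residue prime to q. Hence 1 is in D, and a denominator b of residue 1 provides y = (b * y) /
  b with a residue.\<close>

lemma integral_at_imp_residue:
  assumes "\<forall>Q \<in> primes_dividing I. integral_at Q y"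
  shows "\<exists>n. residue y n"
proof -
  define D where "D = {n. \<exists>b \<in> carrier \<O>. b * y \<in> carrier \<O> \<and> residue b n}"
  have D_mult: "n * m \<in> D" if n: "n \<in> D" for n m
  proof -
    obtain b where "b \<in> carrier \<O>" "b * y \<in> carrier \<O>" "residue b n" using n by (auto simp: D_def)
    moreover have "of_int m * b * y \<in> carrier \<O>"
      using O_closed(5)[OF O_closed(1)[of m] \<open>b * y \<in> carrier \<O>\<close>] by (simp add: mult.assoc)
    ultimately have "of_int m * b \<in> carrier \<O> \<and> of_int m * b * y \<in> carrier \<O> \<and> residue (of_int m * b) (m * n)"
      using residue_mult[OF residue_of_int] O_closed(1,5) by blast
    then show ?thesis unfolding D_def mult.commute[of n m] by blast
  qed
  have D_add: "n + m \<in> D" if nm: "n \<in> D" "m \<in> D" for n m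
  proof -
    obtain b c where "b \<in> carrier \<O>" "b * y \<in> carrier \<O>" "residue b n"
      "c \<in> carrier \<O>" "c * y \<in> carrier \<O>" "residue c m" using nm by (auto simp: D_def)
    then have "b + c \<in> carrier \<O> \<and> (b + c) * y \<in> carrier \<O> \<and> residue (b + c) (n + m)"
      using residue_add O_closed(4) by (simp add: distrib_right)
    then show ?thesis unfolding D_def by blast
  qed
  \<comment> \<open>0 counts as a denominator and has N among its residues; so every prime factor of
    the generator of D divides N, which \<open>primeideal_over\<close> asks for.\<close>
  have "residue 0 (int N)" using residue_cong[OF residue_of_int[of 0]] by (simp add: cong_def)
  then have N_D: "int N \<in> D" using O_closed(2) by (auto simp: D_def intro!: bexI[of _ 0])
  have "\<exists>n \<in> D. \<forall>m \<in> D. n dvd m"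
  proof -
    define n where "n = (LEAST n. n > 0 \<and> int n \<in> D)"
    have n: "n > 0 \<and> int n \<in> D" unfolding n_def
      by (rule LeastI[of _ N]) (use N_D N_gt_1 in simp)
    have "int n dvd m" if "m \<in> D" for m
    proof (rule ccontr)
      assume "\<not> int n dvd m"
      then have "m mod int n \<noteq> 0" by (simp add: mod_eq_0_iff_dvd)
      moreover have "m mod int n \<ge> 0" using n by simp
      ultimately have "m mod int n > 0" by linarith
      moreover have "m + int n * - (m div int n) = m mod int n"
        using minus_mult_div_eq_mod[of m "int n"] by simp
      then have "m mod int n \<in> D"
        using D_add[OF that D_mult[of "int n" "- (m div int n)"]] n by simp
      moreover have "m mod int n < int n" using n by simp
      ultimately have "nat (m mod int n) < n \<and> nat (m mod int n) > 0 \<and> int (nat (m mod int n)) \<in> D"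
        by auto
      then show False unfolding n_def using not_less_Least by blast
    qed
    then show ?thesis using n by blast
  qed
  then obtain n where n: "n \<in> D" "\<And>m. m \<in> D \<Longrightarrow> n dvd m" by blast
  have "\<bar>n\<bar> = 1"
  proof (rule ccontr)
    assume "\<bar>n\<bar> \<noteq> 1"
    then have "nat \<bar>n\<bar> \<noteq> 1" by simp
    then obtain q where q: "Factorial_Ring.prime q" "q dvd nat \<bar>n\<bar>" using prime_factor_nat by blast
    have qn: "int q dvd m" if "m \<in> D" for m
      using n(2)[OF that] q(2) int_dvd_int_iff[of q "nat \<bar>n\<bar>"] by (simp add: dvd_trans)
    then have "q dvd N" using N_D int_dvd_int_iff by blast
    define Q where "Q = {y \<in> carrier \<O>. \<exists>m. int q dvd m \<and> residue y m}"
    have "Q \<in> primes_dividing I"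
      using primeideal_over[OF q(1) \<open>q dvd N\<close>] by (simp add: primes_dividing_def Q_def)
    then obtain a b where ab: "a \<in> carrier \<O>" "b \<in> carrier \<O>" "b \<notin> Q" "y = a / b"
      using assms by (auto simp: integral_at_def)
    obtain m where m: "residue b m" using residue_O_exists ab(2) by blast
    have "b \<noteq> 0" using \<open>b \<notin> Q\<close> residue_of_int[of 0] O_closed(2) by (auto simp: Q_def)
    then have "b * y \<in> carrier \<O>" using ab by simp
    then have "m \<in> D" using ab(2) m unfolding D_def by blast
    then show False using qn ab m by (auto simp: Q_def)
  qed
  then have "n * n = 1" by (metis abs_mult_self_eq mult_1)
  then have "1 \<in> D" using D_mult[OF n(1), of n] by simp
  then obtain b where b: "b \<in> carrier \<O>" "b * y \<in> carrier \<O>" "residue b 1" by (auto simp: D_def)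
  obtain m where m: "residue (b * y) m" using residue_O_exists b(2) by blast
  have "b \<noteq> 0" "residue (1 / b) 1" using residue_inverse[OF b(3), of 1] by auto
  then show ?thesis using residue_mult[OF m, of "1 / b" 1] by auto
qed

end

section \<open>Total positivity\<close>

lemma ring_hom_whole:
  assumes "\<sigma> \<in> ring_hom (whole :: 'a::ring_1 ring) (whole :: 'b::ring_1 ring)"
  shows "\<sigma> (a * b) = \<sigma> a * \<sigma> b" "\<sigma> (a + b) = \<sigma> a + \<sigma> b" "\<sigma> 1 = 1"
  using ring_hom_mult[OF assms, of a b] ring_hom_add[OF assms, of a b] ring_hom_one[OF assms] by simp_all

lemma totally_positive_of_nat:
  assumes "n > 0" shows "totally_positive (of_nat n :: 'f::field_char_0)"
  unfolding totally_positive_def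
proof
  fix \<sigma> assume \<sigma>: "\<sigma> \<in> ring_hom (whole :: 'f ring) (whole :: real ring)"
  have "\<sigma> (of_nat (Suc m)) = of_nat (Suc m)" for m
    by (induction m) (simp_all only: of_nat_Suc of_nat_0 add_0_right ring_hom_whole(2,3)[OF \<sigma>])
  from this[of "n - 1"] show "\<sigma> (of_nat n) > 0" using assms by simp
qed

lemma totally_positive_mult:
  "totally_positive y \<Longrightarrow> totally_positive z \<Longrightarrow> totally_positive (y * z)"
  by (simp add: totally_positive_def ring_hom_whole(1))

lemma totally_positive_inverse:
  fixes y :: "'f::field_char_0"
  assumes "totally_positive y" "y \<noteq> 0" shows "totally_positive (1 / y)"
  unfolding totally_positive_def
proof
  fix \<sigma> assume \<sigma>: "\<sigma> \<in> ring_hom (whole :: 'f ring) (whole :: real ring)"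
  have "\<sigma> (1 / y) * \<sigma> y = 1"
    using assms(2) by (simp add: ring_hom_whole(3)[OF \<sigma>] flip: ring_hom_whole(1)[OF \<sigma>])
  moreover have "\<sigma> y > 0" using assms(1) \<sigma> by (simp add: totally_positive_def)
  ultimately show "\<sigma> (1 / y) > 0" by (metis zero_less_mult_pos2 zero_less_one)
qed

section \<open>Cosets of the narrow ray in terms of residues\<close>

context ray_modulus
begin

interpretation I: ideal I \<O> by (rule ideal)

lemma ideal_prod_principal: "ideal_prod whole (principal u) (principal w) = principal (u * w :: 'f)"
proof
  show "ideal_prod whole (principal u) (principal w) \<subseteq> principal (u * w)"
  proof
    fix s assume "s \<in> ideal_prod whole (principal u) (principal w)"
    then show "s \<in> principal (u * w)"
    proof induction
      case (prod i j)
      then obtain a b where "a \<in> carrier \<O>" "b \<in> carrier \<O>" "i = u * a" "j = w * b"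
        by (auto simp: principal_def)
      then have "a * b \<in> carrier \<O>" "i * j = u * w * (a * b)" using O_closed(5) by auto
      then show ?case by (auto simp: principal_def)
    next
      case (sum s1 s2)
      then obtain a b where "a \<in> carrier \<O>" "b \<in> carrier \<O>" "s1 = u * w * a" "s2 = u * w * b"
        by (auto simp: principal_def)
      then have "a + b \<in> carrier \<O>" "s1 + s2 = u * w * (a + b)"
        using O_closed(4) by (auto simp: algebra_simps)
      then show ?case by (auto simp: principal_def)
    qed
  qed
next
  show "principal (u * w) \<subseteq> ideal_prod whole (principal u) (principal w)"
  proof
    fix s assume "s \<in> principal (u * w)"
    then obtain a where a: "a \<in> carrier \<O>" "s = u * w * a" by (auto simp: principal_def)
    then have "u * a \<in> principal u" "w * 1 \<in> principal w" "s = u * a * (w * 1)"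
      unfolding principal_def using O_closed(3) by (blast, blast, simp)
    then show "s \<in> ideal_prod whole (principal u) (principal w)"
      using ideal_prod.prod[of "u * a" "principal u" "w * 1" "principal w" whole] by simp
  qed
qed

lemma ray_ideals_simps:
  "monoid.mult (ray_ideals J) = ideal_prod whole"
  by (simp add: ray_ideals_def)

text \<open>Every coset of the narrow ray that arises here is of this form; the description depends on the
  residue class only.\<close>

definition ray_class :: "int \<Rightarrow> 'f set set" where
  "ray_class n = {principal u | u. totally_positive u \<and> residue u n}"

lemma ray_class_cong:
  assumes "[n = m] (mod int N)" shows "ray_class n = ray_class m"
  using residue_cong[OF _ assms] residue_cong[OF _ cong_sym[OF assms]]
  unfolding ray_class_def by blast

lemma coprime_inverse:
  assumes "coprime n (int N)" obtains m where "[n * m = 1] (mod int N)"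
  using cong_solve_coprime_int[OF assms] by auto

lemma residue_quotient:
  assumes "residue u (n * k)" "residue z n" "coprime n (int N)"
  shows "z \<noteq> 0" "residue (u / z) k"
proof -
  obtain m where m: "[n * m = 1] (mod int N)" using assms(3) by (rule coprime_inverse)
  show "z \<noteq> 0" using residue_inverse(1)[OF assms(2) m] .
  have "residue (u * (1 / z)) (n * k * m)"
    using residue_mult[OF assms(1) residue_inverse(2)[OF assms(2) m]] .
  moreover have "[n * k * m = k] (mod int N)"
    using cong_scalar_left[OF m, of k] by (simp add: algebra_simps)
  ultimately show "residue (u / z) k" using residue_cong by simp
qed

lemma narrow_ray_eq: "narrow_ray I = ray_class 1"
proof -
  have "y \<noteq> 0 \<and> totally_positive y \<and> cong_ideal I y 1 \<longleftrightarrow> totally_positive y \<and> residue y 1" for y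
  proof -
    have "cong_ideal I y 1 \<longleftrightarrow> residue y 1"
      using residue_add[of "y - 1" 0 1 1] residue_diff[of y 1 1 1] residue_of_int[of 1]
      by (auto simp: cong_ideal_iff)
    moreover have "residue y 1 \<Longrightarrow> y \<noteq> 0" using residue_inverse(1)[of y 1 1] by simp
    ultimately show ?thesis by blast
  qed
  then show ?thesis unfolding narrow_ray_def ray_class_def by simp
qed

text \<open>For u totally positive of residue n, the quotient u / z is totally positive of residue
  1, so (u) = (u / z)(z) lies in the coset: the coset remembers only n.\<close>

lemma narrow_ray_coset:
  assumes "totally_positive z" "residue z n" "coprime n (int N)"
  shows "narrow_ray I #>\<^bsub>ray_ideals I\<^esub> principal z = ray_class n"
proof -
  have "narrow_ray I #>\<^bsub>ray_ideals I\<^esub> principal z = {principal (w * z) | w. totally_positive w \<and> residue w 1}"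
    unfolding r_coset_def narrow_ray_eq ray_class_def
    by (auto simp: ray_ideals_simps ideal_prod_principal)
  also have "\<dots> = ray_class n"
  proof
    show "{principal (w * z) | w. totally_positive w \<and> residue w 1} \<subseteq> ray_class n"
      using assms totally_positive_mult residue_mult[of _ 1 z n] by (fastforce simp: ray_class_def)
    show "ray_class n \<subseteq> {principal (w * z) | w. totally_positive w \<and> residue w 1}"
    proof
      fix A assume "A \<in> ray_class n"
      then obtain u where u: "A = principal u" "totally_positive u" "residue u (n * 1)"
        by (auto simp: ray_class_def)
      then have z: "z \<noteq> 0" "residue (u / z) 1" using residue_quotient assms by blast+
      then have "totally_positive (u / z)"
        using totally_positive_mult[OF u(2) totally_positive_inverse[OF assms(1)]] by simp
      moreover have "A = principal (u / z * z)" using u z by simp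
      ultimately show "A \<in> {principal (w * z) | w. totally_positive w \<and> residue w 1}"
        using z(2) by blast
    qed
  qed
  finally show ?thesis .
qed

text \<open>Positive integers are totally positive, so each residue class contains a totally
  positive element. Adding N keeps k positive in the class of 0.\<close>

lemma positive_representative:
  obtains k where "k > 0" "[int k = n] (mod int N)"
proof
  show "nat (n mod int N) + N > 0" using N_gt_1 by simp
  show "[int (nat (n mod int N) + N) = n] (mod int N)" using N_gt_1 by (simp add: cong_def)
qed

lemma residue_of_nat: "residue (of_nat k) (int k)"
  using residue_of_int[of "int k"] by simp

text \<open>A positive integer witnesses the existence of z in \<open>unit_class\<close>; the
  description is unique because the coset of (z) depends on the residue of z alone.\<close>

lemma unit_class_eq:
  assumes "residue y n" "coprime n (int N)"
  shows "unit_class I y = ray_class n"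
  unfolding unit_class_def
proof (rule the_equality)
  obtain k where k: "k > 0" "[int k = n] (mod int N)" by (rule positive_representative)
  have res: "residue (of_nat k) n" using residue_cong[OF residue_of_nat k(2)] .
  moreover have "of_nat k \<in> carrier (\<O> :: 'f ring)" using O_closed(1)[of "int k"] by simp
  moreover have "cong_ideal I (of_nat k) y"
    using residue_diff[OF res assms(1)] by (simp add: cong_ideal_iff)
  ultimately show "\<exists>z\<in>carrier \<O>. totally_positive z \<and> cong_ideal I z y \<and>
      ray_class n = narrow_ray I #>\<^bsub>ray_ideals I\<^esub> principal z"
    using narrow_ray_coset[OF _ res assms(2)] totally_positive_of_nat[OF k(1)] by metis
next
  fix C assume "\<exists>z\<in>carrier \<O>. totally_positive z \<and> cong_ideal I z y \<and>
      C = narrow_ray I #>\<^bsub>ray_ideals I\<^esub> principal z"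
  then obtain z where z: "totally_positive z" "cong_ideal I z y" "C = narrow_ray I #>\<^bsub>ray_ideals I\<^esub> principal z"
    by blast
  then have "residue z n" using residue_add[of "z - y" 0 y n] assms(1) by (simp add: cong_ideal_iff)
  then show "C = ray_class n" using narrow_ray_coset z assms(2) by simp
qed

lemma ideal_principal:
  assumes "z \<in> carrier \<O>" shows "ideal (principal (z :: 'f)) \<O>"
proof -
  interpret cring "\<O> :: 'f ring"
    by (rule cring.intro[OF I.ring_axioms])
       (auto intro!: comm_monoid.intro comm_monoid_axioms.intro I.monoid_axioms simp: mult.commute)
  have "principal z = PIdl\<^bsub>\<O>\<^esub> z"
    by (auto simp: principal_def cgenideal_def mult.commute)
  then show ?thesis using cgenideal_ideal[OF assms] by simp
qed

text \<open>Needed to place the coset of (k) in the carrier of the class group. As a quotient of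
  integral ideals, (k) gets denominator O, and an inverse of k modulo N shows (k) + I = O.\<close>

lemma principal_in_ray_ideals:
  assumes "k > 0" "coprime (int k) (int N)"
  shows "principal (of_nat k :: 'f) \<in> carrier (ray_ideals I)"
proof -
  let ?z = "of_nat k :: 'f"
  have z: "?z \<in> carrier \<O>" "?z \<noteq> 0" using O_closed(1)[of "int k"] assms(1) by auto
  have sub: "principal ?z \<subseteq> carrier \<O>" using z O_closed(5) by (auto simp: principal_def)
  have mem: "?z * a \<in> principal ?z" if "a \<in> carrier \<O>" for a
    using that unfolding principal_def by blast
  have "fractional_ideal (principal ?z)"
    unfolding fractional_ideal_def
  proof (intro conjI ballI bexI[of _ 1])
    show "subgroup (principal ?z) (add_monoid whole)"
    proof -
      interpret W: ring "whole :: 'f ring" by rule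
      show ?thesis
      proof (rule W.add.subgroupI)
        show "principal ?z \<noteq> {}" using mem O_closed(3) by blast
        show "\<ominus>\<^bsub>whole\<^esub> a \<in> principal ?z" if a: "a \<in> principal ?z" for a
        proof -
          have "\<ominus>\<^bsub>whole\<^esub> a = - a" using W.minus_equality[of "- a" a] by simp
          moreover obtain b where "b \<in> carrier \<O>" "a = ?z * b" using a by (auto simp: principal_def)
          ultimately show ?thesis using mem[of "- b"] O_closed(6) by simp
        qed
        show "a \<oplus>\<^bsub>whole\<^esub> b \<in> principal ?z" if ab: "a \<in> principal ?z" "b \<in> principal ?z" for a b
        proof -
          obtain c d where "c \<in> carrier \<O>" "a = ?z * c" "d \<in> carrier \<O>" "b = ?z * d"
            using ab by (auto simp: principal_def)
          then show ?thesis using mem[of "c + d"] O_closed(4) by (simp add: distrib_left)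
        qed
      qed simp
    qed
    show "principal ?z \<noteq> {0}"
    proof
      assume "principal ?z = {0}"
      then have "?z * 1 \<in> {0}" using mem[OF O_closed(3)] by simp
      then show False using z(2) by simp
    qed
    show "a * y \<in> principal ?z" if a: "a \<in> carrier \<O>" and y: "y \<in> principal ?z" for a y
    proof -
      obtain b where "b \<in> carrier \<O>" "y = ?z * b" using y unfolding principal_def by blast
      then show ?thesis using mem[OF O_closed(5)[OF a]] by (simp add: mult.left_commute)
    qed
    show "1 * y \<in> carrier \<O>" if "y \<in> principal ?z" for y using that sub by auto
    show "1 \<in> carrier \<O> - {0 :: 'f}" using O_closed(3) by simp
  qed
  moreover have "coprime_ideals (principal ?z) I"
    unfolding coprime_ideals_def set_add_def'
  proof
    show "(\<Union>h\<in>principal ?z. \<Union>k\<in>I. {h \<oplus>\<^bsub>\<O>\<^esub> k}) \<subseteq> carrier \<O>"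
      using sub I_subset O_closed(4) by auto
    show "carrier \<O> \<subseteq> (\<Union>h\<in>principal ?z. \<Union>k\<in>I. {h \<oplus>\<^bsub>\<O>\<^esub> k})"
    proof
      fix y :: 'f assume y: "y \<in> carrier \<O>"
      obtain m where m: "[int k * m = 1] (mod int N)" using assms(2) by (rule coprime_inverse)
      have "of_int (1 - int k * m) * y \<in> I"
        using cong_sym[OF m] y of_int_mem_iff[of "1 - int k * m"]
        by (intro I_closed(4)) (simp_all only: cong_iff_dvd_diff)
      moreover have "?z * (of_int m * y) \<in> principal ?z" using mem O_closed(1,5) y by blast
      moreover have "y = ?z * (of_int m * y) + of_int (1 - int k * m) * y" by (simp add: algebra_simps)
      ultimately show "y \<in> (\<Union>h\<in>principal ?z. \<Union>k\<in>I. {h \<oplus>\<^bsub>\<O>\<^esub> k})" by auto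
    qed
  qed
  moreover have "coprime_ideals (carrier \<O>) I"
    unfolding coprime_ideals_def set_add_def'
  proof
    show "(\<Union>h\<in>carrier \<O>. \<Union>k\<in>I. {h \<oplus>\<^bsub>\<O>\<^esub> k}) \<subseteq> carrier \<O>"
      using I_subset O_closed(4) by auto
    show "carrier \<O> \<subseteq> (\<Union>h\<in>carrier \<O>. \<Union>k\<in>I. {h \<oplus>\<^bsub>\<O>\<^esub> k})"
      using I_closed(1) by force
  qed
  moreover have "ideal_prod whole (principal ?z) (carrier \<O>) = principal ?z"
    using ideal_prod_principal[of ?z 1] by (simp add: principal_def[of 1])
  ultimately show ?thesis
    using ideal_principal[OF z(1)] I.oneideal unfolding ray_ideals_def partial_object.simps by blast
qed

lemma ray_class_in_Cl_plus:
  assumes "coprime n (int N)" shows "ray_class n \<in> carrier (Cl_plus I)"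
proof -
  obtain k where k: "k > 0" "[int k = n] (mod int N)" by (rule positive_representative)
  have cop: "coprime (int k) (int N)" using assms cong_imp_coprime[OF cong_sym[OF k(2)]] by simp
  have "ray_class n = narrow_ray I #>\<^bsub>ray_ideals I\<^esub> principal (of_nat k)"
    using narrow_ray_coset[OF totally_positive_of_nat[OF k(1)] residue_cong[OF residue_of_nat k(2)] assms]
    by simp
  then show ?thesis
    using principal_in_ray_ideals[OF k(1) cop]
    unfolding Cl_plus_def FactGroup_def RCOSETS_def partial_object.simps by blast
qed

text \<open>A generator u of residue n * m splits as k * (u / k) with a positive integer k congruent
  to n; since n is invertible modulo N, u / k has residue m.\<close>

lemma ray_class_mult:
  assumes "coprime n (int N)"
  shows "ray_class n \<otimes>\<^bsub>Cl_plus I\<^esub> ray_class m = ray_class (n * m)"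
proof -
  have "ray_class n \<otimes>\<^bsub>Cl_plus I\<^esub> ray_class m =
    {principal (u * w) | u w. totally_positive u \<and> residue u n \<and> totally_positive w \<and> residue w m}"
    (is "_ = ?P")
  proof -
    have "ray_class n \<otimes>\<^bsub>Cl_plus I\<^esub> ray_class m =
      {ideal_prod whole A B | A B. A \<in> ray_class n \<and> B \<in> ray_class m}"
      unfolding Cl_plus_def FactGroup_def set_mult_def by (auto simp: ray_ideals_simps)
    also have "\<dots> = {ideal_prod whole (principal u) (principal w) | u w.
        totally_positive u \<and> residue u n \<and> totally_positive w \<and> residue w m}"
      unfolding ray_class_def by blast
    finally show ?thesis unfolding ideal_prod_principal .
  qed
  also have "\<dots> = ray_class (n * m)"
  proof
    show "{principal (u * w) | u w. totally_positive u \<and> residue u n \<and> totally_positive w \<and> residue w m}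
      \<subseteq> ray_class (n * m)"
      using totally_positive_mult residue_mult unfolding ray_class_def by blast
    show "ray_class (n * m) \<subseteq>
      {principal (u * w) | u w. totally_positive u \<and> residue u n \<and> totally_positive w \<and> residue w m}"
    proof
      fix A assume "A \<in> ray_class (n * m)"
      then obtain u where u: "A = principal u" "totally_positive u" "residue u (n * m)"
        by (auto simp: ray_class_def)
      obtain k where k: "k > 0" "[int k = n] (mod int N)" by (rule positive_representative)
      have res: "residue (of_nat k) n" using residue_cong[OF residue_of_nat k(2)] .
      have q: "residue (u / of_nat k) m" using residue_quotient(2)[OF u(3) res assms] .
      have "totally_positive (u / of_nat k)"
        using totally_positive_mult[OF u(2) totally_positive_inverse[OF totally_positive_of_nat[OF k(1)]]] k(1)
        by simp
      moreover have "A = principal (of_nat k * (u / of_nat k))" using u k(1) by simp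
      ultimately show "A \<in> {principal (u * w) | u w. totally_positive u \<and> residue u n \<and> totally_positive w \<and> residue w m}"
        using res q totally_positive_of_nat[OF k(1)] by blast
    qed
  qed
  finally show ?thesis .
qed

end

section \<open>The Dirichlet character attached to chi\<close>

locale ray_character = ray_modulus I N for I :: "'f::field_char_0 set" and N +
  fixes chi :: "'f set set \<Rightarrow> 'c::field_char_0"
  assumes chi_hom: "chi \<in> hom (Cl_plus I) (mult_of Qbar)"
    and nontrivial: "nontrivial_narrow_modulus chi I"
begin

definition dirichlet :: "int \<Rightarrow> 'c" where
  "dirichlet n = (if coprime n (int N) then chi (ray_class n) else 0)"

lemma chi_val_eq: "residue y n \<Longrightarrow> chi_val chi I y = dirichlet n"
  by (simp add: chi_val_def dirichlet_def prime_to_iff unit_class_eq)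

lemma dirichlet_cong: "[n = m] (mod int N) \<Longrightarrow> dirichlet n = dirichlet m"
  using ray_class_cong[of n m] cong_imp_coprime[of n m] cong_imp_coprime[of m n]
  by (auto simp: dirichlet_def cong_sym_eq)

lemma dirichlet_mult: "dirichlet (n * m) = dirichlet n * dirichlet m"
proof (cases "coprime n (int N) \<and> coprime m (int N)")
  case True
  then have "chi (ray_class n \<otimes>\<^bsub>Cl_plus I\<^esub> ray_class m) = chi (ray_class n) * chi (ray_class m)"
    using hom_mult[OF chi_hom] ray_class_in_Cl_plus by (auto simp: Qbar_def)
  then show ?thesis using True by (simp add: dirichlet_def ray_class_mult)
next
  case False
  then show ?thesis by (auto simp: dirichlet_def)
qed

lemma dirichlet_nonzero: "coprime n (int N) \<Longrightarrow> dirichlet n \<noteq> 0"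
  using hom_in_carrier[OF chi_hom ray_class_in_Cl_plus] by (simp add: dirichlet_def Qbar_def)

lemma dirichlet_1: "dirichlet 1 = 1"
  using dirichlet_mult[of 1 1] dirichlet_nonzero[of 1] by simp

text \<open>By Euler's theorem. That the values of chi have p-adic absolute value at most 1 will
  follow from this.\<close>

lemma dirichlet_root_of_unity: "dirichlet n = 0 \<or> dirichlet n ^ totient N = 1"
proof (cases "coprime n (int N)")
  case True
  obtain k where k: "k > 0" "[int k = n] (mod int N)" by (rule positive_representative)
  have "coprime k N"
    using True cong_imp_coprime[OF cong_sym[OF k(2)]] by simp
  then have "[int (k ^ totient N) = int 1] (mod int N)"
    using euler_theorem[of k N] cong_int_iff by blast
  moreover have "dirichlet (int k ^ j) = dirichlet (int k) ^ j" for j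
    by (induction j) (simp_all add: dirichlet_1 dirichlet_mult)
  ultimately have "dirichlet (int k) ^ totient N = 1"
    using dirichlet_cong[of "int k ^ totient N" 1] dirichlet_1 by simp
  then show ?thesis using dirichlet_cong[OF k(2)] by simp
qed (simp add: dirichlet_def)

lemma dirichlet_values: "dirichlet n \<in> insert 0 (chi ` carrier (Cl_plus I))"
  using ray_class_in_Cl_plus by (auto simp: dirichlet_def)

lemma dirichlet_nontrivial: "\<exists>a. coprime a (int N) \<and> dirichlet a \<noteq> 1"
proof -
  obtain y where y: "y \<in> carrier \<O>" "prime_to I y" "chi (unit_class I y) \<noteq> 1"
    using nontrivial by (auto simp: nontrivial_narrow_modulus_def)
  obtain n where n: "residue y n" using residue_O_exists[OF y(1)] by blast
  then have "coprime n (int N)" using prime_to_iff y(2) by blast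
  then show ?thesis using unit_class_eq[OF n] y(3) by (auto simp: dirichlet_def)
qed

text \<open>Since w is a unit modulo N, j -> e + j * w permutes the residue classes.\<close>

lemma sum_dirichlet_affine:
  assumes "coprime w (int N)"
  shows "(\<Sum>j<N. dirichlet (e + int j * w)) = (\<Sum>j<N. dirichlet (int j))"
proof -
  define h where "h j = nat ((e + int j * w) mod int N)" for j
  have h: "[int (h j) = e + int j * w] (mod int N)" for j
    using N_gt_1 by (simp add: h_def cong_def)
  have "inj_on h {..<N}"
  proof
    fix i j assume ij: "i \<in> {..<N}" "j \<in> {..<N}" "h i = h j"
    then have "[e + int i * w = e + int j * w] (mod int N)" using h by (metis cong_sym cong_trans)
    then have "[int i = int j] (mod int N)"
      using assms by (simp add: cong_add_lcancel cong_mult_rcancel)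
    then show "i = j" using ij by (simp add: cong_def)
  qed
  moreover have "h ` {..<N} \<subseteq> {..<N}" using N_gt_1 by (auto simp: h_def nat_less_iff)
  ultimately have "bij_betw h {..<N} {..<N}"
    by (simp add: bij_betw_def endo_inj_surj)
  then have "(\<Sum>j<N. dirichlet (int (h j))) = (\<Sum>j<N. dirichlet (int j))"
    by (rule sum.reindex_bij_betw)
  then show ?thesis using dirichlet_cong[OF h] by simp
qed

text \<open>Orthogonality: multiplication by an a with \<open>dirichlet a\<close> different from 1
  permutes the classes, yet scales the complete sum by \<open>dirichlet a\<close>.\<close>

lemma sum_dirichlet_zero:
  assumes "coprime w (int N)" shows "(\<Sum>j<N. dirichlet (e + int j * w)) = 0"
proof -
  obtain a where a: "coprime a (int N)" "dirichlet a \<noteq> 1" using dirichlet_nontrivial by blast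
  have "dirichlet a * (\<Sum>j<N. dirichlet (int j)) = (\<Sum>j<N. dirichlet (0 + int j * a))"
    by (simp add: sum_distrib_left dirichlet_mult mult.commute)
  also have "\<dots> = (\<Sum>j<N. dirichlet (int j))" by (rule sum_dirichlet_affine[OF a(1)])
  finally have "(\<Sum>j<N. dirichlet (int j)) = 0" using a(2) by simp
  then show ?thesis using sum_dirichlet_affine[OF assms] by simp
qed

lemma residue_lin:
  assumes "residue x e" "\<And>i. residue (v i) (w i)"
  shows "residue (x + lin v d) (e + (\<Sum>i\<in>UNIV. int (d i) * w i))"
proof -
  have "residue (\<Sum>i\<in>A. of_nat (d i) * v i) (\<Sum>i\<in>A. int (d i) * w i)" if "finite A" for A
    using that
  proof induction
    case empty
    show ?case using residue_of_int[of 0] by simp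
  next
    case (insert i A)
    then show ?case using residue_add[OF residue_mult[OF residue_of_nat assms(2)]] by simp
  qed
  then show ?thesis using residue_add[OF assms(1)] by (simp add: lin_def)
qed

end

section \<open>The isomorphism of O/I with Z/N on rational integers\<close>

lemma (in cring) quotient_hom:
  assumes "ideal J R"
  shows "(+>) J \<in> ring_hom R (R Quot J)"
    and "carrier (R Quot J) = (+>) J ` carrier R"
    and "a \<in> carrier R \<Longrightarrow> b \<in> carrier R \<Longrightarrow> J +> a = J +> b \<longleftrightarrow> a \<ominus> b \<in> J"
  using ideal.rcos_ring_hom[OF assms] quotient_eq_iff_same_a_r_cos[OF assms]
  by (auto simp: FactRing_def A_RCOSETS_def')

text \<open>The composite Z -> O -> O/I -> Z/N and the canonical projection are both ring
  homomorphisms on Z, hence equal. Comparing kernels gives the first claim, surjectivity of the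
  projection the second.\<close>

lemma quotient_integers:
  fixes I :: "'f::field_char_0 set"
  assumes I: "ideal I \<O>" and iso: "\<O> Quot I \<simeq> ZFact (int N)"
  shows "of_int m \<in> I \<longleftrightarrow> int N dvd m"
    and "y \<in> carrier \<O> \<Longrightarrow> \<exists>m. y - of_int m \<in> I"
proof -
  interpret I: ideal I "\<O>" by (rule I)
  interpret O: cring "\<O> :: 'f ring"
    by (rule cring.intro[OF I.ring_axioms])
       (auto intro!: comm_monoid.intro comm_monoid_axioms.intro I.monoid_axioms simp: mult.commute)
  interpret Z: cring "ZFact (int N)" by (rule ZFact_is_cring)
  let ?J = "Idl\<^bsub>\<Z>\<^esub> {int N}"
  have J: "ideal ?J \<Z>" by (simp add: int.genideal_ideal)
  define k where "k = (+>\<^bsub>\<Z>\<^esub>) ?J"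
  have k: "k \<in> ring_hom \<Z> (ZFact (int N))" "carrier (ZFact (int N)) = range k"
    "k a = k b \<longleftrightarrow> int N dvd a - b" for a b
  proof -
    show "k \<in> ring_hom \<Z> (ZFact (int N))" "carrier (ZFact (int N)) = range k"
      using int.quotient_hom(1,2)[OF J] by (simp_all add: k_def ZFact_def)
    show "k a = k b \<longleftrightarrow> int N dvd a - b"
      using int.quotient_hom(3)[OF J, of a b] int_Idl[of "int N"]
      by (auto simp: k_def dvd_def mult.commute)
  qed
  obtain h where h: "h \<in> ring_hom (\<O> Quot I) (ZFact (int N))"
    "bij_betw h (carrier (\<O> Quot I)) (carrier (ZFact (int N)))"
    using iso by (auto simp: is_ring_iso_def ring_iso_def)
  define g where "g = h \<circ> (+>\<^bsub>\<O>\<^esub>) I"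
  have g: "g \<in> ring_hom \<O> (ZFact (int N))"
    unfolding g_def by (rule ring_hom_trans[OF O.quotient_hom(1)[OF I] h(1)])
  have of_int: "of_int n \<in> carrier (\<O> :: 'f ring)" for n by (simp add: mem_carrier_O)
  have minus: "a \<ominus>\<^bsub>\<O>\<^esub> b = a - b" if "a \<in> carrier \<O>" "b \<in> carrier \<O>" for a b :: 'f
  proof -
    have "- b \<in> carrier \<O>" using I.m_closed[OF of_int[of "-1"] that(2)] by simp
    then have "\<ominus>\<^bsub>\<O>\<^esub> b = - b" using I.minus_equality[of "- b" b] that(2) by simp
    then show ?thesis by (simp add: a_minus_def)
  qed
  have g_eq: "g a = g b \<longleftrightarrow> a - b \<in> I" if ab: "a \<in> carrier \<O>" "b \<in> carrier \<O>" for a b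
  proof -
    have "g a = g b \<longleftrightarrow> I +>\<^bsub>\<O>\<^esub> a = I +>\<^bsub>\<O>\<^esub> b"
      using bij_betw_imp_inj_on[OF h(2)] ab O.quotient_hom(2)[OF I] by (auto simp: g_def dest: inj_onD)
    then show ?thesis using O.quotient_hom(3)[OF I ab] minus[OF ab] by simp
  qed
  have g_of_int: "g (of_int n) = k n" for n
  proof (induction n rule: int_induct[where k = 0])
    case base
    have "g 0 = \<zero>\<^bsub>ZFact (int N)\<^esub>"
      using ring_hom_zero[OF g] I.ring_axioms Z.ring_axioms by simp
    moreover have "k 0 = \<zero>\<^bsub>ZFact (int N)\<^esub>"
      using ring_hom_zero[OF k(1)] int.ring_axioms Z.ring_axioms by simp
    ultimately show ?case by simp
  next
    case (step1 i)
    have "g (of_int i + 1) = g (of_int i) \<oplus>\<^bsub>ZFact (int N)\<^esub> \<one>\<^bsub>ZFact (int N)\<^esub>"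
      using ring_hom_add[OF g of_int[of i] of_int[of 1]] ring_hom_one[OF g] by simp
    moreover have "k (i + 1) = k i \<oplus>\<^bsub>ZFact (int N)\<^esub> \<one>\<^bsub>ZFact (int N)\<^esub>"
      using ring_hom_add[OF k(1), of i 1] ring_hom_one[OF k(1)] by simp
    ultimately show ?case using step1 by simp
  next
    case (step2 i)
    have "g (of_int (i - 1) + 1) = g (of_int (i - 1)) \<oplus>\<^bsub>ZFact (int N)\<^esub> \<one>\<^bsub>ZFact (int N)\<^esub>"
      using ring_hom_add[OF g of_int[of "i - 1"] of_int[of 1]] ring_hom_one[OF g] by simp
    moreover have "k (i - 1 + 1) = k (i - 1) \<oplus>\<^bsub>ZFact (int N)\<^esub> \<one>\<^bsub>ZFact (int N)\<^esub>"
      using ring_hom_add[OF k(1), of "i - 1" 1] ring_hom_one[OF k(1)] by simp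
    ultimately have "g (of_int (i - 1)) \<oplus>\<^bsub>ZFact (int N)\<^esub> \<one>\<^bsub>ZFact (int N)\<^esub>
        = k (i - 1) \<oplus>\<^bsub>ZFact (int N)\<^esub> \<one>\<^bsub>ZFact (int N)\<^esub>"
      using step2 by simp
    then show ?case
      using Z.add.r_cancel[of "g (of_int (i - 1))" "\<one>\<^bsub>ZFact (int N)\<^esub>" "k (i - 1)"]
        ring_hom_closed[OF g of_int[of "i - 1"]] ring_hom_closed[OF k(1), of "i - 1"] by simp
  qed
  show "of_int m \<in> I \<longleftrightarrow> int N dvd m"
    using g_eq[OF of_int[of m] of_int[of 0]] g_of_int[of m] g_of_int[of 0] k(3)[of m 0] by simp
  show "\<exists>m. y - of_int m \<in> I" if y: "y \<in> carrier \<O>"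
  proof -
    have "g y \<in> range k" using ring_hom_closed[OF g y] k(2) by simp
    then obtain m where "g y = g (of_int m)" using g_of_int by auto
    then show ?thesis using g_eq[OF y of_int] by blast
  qed
qed

text \<open>Write 1 = a + c p with a in I and replace c by a congruent integer m: then N divides 1 -
  m p. This gives coprimality and excludes N = 0, as p is no unit of Z; N = 1 would put 1 in
  I.\<close>

lemma ray_modulus_quotient:
  fixes I :: "'f::field_char_0 set"
  assumes I: "ideal I \<O>" "I \<noteq> carrier \<O>" and iso: "\<O> Quot I \<simeq> ZFact (int N)"
    and p: "p > 1" "coprime_ideals I (PIdl\<^bsub>\<O>\<^esub> (of_nat p))"
  shows "ray_modulus I N" "coprime p N"
proof -
  interpret I: ideal I \<O> by (rule I)
  have "1 \<in> carrier (\<O> :: 'f ring)" by (simp add: mem_carrier_O)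
  then have "1 \<in> I <+>\<^bsub>\<O>\<^esub> PIdl\<^bsub>\<O>\<^esub> (of_nat p)" using p(2) by (simp add: coprime_ideals_def)
  then obtain a c where ac: "a \<in> I" "c \<in> carrier \<O>" "1 = a + c * of_nat p"
    by (auto simp: set_add_def' cgenideal_def)
  obtain m where m: "c - of_int m \<in> I" using quotient_integers(2)[OF I(1) iso ac(2)] by blast
  have "of_nat p \<in> carrier (\<O> :: 'f ring)" by (simp add: mem_carrier_O)
  then have "(c - of_int m) * of_nat p \<in> I" using I.I_r_closed[OF m] by simp
  then have "a + (c - of_int m) * of_nat p \<in> I"
    using additive_subgroup.a_closed[OF I.is_additive_subgroup ac(1)] by simp
  also have "a + (c - of_int m) * of_nat p = of_int (1 - m * int p)"
    using ac(3) by (simp add: algebra_simps)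
  finally have dvd: "int N dvd 1 - m * int p" using quotient_integers(1)[OF I(1) iso] by blast
  have "coprime (int p) (int N)"
  proof (rule coprimeI)
    fix d assume "d dvd int p" "d dvd int N"
    then have "d dvd (1 - m * int p) + m * int p" using dvd by (intro dvd_add) auto
    then show "is_unit d" by simp
  qed
  then show "coprime p N" by simp
  have "N \<noteq> 0"
  proof
    assume "N = 0"
    then have "int p dvd 1" using dvd by (metis dvd_0_left_iff dvd_triv_right eq_iff_diff_eq_0 of_nat_0)
    then show False using p(1) by simp
  qed
  moreover have "N \<noteq> 1"
  proof
    assume "N = 1"
    then have "of_int 1 \<in> I" using quotient_integers(1)[OF I(1) iso, of 1] by simp
    then have "\<one>\<^bsub>\<O>\<^esub> \<in> I" by simp
    then show False using I.one_imp_carrier I(2) by blast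
  qed
  ultimately show "ray_modulus I N"
    using I quotient_integers[OF I(1) iso] by (intro ray_modulus.intro) auto
qed

section \<open>Values of chi at the points x + d.v\<close>

context ray_character
begin

text \<open>The w i are units modulo N because each v i is prime to I. Periodicity and vanishing
  coordinate sums are thereby statements on a Dirichlet character along an affine form.\<close>

lemma chi_val_lin:
  assumes x: "\<forall>Q \<in> primes_dividing I. integral_at Q x"
    and v: "\<And>i. v i \<in> carrier \<O>" "\<And>i. prime_to I (v i)"
  shows "\<exists>e w. (\<forall>d. chi_val chi I (x + lin v d) = dirichlet (e + (\<Sum>i\<in>UNIV. int (d i) * w i)))
    \<and> (\<forall>i. coprime (w i) (int N))"
proof -
  obtain e where e: "residue x e" using integral_at_imp_residue[OF x] by blast
  have "\<forall>i. \<exists>w. residue (v i) w" using v(1) residue_O_exists by blast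
  then obtain w where w: "\<And>i. residue (v i) (w i)" by metis
  show ?thesis
  proof (intro exI conjI allI)
    show "chi_val chi I (x + lin v d) = dirichlet (e + (\<Sum>i\<in>UNIV. int (d i) * w i))" for d
      by (rule chi_val_eq[OF residue_lin[OF e w]])
    show "coprime (w i) (int N)" for i using prime_to_iff[OF w] v(2) by blast
  qed
qed

lemma chi_val_lin_periodic:
  assumes x: "\<forall>Q \<in> primes_dividing I. integral_at Q x"
    and v: "\<And>i. v i \<in> carrier \<O>" "\<And>i. prime_to I (v i)"
    and "\<And>i. [d i = d' i] (mod N)"
  shows "chi_val chi I (x + lin v d) = chi_val chi I (x + lin v d')"
proof -
  obtain e w where ew: "\<And>d. chi_val chi I (x + lin v d) = dirichlet (e + (\<Sum>i\<in>UNIV. int (d i) * w i))"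
    "\<And>i. coprime (w i) (int N)"
    using chi_val_lin[where x = x and v = v, OF x v] by blast
  have "[e + (\<Sum>i\<in>UNIV. int (d i) * w i) = e + (\<Sum>i\<in>UNIV. int (d' i) * w i)] (mod int N)"
    using assms(4) by (intro cong_add cong_sum cong_mult cong_refl) (simp add: cong_int_iff)
  then show ?thesis unfolding ew(1) by (rule dirichlet_cong)
qed

lemma sum_chi_val_lin:
  fixes d :: "'k::finite \<Rightarrow> nat"
  assumes x: "\<forall>Q \<in> primes_dividing I. integral_at Q x"
    and v: "\<And>i. v i \<in> carrier \<O>" "\<And>i. prime_to I (v i)"
  shows "(\<Sum>j<N. chi_val chi I (x + lin v (d(i := j)))) = 0"
proof -
  obtain e w where ew: "\<And>d. chi_val chi I (x + lin v d) = dirichlet (e + (\<Sum>i\<in>UNIV. int (d i) * w i))"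
    "\<And>i. coprime (w i) (int N)"
    using chi_val_lin[where x = x and v = v, OF x v] by blast
  have "(\<Sum>i'\<in>UNIV. int ((d(i := j)) i') * w i') = (\<Sum>i'\<in>UNIV - {i}. int (d i') * w i') + int j * w i"
    for j
  proof -
    have "(\<Sum>i'\<in>UNIV - {i}. int ((d(i := j)) i') * w i') = (\<Sum>i'\<in>UNIV - {i}. int (d i') * w i')"
      by (rule sum.cong) auto
    then show ?thesis by (subst sum.remove[of _ i]) simp_all
  qed
  then show ?thesis
    unfolding ew(1) using sum_dirichlet_zero[OF ew(2)[of i], of "e + (\<Sum>i'\<in>UNIV - {i}. int (d i') * w i')"]
    by (simp add: add.assoc)
qed

lemma chi_val_lin_values:
  assumes x: "\<forall>Q \<in> primes_dividing I. integral_at Q x"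
    and v: "\<And>i. v i \<in> carrier \<O>" "\<And>i. prime_to I (v i)"
  shows "chi_val chi I (x + lin v d) \<in> insert 0 (chi ` carrier (Cl_plus I))"
    and "chi_val chi I (x + lin v d) = 0 \<or> chi_val chi I (x + lin v d) ^ totient N = 1"
proof -
  obtain e w where ew: "\<And>d. chi_val chi I (x + lin v d) = dirichlet (e + (\<Sum>i\<in>UNIV. int (d i) * w i))"
    "\<And>i. coprime (w i) (int N)"
    using chi_val_lin[where x = x and v = v, OF x v] by blast
  show "chi_val chi I (x + lin v d) \<in> insert 0 (chi ` carrier (Cl_plus I))"
    unfolding ew(1) by (rule dirichlet_values)
  show "chi_val chi I (x + lin v d) = 0 \<or> chi_val chi I (x + lin v d) ^ totient N = 1"
    unfolding ew(1) by (rule dirichlet_root_of_unity)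
qed

end

lemma primes_dividing_ideal_prod:
  assumes "ideal I \<O>" "ideal J \<O>"
  shows "primes_dividing I \<subseteq> primes_dividing (ideal_prod \<O> I J)"
proof -
  interpret I: ideal I \<O> by (rule assms)
  show ?thesis using I.ideal_prod_inter[OF assms] by (auto simp: primes_dividing_def)
qed

subsection \<open>The p-adic absolute value\<close>

locale p_adic =
  fixes p :: nat and T :: "'c::{field_char_0,complete_space} itself"
  assumes prime_p: "Factorial_Ring.prime p" and C_p: "is_C_p T p"
begin

lemma p_gt_1: "p > 1" using prime_p by (rule prime_gt_1_nat)

lemma coprime_p: "\<not> int p dvd m \<Longrightarrow> coprime m (int p)"
  using prime_imp_coprime[of "int p" m] prime_p by (simp add: coprime_commute)

lemma dist_cp: "dist y z = cp_abs (y - z)" for y z :: 'c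
  using C_p by (simp add: is_C_p_def)

lemma cp_abs_mult: "cp_abs (y * z) = cp_abs y * cp_abs z" for y z :: 'c
  using C_p by (simp add: is_C_p_def)

lemma cp_abs_add: "cp_abs (y + z) \<le> max (cp_abs y) (cp_abs z)" for y z :: 'c
  using C_p by (simp add: is_C_p_def)

lemma cp_abs_p: "cp_abs (of_nat p :: 'c) = 1 / real p"
  using C_p by (simp add: is_C_p_def)

lemma cp_abs_nonneg [simp]: "cp_abs (y :: 'c) \<ge> 0" by (simp add: cp_abs_def)

lemma cp_abs_eq_0 [simp]: "cp_abs (y :: 'c) = 0 \<longleftrightarrow> y = 0" by (simp add: cp_abs_def)

lemma cp_abs_0 [simp]: "cp_abs (0 :: 'c) = 0" by simp

lemma cp_abs_1 [simp]: "cp_abs (1 :: 'c) = 1"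
  using cp_abs_mult[of 1 1] by simp

lemma cp_abs_minus [simp]: "cp_abs (- y :: 'c) = cp_abs y"
proof -
  have "cp_abs (- 1 :: 'c) * cp_abs (- 1 :: 'c) = 1" using cp_abs_mult[of "- 1" "- 1"] by simp
  then have "cp_abs (- 1 :: 'c) = 1"
    using cp_abs_nonneg[of "- 1"] unfolding square_eq_1_iff by linarith
  then show ?thesis using cp_abs_mult[of "- 1" y] by simp
qed

lemma cp_abs_diff: "cp_abs (y - z :: 'c) \<le> max (cp_abs y) (cp_abs z)"
  using cp_abs_add[of y "- z"] by simp

lemma cp_abs_commute: "cp_abs (y - z :: 'c) = cp_abs (z - y)"
  using cp_abs_minus[of "y - z"] by simp

lemma cp_abs_add_le: "cp_abs y \<le> e \<Longrightarrow> cp_abs z \<le> e \<Longrightarrow> cp_abs (y + z :: 'c) \<le> e"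
  using cp_abs_add[of y z] by simp

lemma cp_abs_diff_le: "cp_abs y \<le> e \<Longrightarrow> cp_abs z \<le> e \<Longrightarrow> cp_abs (y - z :: 'c) \<le> e"
  using cp_abs_diff[of y z] by simp

lemma cp_abs_triangle_le:
  "cp_abs (y - w) \<le> e \<Longrightarrow> cp_abs (w - z) \<le> e \<Longrightarrow> cp_abs (y - z :: 'c) \<le> e"
  using cp_abs_add_le[of "y - w" e "w - z"] by simp

lemma cp_abs_power: "cp_abs (y ^ n :: 'c) = cp_abs y ^ n"
  by (induction n) (simp_all add: cp_abs_mult)

lemma cp_abs_divide: "cp_abs (y / z :: 'c) = cp_abs y / cp_abs z"
proof (cases "z = 0")
  case False
  have "cp_abs (y / z) * cp_abs z = cp_abs y" using False by (simp flip: cp_abs_mult)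
  then show ?thesis using False by (simp add: field_simps)
qed simp

lemma cp_abs_prod: "cp_abs (\<Prod>i\<in>A. f i :: 'c) = (\<Prod>i\<in>A. cp_abs (f i))"
  by (induction A rule: infinite_finite_induct) (simp_all add: cp_abs_mult)

lemma cp_abs_sum_le:
  assumes "\<And>i. i \<in> A \<Longrightarrow> cp_abs (f i :: 'c) \<le> e" "e \<ge> 0" shows "cp_abs (\<Sum>i\<in>A. f i) \<le> e"
  using assms
proof (induction A rule: infinite_finite_induct)
  case (insert i A)
  then show ?case by (simp add: cp_abs_add_le)
qed simp_all

lemma cp_abs_mult_le: "cp_abs y \<le> e \<Longrightarrow> cp_abs z \<le> 1 \<Longrightarrow> cp_abs (y * z :: 'c) \<le> e"
  using mult_mono[of "cp_abs y" e "cp_abs z" 1] order_trans[OF cp_abs_nonneg[of y], of e]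
  by (simp add: cp_abs_mult)

lemma cp_abs_prod_le_1:
  assumes "\<And>i. i \<in> A \<Longrightarrow> cp_abs (f i :: 'c) \<le> 1" shows "cp_abs (\<Prod>i\<in>A. f i) \<le> 1"
  unfolding cp_abs_prod using assms by (intro prod_le_1) auto

lemma cp_abs_prod_diff:
  assumes "\<And>i. i \<in> A \<Longrightarrow> cp_abs (f i :: 'c) \<le> 1" "\<And>i. i \<in> A \<Longrightarrow> cp_abs (g i) \<le> 1"
    and "\<And>i. i \<in> A \<Longrightarrow> cp_abs (f i - g i) \<le> e" "e \<ge> 0"
  shows "cp_abs ((\<Prod>i\<in>A. f i) - (\<Prod>i\<in>A. g i)) \<le> e"
  using assms
proof (induction A rule: infinite_finite_induct)
  case (insert i A)
  have "(\<Prod>j\<in>insert i A. f j) - (\<Prod>j\<in>insert i A. g j)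
      = (f i - g i) * (\<Prod>j\<in>A. f j) + ((\<Prod>j\<in>A. f j) - (\<Prod>j\<in>A. g j)) * g i"
    using insert by (simp add: algebra_simps)
  moreover have "cp_abs (\<Prod>j\<in>A. f j) \<le> 1" using insert.prems by (intro cp_abs_prod_le_1) auto
  ultimately show ?case using insert by (simp add: cp_abs_add_le cp_abs_mult_le)
qed simp_all

lemma cp_abs_of_nat: "cp_abs (of_nat n :: 'c) \<le> 1"
  by (induction n) (simp_all add: cp_abs_add_le)

lemma cp_abs_of_int: "cp_abs (of_int m :: 'c) \<le> 1"
proof (cases m)
  case (neg n)
  have "(of_int m :: 'c) = - of_nat (Suc n)" using neg by simp
  then show ?thesis by (simp only: cp_abs_minus cp_abs_of_nat)
qed (simp add: cp_abs_of_nat)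

text \<open>From m u - p w = 1 and |p w| < 1 the ultrametric inequality forces |m u| >= 1, while no
  integer has absolute value above 1.\<close>

lemma cp_abs_of_int_coprime:
  assumes "coprime m (int p)" shows "cp_abs (of_int m :: 'c) = 1"
proof (rule antisym)
  obtain u where "[m * u = 1] (mod int p)" using cong_solve_coprime_int[OF assms] by auto
  then obtain w where "m * u - 1 = int p * w" by (auto simp: cong_iff_dvd_diff)
  then have "(1 :: int) = m * u - int p * w" by simp
  then have "(of_int 1 :: 'c) = of_int (m * u - int p * w)" by (rule arg_cong)
  then have "(1 :: 'c) = of_int m * of_int u - of_nat p * of_int w" by simp
  then have "1 \<le> max (cp_abs (of_int m * of_int u :: 'c)) (cp_abs (of_nat p * of_int w :: 'c))"
    by (metis cp_abs_1 cp_abs_diff)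
  moreover have "cp_abs (of_nat p * of_int w :: 'c) < 1"
    using mult_left_mono[OF cp_abs_of_int[of w], of "1 / real p"] p_gt_1
    by (simp add: cp_abs_mult cp_abs_p divide_simps del: mult_left_mono)
  ultimately have "1 \<le> cp_abs (of_int m :: 'c) * cp_abs (of_int u :: 'c)"
    by (simp add: cp_abs_mult max_def split: if_splits)
  also have "\<dots> \<le> cp_abs (of_int m :: 'c)" using cp_abs_of_int[of u] by (simp add: mult_left_le)
  finally show "1 \<le> cp_abs (of_int m :: 'c)" .
qed (rule cp_abs_of_int)

lemma cp_abs_of_nat_coprime: "coprime m p \<Longrightarrow> cp_abs (of_nat m :: 'c) = 1"
  using cp_abs_of_int_coprime[of "int m"] by simp

abbreviation eps :: "nat \<Rightarrow> real" where "eps n \<equiv> (1 / real p) ^ n"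

declare power_one_over [simp del]

lemma eps_pos: "eps n > 0" "eps n \<ge> 0" using p_gt_1 by simp_all

lemma eps_mono: "m \<le> n \<Longrightarrow> eps n \<le> eps m"
  using p_gt_1 by (intro power_decreasing) auto

lemma eps_tendsto_0: "(\<lambda>n. eps n) \<longlonglongrightarrow> 0"
  using p_gt_1 by (intro LIMSEQ_power_zero) auto

lemma eps_less_iff: "eps m \<le> eps n \<longleftrightarrow> n \<le> m"
  using p_gt_1 by (auto simp: power_decreasing_iff)

lemma ex_eps_less: "e > 0 \<Longrightarrow> \<exists>n. eps n < e"
  using p_gt_1 by (intro real_arch_pow_inv) auto

lemma cp_abs_p_power: "cp_abs (of_nat p ^ n :: 'c) = eps n"
  by (simp add: cp_abs_power cp_abs_p)

lemma p_neq_0 [simp]: "(of_nat p :: 'c) \<noteq> 0" using p_gt_1 by simp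

text \<open>The dictionary between metric estimates and divisibility: on Z, balls of radius p^(-n)
  are congruence classes modulo p^n.\<close>

lemma cp_abs_of_int_le_iff: "cp_abs (of_int m :: 'c) \<le> eps n \<longleftrightarrow> int p ^ n dvd m"
proof
  assume "int p ^ n dvd m"
  then obtain w where "m = int p ^ n * w" by auto
  then show "cp_abs (of_int m :: 'c) \<le> eps n"
    using mult_left_mono[OF cp_abs_of_int[of w] eps_pos(2)[of n]]
    by (simp add: cp_abs_mult cp_abs_p_power)
next
  assume le: "cp_abs (of_int m :: 'c) \<le> eps n"
  show "int p ^ n dvd m"
  proof (cases "m = 0")
    case False
    have "\<not> is_unit (int p)" using p_gt_1 by simp
    then obtain w where w: "m = int p ^ multiplicity (int p) m * w" "\<not> int p dvd w"
      using multiplicity_decompose'[OF False] by metis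
    have "coprime w (int p)" using w(2) by (rule coprime_p)
    then have "cp_abs (of_int m :: 'c) = eps (multiplicity (int p) m)"
      by (subst w(1)) (simp add: cp_abs_mult cp_abs_p_power cp_abs_of_int_coprime)
    then have "n \<le> multiplicity (int p) m" using le by (simp only: eps_less_iff)
    then show ?thesis by (rule multiplicity_dvd')
  qed simp
qed

lemma cp_abs_of_nat_diff_le_iff:
  "cp_abs (of_nat a - of_nat b :: 'c) \<le> eps n \<longleftrightarrow> [a = b] (mod p ^ n)"
  using cp_abs_of_int_le_iff[of "int a - int b" n] cong_int_iff[of a b "p ^ n"]
  by (simp add: cong_iff_dvd_diff)

subsection \<open>p-adic integers\<close>

text \<open>In lowest terms the denominator w is prime to p, since otherwise |s| > 1. With m inverse
  to w modulo p^n, the integer u m is the approximation.\<close>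

lemma of_rat_approx:
  assumes "cp_abs (of_rat s :: 'c) \<le> 1" shows "\<exists>a::nat. cp_abs (of_rat s - of_nat a :: 'c) \<le> eps n"
proof -
  obtain u w where q: "quotient_of s = (u, w)" by force
  have w: "w > 0" "coprime u w" using quotient_of_denom_pos[OF q] quotient_of_coprime[OF q] by auto
  have s: "(of_rat s :: 'c) = of_int u / of_int w"
    using quotient_of_div[OF q] by (simp add: of_rat_divide)
  have "\<not> int p dvd w"
  proof
    assume dvd: "int p dvd w"
    then have "coprime u (int p)" using w(2) by (meson coprime_divisors dvd_refl)
    then have u: "cp_abs (of_int u :: 'c) = 1" by (rule cp_abs_of_int_coprime)
    have "cp_abs (of_int w :: 'c) \<le> 1 / real p"
      using dvd cp_abs_of_int_le_iff[of w 1] by simp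
    moreover have "1 / real p < 1" using p_gt_1 by simp
    ultimately have "cp_abs (of_int w :: 'c) < 1" by linarith
    moreover have "cp_abs (of_int w :: 'c) > 0" using w(1) by (simp add: less_le)
    ultimately show False using assms u unfolding s by (simp add: cp_abs_divide divide_simps)
  qed
  then have cop: "coprime w (int p)" by (rule coprime_p)
  then obtain m where m: "[w * m = 1] (mod int p ^ n)"
    using cong_solve_coprime_int[of w "int p ^ n"] by auto
  define a where "a = nat ((u * m) mod int p ^ n)"
  have "int a = (u * m) mod int p ^ n" using p_gt_1 by (simp add: a_def)
  then have "[w * int a = w * (u * m)] (mod int p ^ n)" by (simp add: cong_def mod_mult_right_eq)
  also have "[w * (u * m) = u] (mod int p ^ n)"
    using cong_scalar_left[OF m, of u] by (simp add: algebra_simps)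
  finally have "int p ^ n dvd u - w * int a" by (simp add: cong_iff_dvd_diff dvd_diff_commute)
  then have "cp_abs (of_int (u - w * int a) :: 'c) \<le> eps n" by (simp only: cp_abs_of_int_le_iff)
  moreover have "(of_rat s - of_nat a :: 'c) = of_int (u - w * int a) / of_int w"
    using w(1) by (simp add: s field_simps)
  ultimately have "cp_abs (of_rat s - of_nat a :: 'c) \<le> eps n"
    by (simp only: cp_abs_divide cp_abs_of_int_coprime[OF cop] div_by_1)
  then show ?thesis by blast
qed

text \<open>\<open>Zp\<close> is given as the unit ball in the closure of Q; here it becomes the
  closure of the natural numbers, so that ring operations are handled by approximation.\<close>

lemma Zp_iff: "(y :: 'c) \<in> Zp \<longleftrightarrow> (\<forall>n. \<exists>a::nat. cp_abs (y - of_nat a) \<le> eps n)"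
proof
  assume y: "y \<in> Zp"
  show "\<forall>n. \<exists>a::nat. cp_abs (y - of_nat a) \<le> eps n"
  proof
    fix n
    have "y \<in> closure \<rat>" "cp_abs y \<le> 1" using y by (auto simp: Zp_def Qp_def)
    then obtain t where t: "t \<in> \<rat>" "dist t y < eps n"
      using eps_pos(1)[of n] unfolding closure_approachable by blast
    then obtain s where s: "cp_abs (of_rat s - y) < eps n" by (auto simp: Rats_def dist_cp)
    have "cp_abs (of_rat s - y + y) \<le> 1"
      using s eps_mono[of 0 n] \<open>cp_abs y \<le> 1\<close> by (intro cp_abs_add_le) auto
    then obtain a :: nat where "cp_abs (of_rat s - of_nat a :: 'c) \<le> eps n" using of_rat_approx[of s n] by auto
    then have "cp_abs (y - of_nat a) \<le> eps n"
      using s cp_abs_commute[of y "of_rat s"] by (intro cp_abs_triangle_le[of y "of_rat s" _ "of_nat a"]) auto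
    then show "\<exists>a::nat. cp_abs (y - of_nat a) \<le> eps n" by blast
  qed
next
  assume ap: "\<forall>n. \<exists>a::nat. cp_abs (y - of_nat a) \<le> eps n"
  have "y \<in> closure \<rat>" unfolding closure_approachable
  proof (intro allI impI)
    fix e :: real assume "e > 0"
    then obtain n where "eps n < e" using ex_eps_less by blast
    moreover obtain a :: nat where "cp_abs (y - of_nat a) \<le> eps n" using ap by blast
    ultimately have "dist (of_nat a) y < e" using cp_abs_commute[of y "of_nat a"] by (simp add: dist_cp)
    then show "\<exists>z\<in>\<rat>. dist z y < e" by (intro bexI[of _ "of_nat a"]) simp_all
  qed
  moreover obtain a :: nat where "cp_abs (y - of_nat a) \<le> eps 0" using ap by blast
  then have "cp_abs (y - of_nat a + of_nat a) \<le> 1" using cp_abs_of_nat by (intro cp_abs_add_le) auto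
  ultimately show "y \<in> Zp" by (simp add: Zp_def Qp_def)
qed

lemma Zp_intI:
  assumes "\<And>n. \<exists>a::int. cp_abs (y - of_int a) \<le> eps n" shows "(y :: 'c) \<in> Zp"
  unfolding Zp_iff
proof
  fix n
  obtain a :: int where a: "cp_abs (y - of_int a) \<le> eps n" using assms by blast
  have "cp_abs (of_int (a - a mod int p ^ n) :: 'c) \<le> eps n"
    unfolding cp_abs_of_int_le_iff by (simp add: minus_mod_eq_mult_div)
  moreover have "(of_nat (nat (a mod int p ^ n)) :: 'c) = of_int (a mod int p ^ n)"
    using p_gt_1 by simp
  ultimately have "cp_abs (y - of_nat (nat (a mod int p ^ n))) \<le> eps n"
    using cp_abs_triangle_le[OF a, of "of_int (a mod int p ^ n)"] by simp
  then show "\<exists>a::nat. cp_abs (y - of_nat a) \<le> eps n" by blast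
qed

lemma Zp_approx: "(y :: 'c) \<in> Zp \<Longrightarrow> \<exists>a::nat. cp_abs (y - of_nat a) \<le> eps n"
  by (simp add: Zp_iff)

lemma Zp_abs: "(y :: 'c) \<in> Zp \<Longrightarrow> cp_abs y \<le> 1"
  by (simp add: Zp_def)

lemma Zp_of_int: "of_int m \<in> (Zp :: 'c set)"
proof (rule Zp_intI)
  show "\<exists>a::int. cp_abs (of_int m - of_int a :: 'c) \<le> eps n" for n
    using eps_pos(2)[of n] by (intro exI[of _ m]) simp
qed

lemma Zp_of_nat: "of_nat m \<in> (Zp :: 'c set)"
  using Zp_of_int[of "int m"] by simp

lemma Zp_add: assumes "(y :: 'c) \<in> Zp" "z \<in> Zp" shows "y + z \<in> Zp"
  unfolding Zp_iff
proof
  fix n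
  obtain a b :: nat where "cp_abs (y - of_nat a) \<le> eps n" "cp_abs (z - of_nat b) \<le> eps n"
    using Zp_approx[OF assms(1)] Zp_approx[OF assms(2)] by blast
  then have "cp_abs ((y - of_nat a) + (z - of_nat b)) \<le> eps n" by (rule cp_abs_add_le)
  then show "\<exists>a::nat. cp_abs (y + z - of_nat a) \<le> eps n"
    by (intro exI[of _ "a + b"]) (simp add: algebra_simps)
qed

lemma Zp_mult: assumes "(y :: 'c) \<in> Zp" "z \<in> Zp" shows "y * z \<in> Zp"
  unfolding Zp_iff
proof
  fix n
  obtain a b :: nat where ab: "cp_abs (y - of_nat a) \<le> eps n" "cp_abs (z - of_nat b) \<le> eps n"
    using Zp_approx[OF assms(1)] Zp_approx[OF assms(2)] by blast
  have "cp_abs ((y - of_nat a) * z + (z - of_nat b) * of_nat a) \<le> eps n"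
    using ab Zp_abs[OF assms(2)] cp_abs_of_nat by (intro cp_abs_add_le cp_abs_mult_le)
  then show "\<exists>a::nat. cp_abs (y * z - of_nat a) \<le> eps n"
    by (intro exI[of _ "a * b"]) (simp add: algebra_simps)
qed

lemma Zp_diff: "(y :: 'c) \<in> Zp \<Longrightarrow> z \<in> Zp \<Longrightarrow> y - z \<in> Zp"
  using Zp_add[OF _ Zp_mult[OF Zp_of_int[of "-1"]], of y z] by simp

text \<open>A natural number approximating z to precision n + m is itself divisible by p^n; dividing
  it loses n digits and keeps m.\<close>

lemma Zp_divide_power:
  assumes "(z :: 'c) \<in> Zp" "cp_abs z \<le> eps n" shows "z / of_nat p ^ n \<in> Zp"
  unfolding Zp_iff
proof
  fix m
  obtain a :: nat where a: "cp_abs (z - of_nat a) \<le> eps (n + m)" using assms(1) Zp_approx by blast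
  have "cp_abs (z - of_nat a) \<le> eps n" using a eps_mono[of n "n + m"] by simp
  then have "cp_abs (z - (z - of_nat a)) \<le> eps n" by (rule cp_abs_diff_le[OF assms(2)])
  then have "cp_abs (of_nat a - of_nat 0 :: 'c) \<le> eps n" by (simp)
  then have "[a = 0] (mod p ^ n)" by (simp only: cp_abs_of_nat_diff_le_iff)
  then obtain b where b: "a = p ^ n * b" by (auto simp: cong_0_iff)
  have "z / of_nat p ^ n - of_nat b = (z - of_nat a) / of_nat p ^ n" using p_gt_1 by (simp add: b diff_divide_distrib)
  then have "cp_abs (z / of_nat p ^ n - of_nat b) \<le> eps (n + m) / eps n"
    using a eps_pos(1)[of n] by (simp add: cp_abs_divide cp_abs_p_power divide_right_mono)
  also have "\<dots> = eps m" using p_gt_1 by (simp add: power_add)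
  finally show "\<exists>b::nat. cp_abs (z / of_nat p ^ n - of_nat b) \<le> eps m" by blast
qed

text \<open>Reduction of p-adic integers modulo p^n; being least among the approximations puts the
  representative below p^n.\<close>

definition res :: "nat \<Rightarrow> 'c \<Rightarrow> nat" where
  "res n y = (LEAST a. cp_abs (y - of_nat a) \<le> eps n)"

lemma res_approx: "y \<in> Zp \<Longrightarrow> cp_abs (y - of_nat (res n y)) \<le> eps n"
  unfolding res_def using Zp_approx[of y n] by (rule LeastI_ex)

lemma res_less: assumes "y \<in> Zp" shows "res n y < p ^ n"
proof -
  have "[res n y mod p ^ n = res n y] (mod p ^ n)" by simp
  then have "cp_abs (of_nat (res n y) - of_nat (res n y mod p ^ n) :: 'c) \<le> eps n"
    unfolding cp_abs_of_nat_diff_le_iff by (rule cong_sym)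
  then have "cp_abs (y - of_nat (res n y mod p ^ n)) \<le> eps n"
    by (rule cp_abs_triangle_le[OF res_approx[OF assms]])
  then have "res n y \<le> res n y mod p ^ n" unfolding res_def by (rule Least_le)
  moreover have "res n y mod p ^ n < p ^ n" using p_gt_1 by simp
  ultimately show ?thesis by linarith
qed

lemma cp_abs_diff_le_iff_res:
  assumes "y \<in> Zp" shows "cp_abs (y - of_nat a) \<le> eps n \<longleftrightarrow> [a = res n y] (mod p ^ n)"
proof -
  have "cp_abs (y - of_nat a) \<le> eps n \<longleftrightarrow> cp_abs (of_nat a - of_nat (res n y) :: 'c) \<le> eps n"
    using res_approx[OF assms, of n] cp_abs_triangle_le[of "of_nat a" y "eps n" "of_nat (res n y)"]
      cp_abs_triangle_le[of y "of_nat (res n y)" "eps n" "of_nat a"]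
      cp_abs_commute[of y "of_nat a"] cp_abs_commute[of "of_nat a" "of_nat (res n y)"] by auto
  then show ?thesis by (simp only: cp_abs_of_nat_diff_le_iff)
qed

lemma res_eqI: "y \<in> Zp \<Longrightarrow> a < p ^ n \<Longrightarrow> cp_abs (y - of_nat a) \<le> eps n \<Longrightarrow> res n y = a"
  using cp_abs_diff_le_iff_res[of y a n] res_less[of y n] by (simp add: cong_def)

lemma res_cong: assumes "y \<in> Zp" "z \<in> Zp" shows "res n y = res n z \<longleftrightarrow> cp_abs (y - z) \<le> eps n"
proof
  assume "res n y = res n z"
  then have "cp_abs (of_nat (res n y) - z) \<le> eps n"
    using res_approx[OF assms(2), of n] cp_abs_commute[of z] by simp
  then show "cp_abs (y - z) \<le> eps n" by (rule cp_abs_triangle_le[OF res_approx[OF assms(1)]])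
next
  assume "cp_abs (y - z) \<le> eps n"
  then have "cp_abs (y - of_nat (res n z)) \<le> eps n"
    by (rule cp_abs_triangle_le[OF _ res_approx[OF assms(2)]])
  then show "res n y = res n z" by (intro res_eqI assms res_less)
qed

text \<open>Closed in a complete space, and covered by the finitely many balls around 0, ..., p^n -
  1.\<close>

lemma compact_Zp: "compact (Zp :: 'c set)"
  unfolding compact_eq_totally_bounded
proof
  have "(Zp :: 'c set) = closure \<rat> \<inter> cball 0 1"
    by (auto simp: Zp_def Qp_def cp_abs_def dist_commute)
  then have "closed (Zp :: 'c set)" by (metis closed_Int closed_closure closed_cball)
  then show "complete (Zp :: 'c set)" by (simp add: complete_eq_closed)
  show "\<forall>e>0. \<exists>k. finite k \<and> (Zp :: 'c set) \<subseteq> (\<Union>x\<in>k. ball x e)"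
  proof (intro allI impI)
    fix e :: real assume "e > 0"
    then obtain n where n: "eps n < e" using ex_eps_less by blast
    show "\<exists>k. finite k \<and> (Zp :: 'c set) \<subseteq> (\<Union>x\<in>k. ball x e)"
    proof (intro exI conjI subsetI)
      fix y :: 'c assume y: "y \<in> Zp"
      then have "y \<in> ball (of_nat (res n y)) e"
        using res_approx[OF y, of n] n by (simp add: dist_commute dist_cp)
      then show "y \<in> (\<Union>x\<in>of_nat ` {..<p ^ n}. ball x e)" using res_less[OF y] by auto
    qed simp
  qed
qed

subsection \<open>Binomial coefficients\<close>

text \<open>The numerators are products of m factors in the unit ball, so they differ by at most |a
  - b|; the factor 1 / |m!| is the price of the denominator.\<close>

lemma cp_abs_gbinomial_diff:
  assumes "cp_abs (a :: 'c) \<le> 1" "cp_abs b \<le> 1"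
  shows "cp_abs ((a gchoose m) - (b gchoose m)) \<le> cp_abs (a - b) / cp_abs (fact m :: 'c)"
proof -
  have "cp_abs (a - of_nat i) \<le> 1" "cp_abs (b - of_nat i) \<le> 1" for i
    using cp_abs_diff_le[OF assms(1) cp_abs_of_nat] cp_abs_diff_le[OF assms(2) cp_abs_of_nat] .
  then have "cp_abs ((\<Prod>i=0..<m. a - of_nat i) - (\<Prod>i=0..<m. b - of_nat i)) \<le> cp_abs (a - b)"
    by (intro cp_abs_prod_diff) simp_all
  then show ?thesis
    unfolding gbinomial_prod_rev by (simp add: cp_abs_divide divide_right_mono flip: diff_divide_distrib)
qed

text \<open>At natural numbers the coefficient is an integer; an approximation of a finer than |m!|
  carries the bound over to \<open>Zp\<close>.\<close>

lemma cp_abs_gbinomial: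
  assumes "(a :: 'c) \<in> Zp" shows "cp_abs (a gchoose m) \<le> 1"
proof -
  have "cp_abs (fact m :: 'c) > 0" by (simp add: less_le)
  then obtain n where n: "eps n < cp_abs (fact m :: 'c)" using ex_eps_less by blast
  let ?b = "of_nat (res n a) :: 'c"
  have "cp_abs ((a gchoose m) - (?b gchoose m)) \<le> eps n / cp_abs (fact m :: 'c)"
    using cp_abs_gbinomial_diff[OF Zp_abs[OF assms] cp_abs_of_nat, of m "res n a"]
      divide_right_mono[OF res_approx[OF assms, of n] cp_abs_nonneg, of "fact m"] by linarith
  also have "\<dots> \<le> 1" using n \<open>cp_abs (fact m :: 'c) > 0\<close> by (simp add: divide_le_eq_1_pos)
  finally have "cp_abs ((a gchoose m) - (?b gchoose m)) \<le> 1" .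
  moreover have "cp_abs (?b gchoose m) \<le> 1"
    by (metis binomial_gbinomial cp_abs_of_nat)
  ultimately have "cp_abs (((a gchoose m) - (?b gchoose m)) + (?b gchoose m)) \<le> 1" by (rule cp_abs_add_le)
  then show ?thesis by simp
qed

subsection \<open>Limits\<close>

lemma tendsto_cp_iff:
  fixes l :: 'c
  shows "(s \<longlonglongrightarrow> l) \<longleftrightarrow> ((\<lambda>n. cp_abs (s n - l)) \<longlonglongrightarrow> 0)"
  unfolding tendsto_dist_iff[of s l] by (simp add: dist_cp)

text \<open>The sort of \<open>'c\<close> does not tie the metric to the field operations, so
  continuity of addition and multiplication is derived from the absolute value.\<close>

lemma tendsto_cp_add:
  assumes "s \<longlonglongrightarrow> (l :: 'c)" "u \<longlonglongrightarrow> m" shows "(\<lambda>n. s n + u n) \<longlonglongrightarrow> l + m"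
  unfolding tendsto_cp_iff
proof (rule tendsto_sandwich[OF _ _ tendsto_const])
  show "\<forall>\<^sub>F n in sequentially. cp_abs (s n + u n - (l + m)) \<le> cp_abs (s n - l) + cp_abs (u n - m)"
  proof (rule always_eventually, rule allI)
    fix n
    have "cp_abs ((s n - l) + (u n - m)) \<le> cp_abs (s n - l) + cp_abs (u n - m)"
      by (intro cp_abs_add_le) simp_all
    then show "cp_abs (s n + u n - (l + m)) \<le> cp_abs (s n - l) + cp_abs (u n - m)"
      by (simp add: algebra_simps)
  qed
  show "(\<lambda>n. cp_abs (s n - l) + cp_abs (u n - m)) \<longlonglongrightarrow> 0"
    using tendsto_add[of "\<lambda>n. cp_abs (s n - l)" 0 sequentially "\<lambda>n. cp_abs (u n - m)" 0] assms
    unfolding tendsto_cp_iff by simp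
qed simp

lemma tendsto_cp_mult:
  assumes "s \<longlonglongrightarrow> (l :: 'c)" "u \<longlonglongrightarrow> m" shows "(\<lambda>n. s n * u n) \<longlonglongrightarrow> l * m"
proof -
  have s: "(\<lambda>n. cp_abs (s n - l)) \<longlonglongrightarrow> 0" and u: "(\<lambda>n. cp_abs (u n - m)) \<longlonglongrightarrow> 0"
    using assms unfolding tendsto_cp_iff by simp_all
  have 1: "(\<lambda>n. (s n - l) * (u n - m)) \<longlonglongrightarrow> 0"
    using tendsto_mult[OF s u] unfolding tendsto_cp_iff by (simp add: cp_abs_mult)
  have 2: "(\<lambda>n. l * (u n - m)) \<longlonglongrightarrow> 0"
    using tendsto_mult[OF tendsto_const u, of "cp_abs l"] unfolding tendsto_cp_iff by (simp add: cp_abs_mult)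
  have 3: "(\<lambda>n. (s n - l) * m) \<longlonglongrightarrow> 0"
    using tendsto_mult[OF s tendsto_const, of "cp_abs m"] unfolding tendsto_cp_iff by (simp add: cp_abs_mult)
  have "(\<lambda>n. l * m + ((s n - l) * (u n - m) + (l * (u n - m) + (s n - l) * m))) \<longlonglongrightarrow> l * m + (0 + (0 + 0))"
    by (intro tendsto_cp_add tendsto_const 1 2 3)
  then show ?thesis by (simp add: algebra_simps)
qed

lemma tendsto_cp_sum:
  assumes "\<And>i. i \<in> A \<Longrightarrow> (\<lambda>n. s n i) \<longlonglongrightarrow> (l i :: 'c)"
  shows "(\<lambda>n. \<Sum>i\<in>A. s n i) \<longlonglongrightarrow> (\<Sum>i\<in>A. l i)"
  using assms by (induction A rule: infinite_finite_induct) (simp_all add: tendsto_cp_add)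

lemma tendsto_cp_prod:
  assumes "\<And>i. i \<in> A \<Longrightarrow> (\<lambda>n. s n i) \<longlonglongrightarrow> (l i :: 'c)"
  shows "(\<lambda>n. \<Prod>i\<in>A. s n i) \<longlonglongrightarrow> (\<Prod>i\<in>A. l i)"
  using assms by (induction A rule: infinite_finite_induct) (simp_all add: tendsto_cp_mult)

lemma tendsto_cp_zeroI:
  assumes "\<And>n. cp_abs (s n :: 'c) \<le> C * eps n" shows "s \<longlonglongrightarrow> 0"
proof -
  have "(\<lambda>n. C * eps n) \<longlonglongrightarrow> 0" using tendsto_mult_right_zero[OF eps_tendsto_0] .
  then have "(\<lambda>n. cp_abs (s n)) \<longlonglongrightarrow> 0"
    by (rule tendsto_sandwich[OF _ _ tendsto_const, rotated 2]) (simp_all add: assms)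
  then show ?thesis by (simp add: tendsto_cp_iff)
qed

lemma tendsto_cp_eqI:
  assumes "(\<lambda>n. s n - u n) \<longlonglongrightarrow> (0 :: 'c)" "u \<longlonglongrightarrow> l" shows "s \<longlonglongrightarrow> l"
  using tendsto_cp_add[OF assms] by simp

text \<open>In an ultrametric space a bound on consecutive differences bounds all later differences
  with the same constant.\<close>

lemma convergent_cpI:
  assumes "\<And>n. cp_abs (s (Suc n) - s n :: 'c) \<le> C * eps n" "C \<ge> 0"
  shows "convergent s"
proof -
  have step: "cp_abs (s (n + m) - s n) \<le> C * eps n" for n m
  proof (induction m)
    case 0
    show ?case using assms(2) eps_pos(2)[of n] by simp
  next
    case (Suc m)
    have "cp_abs (s (Suc (n + m)) - s (n + m)) \<le> C * eps n"
      using assms(1)[of "n + m"] mult_left_mono[OF eps_mono[of n "n + m"] assms(2)] by simp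
    from cp_abs_triangle_le[OF this Suc] show ?case by simp
  qed
  have "Cauchy s"
  proof (rule metric_CauchyI)
    fix e :: real assume "e > 0"
    then obtain n where n: "eps n < e / (C + 1)" using ex_eps_less[of "e / (C + 1)"] assms(2) by auto
    have "C * eps n \<le> (C + 1) * eps n" using eps_pos(2)[of n] by (simp add: distrib_right)
    also have "\<dots> < e" using n assms(2) by (simp add: field_simps)
    finally have Ce: "C * eps n < e" .
    have "dist (s i) (s j) < e" if "i \<ge> n" "j \<ge> n" for i j
    proof -
      have "cp_abs (s i - s n) \<le> C * eps n" "cp_abs (s n - s j) \<le> C * eps n"
        using step[of n "i - n"] step[of n "j - n"] that cp_abs_commute[of "s n"] by auto
      then show ?thesis using cp_abs_triangle_le Ce unfolding dist_cp by (meson le_less_trans)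
    qed
    then show "\<exists>M. \<forall>m\<ge>M. \<forall>n\<ge>M. dist (s m) (s n) < e" by blast
  qed
  then show ?thesis by (simp add: Cauchy_convergent_iff)
qed

end

subsection \<open>Sums over boxes\<close>

lemma box_eq_PiE: "{d :: 'k::finite \<Rightarrow> nat. \<forall>i. d i < N} = PiE UNIV (\<lambda>_. {..<N})"
  by (auto simp: PiE_def Pi_def)

lemma finite_box [simp]: "finite {d :: 'k::finite \<Rightarrow> nat. \<forall>i. d i < N}"
  unfolding box_eq_PiE by (intro finite_PiE) auto

lemma prod_sum_box:
  fixes f :: "'k::finite \<Rightarrow> nat \<Rightarrow> 'a::comm_semiring_1"
  shows "(\<Prod>i\<in>UNIV. \<Sum>j<N. f i j) = (\<Sum>d | \<forall>i. d i < N. \<Prod>i\<in>UNIV. f i (d i))"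
  unfolding box_eq_PiE by (rule prod_sum_PiE) auto

lemma prod_sum_le:
  fixes f :: "'k::finite \<Rightarrow> nat \<Rightarrow> 'a::comm_semiring_1"
  shows "(\<Prod>i\<in>UNIV. \<Sum>j=0..m i. f i j) = (\<Sum>d | \<forall>i. d i \<le> m i. \<Prod>i\<in>UNIV. f i (d i))"
proof -
  have "{d :: 'k \<Rightarrow> nat. \<forall>i. d i \<le> m i} = PiE UNIV (\<lambda>i. {0..m i})"
    by (auto simp: PiE_def Pi_def)
  then show ?thesis by (simp add: prod_sum_PiE)
qed

lemma sum_box_zero:
  fixes F :: "('k::finite \<Rightarrow> nat) \<Rightarrow> 'a::comm_monoid_add"
  assumes "\<And>c. (\<Sum>j<N. F (c(i := j))) = 0" and "N > 0"
  shows "(\<Sum>c | \<forall>i. c i < N. F c) = 0"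
proof -
  \<comment> \<open>The box is fibred over the coordinates other than i; \<open>c i = 0\<close>
    picks one point in each fibre.\<close>
  let ?B = "{c :: 'k \<Rightarrow> nat. (\<forall>i. c i < N) \<and> c i = 0}"
  have "(\<Sum>c | \<forall>i. c i < N. F c) = (\<Sum>z\<in>?B \<times> {..<N}. F ((fst z)(i := snd z)))"
    using assms(2)
    by (intro sum.reindex_bij_witness[where i = "\<lambda>z. (fst z)(i := snd z)" and j = "\<lambda>c. (c(i := 0), c i)"])
       (auto simp: fun_eq_iff)
  also have "\<dots> = (\<Sum>c\<in>?B. \<Sum>j<N. F (c(i := j)))"
    by (simp add: sum.cartesian_product case_prod_unfold)
  finally show ?thesis by (simp add: assms(1))
qed

text \<open>A function whose sum over each coordinate vanishes is orthogonal to every function that does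
  not depend on some coordinate; so in a product of sums the constant terms may be changed.\<close>

lemma zero_sum_prod_shift:
  fixes g :: "('k::finite \<Rightarrow> nat) \<Rightarrow> 'a::comm_ring_1"
  assumes g: "\<And>c i. (\<Sum>j<N. g (c(i := j))) = 0" and N: "N > 0"
  shows "(\<Sum>c | \<forall>i. c i < N. g c * (\<Prod>i\<in>UNIV. a i (c i) + b i))
    = (\<Sum>c | \<forall>i. c i < N. g c * (\<Prod>i\<in>UNIV. a i (c i)))"
proof -
  let ?t = "\<lambda>S c. g c * ((\<Prod>i\<in>S. a i (c i)) * (\<Prod>i\<in>UNIV - S. b i))"
  have zero: "(\<Sum>c | \<forall>i. c i < N. ?t S c) = 0" if "S \<noteq> UNIV" for S
  proof -
    obtain i where i: "i \<notin> S" using \<open>S \<noteq> UNIV\<close> by blast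
    show ?thesis
    proof (rule sum_box_zero[OF _ N])
      fix c :: "'k \<Rightarrow> nat"
      have "(\<Prod>j\<in>S. a j ((c(i := m)) j)) = (\<Prod>j\<in>S. a j (c j))" for m
        using i by (intro prod.cong) auto
      then show "(\<Sum>j<N. ?t S (c(i := j))) = 0" using g[of c i] by (simp flip: sum_distrib_right)
    qed
  qed
  have "(\<Sum>c | \<forall>i. c i < N. g c * (\<Prod>i\<in>UNIV. a i (c i) + b i)) = (\<Sum>c | \<forall>i. c i < N. \<Sum>S\<in>Pow UNIV. ?t S c)"
    by (simp only: prod_add[OF finite] sum_distrib_left)
  also have "\<dots> = (\<Sum>S\<in>Pow UNIV. \<Sum>c | \<forall>i. c i < N. ?t S c)" by (rule sum.swap)
  also have "\<dots> = (\<Sum>S\<in>Pow UNIV. if S = UNIV then \<Sum>c | \<forall>i. c i < N. ?t S c else 0)"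
    by (rule sum.cong) (use zero in auto)
  also have "\<dots> = (\<Sum>c | \<forall>i. c i < N. ?t UNIV c)" by (subst sum.delta) simp_all
  finally show ?thesis by simp
qed

subsection \<open>Products of power series in separate variables\<close>

text \<open>The series f_1(X_1) ... f_k(X_k), which can be treated one variable at a time.\<close>

definition tens :: "('k::finite \<Rightarrow> 'a::comm_ring_1 fps) \<Rightarrow> ('k, 'a) mfps" where
  "tens f = Abs_mfps (\<lambda>m. \<Prod>i\<in>UNIV. fps_nth (f i) (m i))"

lemma mcoeff_tens: "mcoeff (tens f) m = (\<Prod>i\<in>UNIV. fps_nth (f i) (m i))"
  by (simp add: tens_def)

lemma mcoeff_times: "mcoeff (f * g) m = (\<Sum>a | \<forall>i. a i \<le> m i. mcoeff f a * mcoeff g (\<lambda>i. m i - a i))"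
  by (simp add: times_mfps_def)

lemma mcoeff_add: "mcoeff (f + g) m = mcoeff f m + mcoeff g m"
  by (simp add: plus_mfps_def)

lemma mcoeff_diff: "mcoeff (f - g) m = mcoeff f m - mcoeff g m"
  by (simp add: minus_mfps_def)

lemma mcoeff_0: "mcoeff 0 m = 0"
  by (simp add: zero_mfps_def)

lemma mcoeff_sum: "mcoeff (\<Sum>a\<in>A. f a) m = (\<Sum>a\<in>A. mcoeff (f a) m)"
  by (induction A rule: infinite_finite_induct) (simp_all add: mcoeff_0 mcoeff_add)

lemma mcoeff_const_times: "mcoeff (mconst c * f) m = c * mcoeff f m"
proof -
  have "mcoeff (mconst c * f) m = (\<Sum>a | \<forall>i. a i \<le> m i. if a = (\<lambda>_. 0) then c * mcoeff f m else 0)"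
    unfolding mcoeff_times mconst_def mcoeff_Abs by (rule sum.cong) auto
  also have "\<dots> = c * mcoeff f m" by (simp add: sum.delta finite_le_fun)
  finally show ?thesis .
qed

lemma tens_mult: "tens f * tens g = tens (\<lambda>i. f i * g i)"
  by (rule mfps_eqI) (simp add: mcoeff_times mcoeff_tens fps_mult_nth prod_sum_le prod.distrib)

lemma tens_1: "tens (\<lambda>_. 1) = 1"
proof (rule mfps_eqI)
  fix m :: "'a \<Rightarrow> nat"
  show "mcoeff (tens (\<lambda>_. 1)) m = mcoeff (1 :: ('a, 'b) mfps) m"
  proof (cases "m = (\<lambda>_. 0)")
    case False
    then obtain i where "m i \<noteq> 0" by auto
    then have "(\<Prod>i\<in>UNIV. fps_nth (1 :: 'b fps) (m i)) = 0"
      by (intro prod_zero bexI[of _ i]) auto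
    then show ?thesis using False by (simp add: mcoeff_tens one_mfps_def)
  qed (simp add: mcoeff_tens one_mfps_def)
qed

lemma tens_single_diff:
  "1 - tens (\<lambda>j. if j = i then f else 1) = tens (\<lambda>j. if j = i then 1 - f else 1)"
proof (rule mfps_eqI)
  fix m :: "'a \<Rightarrow> nat"
  have *: "mcoeff (tens (\<lambda>j. if j = i then h else 1)) m
      = fps_nth h (m i) * (\<Prod>j\<in>UNIV - {i}. fps_nth 1 (m j))"
    for h :: "'b fps"
  proof -
    have "(\<Prod>j\<in>UNIV - {i}. fps_nth (if j = i then h else 1) (m j)) = (\<Prod>j\<in>UNIV - {i}. fps_nth 1 (m j))"
      by (rule prod.cong) auto
    then show ?thesis by (simp add: mcoeff_tens prod.remove[of UNIV i] del: fps_one_nth)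
  qed
  have "tens (\<lambda>j. if j = i then 1 else 1) = (1 :: ('a, 'b) mfps)" by (simp add: tens_1)
  then have "mcoeff (1 :: ('a, 'b) mfps) m = fps_nth 1 (m i) * (\<Prod>j\<in>UNIV - {i}. fps_nth 1 (m j))"
    using *[of 1] by simp
  then show "mcoeff (1 - tens (\<lambda>j. if j = i then f else 1)) m
      = mcoeff (tens (\<lambda>j. if j = i then 1 - f else 1)) m"
    by (simp only: mcoeff_diff * fps_sub_nth left_diff_distrib)
qed

lemma prod_tens_single:
  "(\<Prod>i\<in>UNIV. tens (\<lambda>j. if j = i then f i else 1)) = tens f"
proof -
  have "(\<Prod>i\<in>A. tens (\<lambda>j. if j = i then f i else 1)) = tens (\<lambda>j. if j \<in> A then f j else 1)" if "finite A" for A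
    using that
  proof induction
    case (insert i A)
    then have "(\<lambda>j. (if j = i then f i else 1) * (if j \<in> A then f j else 1)) = (\<lambda>j. if j \<in> insert i A then f j else 1)"
      by auto
    then show ?case using insert by (simp add: tens_mult)
  qed (simp add: tens_1)
  from this[of UNIV] show ?thesis by simp
qed

text \<open>Each factor is X times a unit series, so multiplying by the inverse units leaves X_1 ...
  X_k, which only shifts exponents. This makes a quotient by \<open>f_den\<close> unique.\<close>

lemma mult_tens_eq_0:
  fixes g :: "('k::finite, 'a::field) mfps"
  assumes "g * tens f = 0" and "\<And>i. fps_nth (f i) 0 = 0" "\<And>i. fps_nth (f i) 1 \<noteq> 0"
  shows "g = 0"
proof -
  define u where "u i = fps_shift 1 (f i)" for i
  have u: "f i = fps_X * u i" "u i * inverse (u i) = 1" for i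
  proof -
    show "f i = fps_X * u i" using assms(2)[of i] unfolding u_def
      by (intro fps_ext) (auto simp: fps_X_mult_nth)
    show "u i * inverse (u i) = 1"
      using inverse_mult_eq_1'[of "u i"] assms(3)[of i] by (simp add: u_def)
  qed
  have "f i * inverse (u i) = fps_X" for i using u[of i] by (simp add: mult.assoc)
  then have "g * tens (\<lambda>_. fps_X) = g * tens f * tens (\<lambda>i. inverse (u i))"
    by (simp add: mult.assoc tens_mult)
  then have zero: "g * tens (\<lambda>_. fps_X) = 0" using assms(1) by simp
  show ?thesis
  proof (rule mfps_eqI)
    fix m :: "'k \<Rightarrow> nat"
    let ?n = "\<lambda>i. m i + 1"
    have "mcoeff (g * tens (\<lambda>_. fps_X)) ?n = (\<Sum>a | \<forall>i. a i \<le> ?n i. if a = m then mcoeff g m else 0)"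
      unfolding mcoeff_times
    proof (rule sum.cong)
      fix a assume "a \<in> {a. \<forall>i. a i \<le> ?n i}"
      then have a: "a i \<le> ?n i" for i by simp
      show "mcoeff g a * mcoeff (tens (\<lambda>_. fps_X)) (\<lambda>i. ?n i - a i) = (if a = m then mcoeff g m else 0)"
      proof (cases "a = m")
        case False
        then obtain i where "a i \<noteq> m i" by auto
        then have "?n i - a i \<noteq> 1" using a[of i] by linarith
        then have "mcoeff (tens (\<lambda>_. fps_X :: 'a fps)) (\<lambda>i. ?n i - a i) = 0"
          unfolding mcoeff_tens by (intro prod_zero bexI[of _ i]) (auto simp: fps_X_def)
        then show ?thesis using False by simp
      qed (simp add: mcoeff_tens fps_X_def)
    qed simp
    also have "\<dots> = mcoeff g m" by (simp add: finite_le_fun)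
    finally show "mcoeff g m = mcoeff 0 m" using zero by (simp add: mcoeff_0)
  qed
qed

subsection \<open>Coordinates with respect to a rational basis\<close>

lemma tpow_eq_tens: "tpow p r \<alpha> = tens (\<lambda>i. fps_binomial (of_nat p ^ r * \<alpha> i))"
  by (rule mfps_eqI) (simp add: tpow_def mcoeff_tens)

lemma emb_scale_basis:
  assumes "rat_basis v"
  shows "emb v (of_nat n * v i) j = (if j = i then of_nat n else 0)"
proof -
  have "of_nat n * v i = rat_scale (of_nat n) (v i)" by (simp add: rat_scale_def of_rat_of_nat_eq)
  moreover have "v j = v i \<longleftrightarrow> j = i" using assms by (auto simp: rat_basis_def inj_def)
  ultimately show ?thesis
    using assms
    by (simp add: emb_def rat_basis_def rat_vs.representation_scale rat_vs.representation_basis of_rat_of_nat_eq)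
qed

lemma emb_add:
  assumes "rat_basis v"
  shows "(emb v (y + z) :: 'k::finite \<Rightarrow> 'c::field_char_0) j = emb v y j + emb v z j"
  using assms by (simp add: emb_def rat_basis_def rat_vs.representation_add of_rat_add)

lemma emb_lin:
  assumes "rat_basis v"
  shows "(emb v (lin v d) :: 'k::finite \<Rightarrow> 'c::field_char_0) j = of_nat (d j)"
proof -
  have "(emb v (\<Sum>i\<in>A. of_nat (d i) * v i) :: 'k \<Rightarrow> 'c) j = (if j \<in> A then of_nat (d j) else 0)" if "finite A" for A
    using that
  proof induction
    case empty
    have "(emb v 0 :: 'k \<Rightarrow> 'c) j = 0" using assms by (simp add: emb_def rat_basis_def rat_vs.representation_zero)
    then show ?case by simp
  next
    case (insert i A)
    then show ?case by (auto simp: emb_add[OF assms] emb_scale_basis[OF assms])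
  qed
  then show ?thesis by (simp add: lin_def)
qed

text \<open>N v_i has a single nonzero coordinate, so the i-th factor of the denominator is a series
  in one variable, and the same series for every i.\<close>

lemma f_den_eq_tens:
  assumes "rat_basis v"
  shows "(f_den p r N v :: ('k::finite, 'c::field_char_0) mfps)
    = tens (\<lambda>_. 1 - fps_binomial (of_nat p ^ r * of_nat N))"
proof -
  let ?b = "fps_binomial (of_nat p ^ r * of_nat N) :: 'c fps"
  have "tpow p r (emb v (of_nat N * v i)) = tens (\<lambda>j. if j = i then ?b else 1)" for i
    unfolding tpow_eq_tens by (rule arg_cong[of _ _ tens]) (auto simp: emb_scale_basis[OF assms])
  then show ?thesis by (simp add: f_den_def tens_single_diff prod_tens_single)
qed

lemma f_num_coeff:
  assumes "rat_basis v"
  shows "mcoeff (f_num p r N v x \<psi> :: ('k::finite, 'c::field_char_0) mfps) m =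
    (\<Sum>d | \<forall>i. d i < N. \<psi> (x + lin v d) *
      (\<Prod>i\<in>UNIV. (of_nat p ^ r * (emb v x i + of_nat (d i))) gchoose (m i)))"
  by (simp add: f_num_def mcoeff_sum mcoeff_const_times tpow_eq_tens mcoeff_tens
      emb_add[OF assms] emb_lin[OF assms])

subsection \<open>The one-dimensional building blocks\<close>

text \<open>Subtracting the class of 0 makes the sums over a period vanish.\<close>

definition res_ind :: "nat \<Rightarrow> nat \<Rightarrow> nat \<Rightarrow> 'a::ring_1" where
  "res_ind N c d = of_bool (d mod N = c mod N) - of_bool (d mod N = 0)"

lemma res_ind_mod: "[d = d'] (mod N) \<Longrightarrow> res_ind N c d = res_ind N c d'"
  by (simp add: res_ind_def cong_def)

lemma sum_zero_affine:
  fixes h :: "nat \<Rightarrow> 'a::comm_monoid_add"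
  assumes per: "\<And>d d'. [d = d'] (mod N) \<Longrightarrow> h d = h d'" and cop: "coprime m N" and N: "N > 0"
  shows "(\<Sum>d<N. h (l + m * d)) = (\<Sum>d<N. h d)"
proof -
  define g where "g d = (l + m * d) mod N" for d
  have "inj_on g {..<N}"
  proof
    fix i j assume ij: "i \<in> {..<N}" "j \<in> {..<N}" "g i = g j"
    then have "[l + m * i = l + m * j] (mod N)" by (simp add: g_def cong_def)
    then have "[i = j] (mod N)" using cop by (simp add: cong_add_lcancel_nat cong_mult_lcancel_nat)
    then show "i = j" using ij by (simp add: cong_def)
  qed
  moreover have "g ` {..<N} \<subseteq> {..<N}" using N by (auto simp: g_def)
  ultimately have "bij_betw g {..<N} {..<N}" by (simp add: bij_betw_def endo_inj_surj)
  then have "(\<Sum>d<N. h (g d)) = (\<Sum>d<N. h d)" by (rule sum.reindex_bij_betw)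
  moreover have "h (g d) = h (l + m * d)" for d by (rule per) (simp add: g_def)
  ultimately show ?thesis by simp
qed

lemma sum_res_ind:
  assumes "c < N" shows "(\<Sum>d<N. res_ind N c d) = (0 :: 'a::ring_1)"
proof -
  have "(\<Sum>d<N. of_bool (d mod N = c mod N)) = (1 :: 'a)" if "c < N" for c
  proof -
    have "(\<Sum>d<N. of_bool (d mod N = c mod N)) = (\<Sum>d<N. if d = c then 1 else (0 :: 'a))"
      using that by (intro sum.cong) auto
    then show ?thesis using that by simp
  qed
  from this[OF assms] this[of 0] assms show ?thesis by (simp add: res_ind_def sum_subtractf)
qed

lemma sum_res_ind_affine:
  assumes "c < N" "coprime m N" shows "(\<Sum>d<N. res_ind N c (l + m * d)) = (0 :: 'a::ring_1)"
  using sum_zero_affine[of N "res_ind N c :: nat \<Rightarrow> 'a", OF res_ind_mod assms(2)] sum_res_ind[OF assms(1)] assms(1)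
  by simp

lemma sum_nat_product:
  fixes f :: "nat \<Rightarrow> 'a::comm_monoid_add"
  shows "(\<Sum>m<a * b. f m) = (\<Sum>i<a. \<Sum>j<b. f (i + a * j))"
proof (cases "a = 0")
  case False
  have "(\<Sum>m<a * b. f m) = (\<Sum>z\<in>{..<a} \<times> {..<b}. f (fst z + a * snd z))"
  proof (rule sum.reindex_bij_witness[where i = "\<lambda>z. fst z + a * snd z" and j = "\<lambda>m. (m mod a, m div a)"])
    fix z assume "z \<in> {..<a} \<times> {..<b}"
    then have z: "fst z < a" "snd z < b" by auto
    have "fst z + a * snd z < a * Suc (snd z)" using z by simp
    also have "\<dots> \<le> a * b" using z by (intro mult_le_mono) auto
    finally show "fst z + a * snd z \<in> {..<a * b}" by simp
    show "((fst z + a * snd z) mod a, (fst z + a * snd z) div a) = z"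
      using z by (auto simp: prod_eq_iff)
  next
    fix m assume "m \<in> {..<a * b}"
    then show "(m mod a, m div a) \<in> {..<a} \<times> {..<b}"
      using False by (simp add: less_mult_imp_div_less mult.commute)
  qed auto
  then show ?thesis by (simp add: sum.cartesian_product case_prod_unfold)
qed simp

text \<open>The measure of \<open>l + p^n Z_p\<close> for the one-dimensional building block, with \<open>P = p^n\<close>.\<close>

definition block :: "nat \<Rightarrow> nat \<Rightarrow> nat \<Rightarrow> nat \<Rightarrow> 'a::field_char_0" where
  "block N c P l = - (\<Sum>d<N. of_nat d * res_ind N c (l + P * d)) / of_nat N"

text \<open>The sum of m h(m) over m < N q is computed twice, with m = i + N j and with m = j + q d.
  Each time the surplus terms contain a sum of h over a complete residue system modulo N and vanish;
  comparing the two gives additivity under refinement from P to P q.\<close>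

lemma block_refine:
  assumes c: "c < N" and cop: "coprime q N" "coprime P N" and q: "q > 0"
  shows "(\<Sum>j<q. block N c (P * q) (l + P * j)) = (block N c P l :: 'a::field_char_0)"
proof -
  define h :: "nat \<Rightarrow> 'a" where "h m = res_ind N c (l + P * m)" for m
  have per: "h m = h m'" if "[m = m'] (mod N)" for m m'
    unfolding h_def using that by (intro res_ind_mod cong_add cong_mult cong_refl)
  have zero: "(\<Sum>d<N. h (j + q * d)) = 0" for j
    using sum_res_ind_affine[of c N "P * q" "l + P * j", where 'a = 'a] c cop
    by (simp add: h_def algebra_simps)
  have "(\<Sum>m<N * q. of_nat m * h m) = (\<Sum>i<N. \<Sum>j<q. of_nat i * h i + of_nat N * (of_nat j * h i))"
  proof -
    have "h (i + N * j) = h i" for i j by (rule per) (simp add: cong_def)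
    then show ?thesis unfolding sum_nat_product by (simp add: algebra_simps)
  qed
  also have "\<dots> = of_nat q * (\<Sum>i<N. of_nat i * h i) + of_nat N * ((\<Sum>j<q. of_nat j) * (\<Sum>i<N. h i))"
    by (simp add: sum.distrib sum_product sum_distrib_left sum.swap[of _ "{..<N}" "{..<q}"] algebra_simps)
  also have "(\<Sum>i<N. h i) = 0"
    using sum_res_ind_affine[of c N P l, where 'a = 'a] c cop by (simp add: h_def)
  finally have 1: "(\<Sum>m<N * q. of_nat m * h m) = of_nat q * (\<Sum>i<N. of_nat i * h i)" by simp
  have "(\<Sum>m<q * N. of_nat m * h m) = (\<Sum>j<q. \<Sum>d<N. of_nat j * h (j + q * d) + of_nat q * (of_nat d * h (j + q * d)))"
    unfolding sum_nat_product by (intro sum.cong refl) (simp add: algebra_simps)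
  also have "\<dots> = of_nat q * (\<Sum>j<q. \<Sum>d<N. of_nat d * h (j + q * d))"
    by (simp add: sum.distrib zero flip: sum_distrib_left)
  finally have "of_nat q * (\<Sum>i<N. of_nat i * h i) = of_nat q * (\<Sum>j<q. \<Sum>d<N. of_nat d * h (j + q * d))"
    using 1 by (simp add: mult.commute)
  then have "(\<Sum>i<N. of_nat i * h i) = (\<Sum>j<q. \<Sum>d<N. of_nat d * h (j + q * d))" using q by simp
  moreover have "h (j + q * d) = res_ind N c (l + P * j + P * q * d)" for j d
    by (simp add: h_def algebra_simps)
  ultimately show ?thesis
    by (simp add: block_def h_def sum_negf flip: sum_divide_distrib)
qed

lemma block_refine_power:
  assumes c: "c < N" and cop: "coprime p N" and p: "p > 0"
  shows "(\<Sum>j<p ^ m. block N c (p ^ (n + m)) (l + p ^ n * j)) = (block N c (p ^ n) l :: 'a::field_char_0)"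
  using block_refine[OF c, of "p ^ m" "p ^ n" l, where 'a = 'a] cop p
  by (simp add: power_add)

text \<open>The Riemann sums of the generating function satisfy this exact identity, where \<open>W = U^P\<close>
  and \<open>\<Sum>j<d. W^j\<close> tends to \<open>d\<close> as \<open>W\<close> tends to 1.\<close>

lemma block_generating:
  fixes U :: "'a::idom"
  assumes c: "c < N" and cop: "coprime P N" and W: "W = U ^ P" "W \<noteq> 1"
  shows "(1 - U ^ N) * (\<Sum>l<P. \<Sum>d<N. U ^ l * (\<Sum>j<d. W ^ j) * res_ind N c (l + P * d))
    = - (U ^ c - 1) * (\<Sum>j<N. W ^ j)"
proof -
  have tel: "(W - 1) * (\<Sum>j<d. W ^ j) = W ^ d - 1" for d :: nat
    by (simp add: power_diff_1_eq)
  have ind: "(\<Sum>m<N * P. U ^ m * of_bool (m mod N = c)) = U ^ c * (\<Sum>j<P. (U ^ N) ^ j)" if "c < N" for c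
  proof -
    have "(\<Sum>m<N * P. U ^ m * of_bool (m mod N = c))
        = (\<Sum>j<P. \<Sum>i<N. if i = c then U ^ (c + N * j) else 0)"
      unfolding sum_nat_product using sum.swap by (subst sum.swap) (intro sum.cong refl, auto)
    also have "\<dots> = U ^ c * (\<Sum>j<P. (U ^ N) ^ j)"
      using that by (simp add: power_add power_mult sum_distrib_left)
    finally show ?thesis .
  qed
  have "(\<Sum>m<P * N. U ^ m * res_ind N c m) = (U ^ c - 1) * (\<Sum>j<P. (U ^ N) ^ j)"
    using ind[OF c] ind[of 0] c
    by (simp add: res_ind_def algebra_simps sum_subtractf)
  then have "(1 - U ^ N) * (\<Sum>m<P * N. U ^ m * res_ind N c m)
      = (U ^ c - 1) * ((1 - U ^ N) * (\<Sum>j<P. (U ^ N) ^ j))" by (simp add: mult.left_commute)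
  also have "(1 - U ^ N) * (\<Sum>j<P. (U ^ N) ^ j) = 1 - (U ^ N) ^ P" by (simp add: one_diff_power_eq)
  also have "(U ^ N) ^ P = W ^ N" by (simp add: W(1) flip: power_mult add: mult.commute)
  also have "1 - W ^ N = - ((W - 1) * (\<Sum>j<N. W ^ j))" by (simp add: tel)
  finally have total: "(1 - U ^ N) * (\<Sum>m<P * N. U ^ m * res_ind N c m)
      = (W - 1) * (- (U ^ c - 1) * (\<Sum>j<N. W ^ j))" by (simp add: algebra_simps)
  have "(\<Sum>m<P * N. U ^ m * res_ind N c m) = (\<Sum>l<P. \<Sum>d<N. U ^ l * W ^ d * res_ind N c (l + P * d))"
    unfolding sum_nat_product by (intro sum.cong refl) (simp add: W(1) power_add power_mult)
  \<comment> \<open>W^d is written as 1 + (W - 1) times a geometric sum. The part with 1 vanishes on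
    summing d over a period, and the factor W - 1 of the rest cancels against that in
    \<open>total\<close>.\<close>
  also have "\<dots> = (\<Sum>l<P. \<Sum>d<N. U ^ l * res_ind N c (l + P * d)
      + (W - 1) * (U ^ l * (\<Sum>j<d. W ^ j) * res_ind N c (l + P * d)))"
  proof (intro sum.cong refl)
    fix l d
    have "W ^ d = 1 + (W - 1) * (\<Sum>j<d. W ^ j)" by (simp add: tel)
    then show "U ^ l * W ^ d * res_ind N c (l + P * d) = U ^ l * res_ind N c (l + P * d)
      + (W - 1) * (U ^ l * (\<Sum>j<d. W ^ j) * res_ind N c (l + P * d))"
      by (simp only:) (simp add: algebra_simps)
  qed
  also have "\<dots> = (W - 1) * (\<Sum>l<P. \<Sum>d<N. U ^ l * (\<Sum>j<d. W ^ j) * res_ind N c (l + P * d))"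
    using sum_res_ind_affine[OF c cop, where 'a = 'a]
    by (simp add: sum.distrib mult.assoc flip: sum_distrib_left)
  finally have "(W - 1) * ((1 - U ^ N) * (\<Sum>l<P. \<Sum>d<N. U ^ l * (\<Sum>j<d. W ^ j) * res_ind N c (l + P * d)))
      = (W - 1) * (- (U ^ c - 1) * (\<Sum>j<N. W ^ j))"
    using total by (simp add: mult.left_commute)
  then show ?thesis using W(2) by simp
qed

text \<open>Shifting the window of summation is what produces the second formula for the measure.\<close>

lemma block_shift:
  assumes c: "c < N"
  shows "(\<Sum>d<N. of_nat d * res_ind N c (l + d)) / of_nat N
    = (\<Sum>d<N. of_nat d * res_ind N c d) / of_nat N + (\<Sum>d<l. res_ind N c d :: 'a::field_char_0)"
proof (induction l)
  case (Suc l)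
  have N: "(of_nat N :: 'a) \<noteq> 0" using c by simp
  let ?h = "\<lambda>d. res_ind N c (l + d) :: 'a"
  have zero: "(\<Sum>d<N. ?h (Suc d)) = 0"
    using sum_res_ind_affine[OF c, of 1 "Suc l", where 'a = 'a] by simp
  \<comment> \<open>Passing from l to l + 1, the lost term d = 0 has weight 0 and the new term d = N
    has weight N, which leaves one extra value after division by N.\<close>
  have "(\<Sum>d<Suc N. of_nat d * ?h d) = (\<Sum>d<N. of_nat (Suc d) * ?h (Suc d))"
    by (subst sum.lessThan_Suc_shift) simp
  also have "\<dots> = (\<Sum>d<N. of_nat d * ?h (Suc d))" using zero by (simp add: distrib_right sum.distrib)
  finally have "(\<Sum>d<N. of_nat d * ?h (Suc d)) = (\<Sum>d<N. of_nat d * ?h d) + of_nat N * ?h N" by simp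
  moreover have "?h N = res_ind N c l" by (rule res_ind_mod) (simp add: cong_def)
  ultimately have "(\<Sum>d<N. of_nat d * res_ind N c (Suc l + d)) / of_nat N
      = (\<Sum>d<N. of_nat d * ?h d) / of_nat N + (res_ind N c l :: 'a)"
    using N by (simp add: add_divide_distrib)
  then show ?case using Suc by simp
qed simp

subsection \<open>The Riemann sums of a block\<close>

lemma sum_in_closed:
  assumes "0 \<in> S" "\<And>y z. y \<in> S \<Longrightarrow> z \<in> S \<Longrightarrow> y + z \<in> S" "\<And>i. i \<in> A \<Longrightarrow> f i \<in> S"
  shows "(\<Sum>i\<in>A. f i) \<in> S"
  using assms(3) by (induction A rule: infinite_finite_induct) (simp_all add: assms(1,2))

lemma prod_in_closed:
  assumes "1 \<in> S" "\<And>y z. y \<in> S \<Longrightarrow> z \<in> S \<Longrightarrow> y * z \<in> S" "\<And>i. i \<in> A \<Longrightarrow> f i \<in> S"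
  shows "(\<Prod>i\<in>A. f i) \<in> S"
  using assms(3) by (induction A rule: infinite_finite_induct) (simp_all add: assms(1,2))

text \<open>D starts in degree one, so coefficient m + 1 of D * A isolates coefficient m of A. The
  same recursion serves for limits and for membership in a subfield.\<close>

lemma fps_quotient_rec:
  fixes D A :: "'a::field fps"
  assumes "fps_nth D 0 = 0"
  shows "fps_nth D 1 * fps_nth A m
    = fps_nth (D * A) (Suc m) - (\<Sum>i=2..Suc m. fps_nth D i * fps_nth A (Suc m - i))"
proof -
  have "fps_nth (D * A) (Suc m) = (\<Sum>i=0..Suc m. fps_nth D i * fps_nth A (Suc m - i))"
    by (simp add: fps_mult_nth)
  also have "\<dots> = fps_nth D 0 * fps_nth A (Suc m) + (fps_nth D 1 * fps_nth A m
      + (\<Sum>i=2..Suc m. fps_nth D i * fps_nth A (Suc m - i)))"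
    by (simp add: sum.atLeast_Suc_atMost numeral_2_eq_2)
  finally show ?thesis using assms by simp
qed

lemma ex_fps_quotient:
  fixes D f :: "'a::field fps"
  assumes "fps_nth D 0 = 0" "fps_nth D 1 \<noteq> 0" "fps_nth f 0 = 0"
  shows "\<exists>A. D * A = f"
proof -
  have X: "h = fps_X * fps_shift 1 h" if "fps_nth h 0 = 0" for h :: "'a fps"
    using that by (intro fps_ext) (auto simp: fps_X_mult_nth)
  have "fps_shift 1 D * inverse (fps_shift 1 D) = 1"
    using inverse_mult_eq_1'[of "fps_shift 1 D"] assms(2) by simp
  then have "fps_X * fps_shift 1 D * (inverse (fps_shift 1 D) * fps_shift 1 f) = fps_X * fps_shift 1 f"
    by (metis mult.assoc mult.left_commute mult_1)
  then show ?thesis using X[OF assms(1)] X[OF assms(3)] by metis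
qed

lemma fps_quotient_coeff_closed:
  fixes D A :: "'a::field fps"
  assumes "fps_nth D 0 = 0" "fps_nth D 1 \<noteq> 0"
    and S: "\<And>a b. a \<in> S \<Longrightarrow> b \<in> S \<Longrightarrow> a - b \<in> S" "\<And>a b. a \<in> S \<Longrightarrow> b \<in> S \<Longrightarrow> a * b \<in> S"
      "\<And>a b. a \<in> S \<Longrightarrow> b \<in> S \<Longrightarrow> a / b \<in> S" "0 \<in> S"
    and "\<And>m. fps_nth D m \<in> S" "\<And>m. fps_nth (D * A) m \<in> S"
  shows "fps_nth A m \<in> S"
proof (induction m rule: less_induct)
  case (less m)
  have neg: "- a \<in> S" if "a \<in> S" for a using S(1)[OF S(4) that] by simp
  have add: "a + b \<in> S" if "a \<in> S" "b \<in> S" for a b using S(1)[OF that(1) neg[OF that(2)]] by simp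
  have "(\<Sum>i=2..Suc m. fps_nth D i * fps_nth A (Suc m - i)) \<in> S"
    using less S(2) assms(7) by (intro sum_in_closed[OF S(4) add]) auto
  then have "fps_nth D 1 * fps_nth A m \<in> S"
    unfolding fps_quotient_rec[OF assms(1)] using S(1) assms(8) by blast
  then have "fps_nth D 1 * fps_nth A m / fps_nth D 1 \<in> S" using S(3) assms(7) by blast
  then show ?case using assms(2) by simp
qed

lemma fps_const_sum: "fps_const (\<Sum>i\<in>A. f i :: 'a::comm_ring_1) = (\<Sum>i\<in>A. fps_const (f i))"
  by (induction A rule: infinite_finite_induct) (simp_all flip: fps_const_add)

lemma fps_const_res_ind: "fps_const (res_ind N c d) = res_ind N c d"
  by (auto simp: res_ind_def)

context p_adic
begin

text \<open>Induction along the coefficient recursion. Dividing by the fixed number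
  \<open>fps_nth D 1\<close> is continuous, so a factor p^r in it does no harm.\<close>

lemma fps_quotient_tendsto:
  fixes D :: "'c fps"
  assumes D: "fps_nth D 0 = 0" "fps_nth D 1 \<noteq> 0"
    and lim: "\<And>m. (\<lambda>n. fps_nth (D * F n) m) \<longlonglongrightarrow> fps_nth (D * A) m"
  shows "(\<lambda>n. fps_nth (F n) m) \<longlonglongrightarrow> fps_nth A m"
proof (induction m rule: less_induct)
  case (less m)
  have eq: "fps_nth B m = 1 / fps_nth D 1 * (fps_nth (D * B) (Suc m)
      + - 1 * (\<Sum>i=2..Suc m. fps_nth D i * fps_nth B (Suc m - i)))" for B
    using fps_quotient_rec[OF D(1), of B m] D(2) by (simp add: field_simps)
  show ?case
    unfolding eq[of "F _"] eq[of A]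
    by (intro tendsto_cp_mult tendsto_cp_add tendsto_cp_sum tendsto_const lim less) auto
qed

text \<open>The truncation at degree m matters: the estimates carry 1 / |i!|, which is unbounded in
  i.\<close>

definition small :: "nat \<Rightarrow> real \<Rightarrow> 'c fps \<Rightarrow> bool" where
  "small m e f \<longleftrightarrow> (\<forall>j\<le>m. cp_abs (fps_nth f j) \<le> e)"

lemma small_add: "small m e f \<Longrightarrow> small m e g \<Longrightarrow> small m e (f + g)"
  by (simp add: small_def cp_abs_add_le)

lemma small_uminus: "small m e f \<Longrightarrow> small m e (- f)"
  by (simp add: small_def)

lemma small_sum: "e \<ge> 0 \<Longrightarrow> (\<And>i. i \<in> A \<Longrightarrow> small m e (f i)) \<Longrightarrow> small m e (\<Sum>i\<in>A. f i)"
  by (auto simp: small_def fps_sum_nth intro!: cp_abs_sum_le)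

lemma small_mult:
  assumes "small m 1 f" "small m e g" "e \<ge> 0" shows "small m e (f * g)"
  unfolding small_def fps_mult_nth
proof (intro allI impI cp_abs_sum_le)
  fix j i assume "j \<le> m" "i \<in> {0..j}"
  then have "cp_abs (fps_nth g (j - i)) \<le> e" "cp_abs (fps_nth f i) \<le> 1"
    using assms(1,2) by (auto simp: small_def)
  then show "cp_abs (fps_nth f i * fps_nth g (j - i)) \<le> e"
    unfolding mult.commute[of "fps_nth f i"] by (rule cp_abs_mult_le)
qed (use assms in auto)

lemma small_binomial: "a \<in> Zp \<Longrightarrow> small m 1 (fps_binomial a)"
  by (simp add: small_def cp_abs_gbinomial)

lemma small_const: "cp_abs a \<le> 1 \<Longrightarrow> small m 1 (fps_const a)"
  by (auto simp: small_def)

lemma small_1: "small m 1 1"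
  using small_const[of 1 m] by simp

lemma cp_abs_res_ind: "cp_abs (res_ind N c d :: 'c) \<le> 1"
  unfolding res_ind_def by (intro cp_abs_diff_le) auto

lemma cp_abs_of_nat_inverse: "coprime N p \<Longrightarrow> cp_abs (1 / of_nat N :: 'c) = 1"
  by (simp add: cp_abs_divide cp_abs_of_nat_coprime)

lemma cp_abs_block:
  assumes "coprime N p" shows "cp_abs (block N c P l :: 'c) \<le> 1"
proof -
  have "cp_abs (\<Sum>d<N. of_nat d * res_ind N c (l + P * d) :: 'c) \<le> 1"
    by (intro cp_abs_sum_le cp_abs_mult_le cp_abs_of_nat cp_abs_res_ind) simp
  then show ?thesis using assms by (simp add: block_def cp_abs_divide cp_abs_of_nat_coprime)
qed

text \<open>Dominates 1 / |i!| for every i up to m; the sum stands in for a maximum.\<close>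

definition fact_bound :: "nat \<Rightarrow> real" where
  "fact_bound m = (\<Sum>i\<le>m. 1 / cp_abs (fact i :: 'c))"

lemma fact_bound: "i \<le> m \<Longrightarrow> 1 / cp_abs (fact i :: 'c) \<le> fact_bound m" "fact_bound m \<ge> 0"
  unfolding fact_bound_def by (auto intro!: member_le_sum sum_nonneg)

lemma gbinomial_cong_bound:
  assumes "cp_abs (a :: 'c) \<le> 1" "cp_abs b \<le> 1" "cp_abs (a - b) \<le> eps n" "i \<le> m"
  shows "cp_abs ((a gchoose i) - (b gchoose i)) \<le> fact_bound m * eps n"
proof -
  have "cp_abs ((a gchoose i) - (b gchoose i)) \<le> cp_abs (a - b) * (1 / cp_abs (fact i :: 'c))"
    using cp_abs_gbinomial_diff[OF assms(1,2), of i] by simp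
  also have "\<dots> \<le> eps n * fact_bound m"
    using assms(3,4) fact_bound eps_pos(2) by (intro mult_mono) auto
  finally show ?thesis by (simp add: mult.commute)
qed

text \<open>After multiplication by D = 1 - U^N the difference between Riemann sum and limit is
  explicit: by \<open>block_generating\<close> it is built from terms 1 - W^j with W = U^(p^n),
  whose coefficients up to degree m are at most a constant times p^(-n). D is then divided out by
  the coefficient recursion.\<close>

lemma block_quotient_tendsto:
  fixes a :: 'c
  assumes a: "a \<in> Zp" and c: "c < N" and cop: "coprime p N"
    and A: "(1 - fps_binomial (of_nat p ^ r * of_nat N)) * A
      = fps_binomial (a + of_nat p ^ r * of_nat c) - fps_binomial a"
  shows "(\<lambda>n. \<Sum>l<p ^ n. (of_nat (res n (a + of_nat p ^ r * of_nat l)) gchoose m) * block N c (p ^ n) l)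
    \<longlonglongrightarrow> fps_nth A m"
proof -
  define q :: 'c where "q = of_nat p ^ r"
  define U where "U = fps_binomial q"
  define D where "D = 1 - U ^ N"
  have N: "N > 0" using c by simp
  have q: "q \<in> Zp" "q \<noteq> 0" using Zp_of_nat[of "p ^ r"] p_gt_1 by (simp_all add: q_def)
  have U_power: "U ^ n = fps_binomial (q * of_nat n)" for n
    by (simp add: U_def fps_binomial_power mult.commute)
  have D_eq: "D = 1 - fps_binomial (of_nat p ^ r * of_nat N)"
    by (simp add: D_def U_power q_def)
  have D01: "fps_nth D 0 = 0" "fps_nth D 1 \<noteq> 0"
    using q N by (simp_all add: D_def U_power)
  have DA: "D * A = fps_binomial a * (U ^ c - 1)"
    unfolding D_eq A by (simp add: U_power fps_binomial_add_mult q_def algebra_simps)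
  have int: "a + q * of_nat l \<in> Zp" "q * of_nat l \<in> Zp" for l
    using Zp_add[OF a] Zp_mult[OF q(1) Zp_of_nat] by blast+
  have small_U: "small m 1 (U ^ n)" for m n unfolding U_power using int(2) by (rule small_binomial)
  have small_minus_1: "small m 1 (U ^ n - 1)" for m n
    using small_add[OF small_U small_uminus[OF small_1]] by simp
  have small_D: "small m 1 D" for m
    using small_uminus[OF small_minus_1[of m N]] by (simp add: D_def)
  \<comment> \<open>The exact points a + q * l come first; their residues modulo p^n, at which the
    statement evaluates, replace them only at the end, at the cost of a further error of order
    p^(-n).\<close>
  define F where "F n = (\<Sum>l<p ^ n. fps_binomial (a + q * of_nat l) * fps_const (block N c (p ^ n) l))" for n
  have main: "small m (fact_bound m * eps n) (D * F n - D * A)" for m n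
  proof -
    let ?e = "fact_bound m * eps n"
    have e: "?e \<ge> 0" using fact_bound(2) eps_pos(2) by simp
    define W where "W = U ^ (p ^ n)"
    define k where "k = fps_const (1 / of_nat N :: 'c)"
    \<comment> \<open>\<open>S0\<close> is what the Riemann sum contains, with weights d;
      \<open>S1\<close> has geometric sums of W in place of d and is the one with a closed
      formula.\<close>
    define S0 where "S0 = (\<Sum>l<p ^ n. \<Sum>d<N. U ^ l * of_nat d * res_ind N c (l + p ^ n * d))"
    define S1 where "S1 = (\<Sum>l<p ^ n. \<Sum>d<N. U ^ l * (\<Sum>j<d. W ^ j) * res_ind N c (l + p ^ n * d))"
    have "fps_nth W 1 \<noteq> 0" using q p_gt_1 by (simp add: W_def U_power)
    then have "W \<noteq> 1" by auto
    then have S1: "D * S1 = - (U ^ c - 1) * (\<Sum>j<N. W ^ j)"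
      unfolding D_def S1_def using cop c by (intro block_generating) (simp_all add: W_def)
    have k: "k * of_nat N = 1" using N by (simp add: k_def flip: fps_of_nat fps_const_mult)
    have "F n = - k * fps_binomial a * S0"
    proof -
      have "fps_const (block N c (p ^ n) l) = - k * (\<Sum>d<N. of_nat d * res_ind N c (l + p ^ n * d))"
        for l
      proof -
        have "fps_const (\<Sum>d<N. of_nat d * res_ind N c (l + p ^ n * d) :: 'c)
          = (\<Sum>d<N. of_nat d * res_ind N c (l + p ^ n * d))"
          unfolding fps_const_sum fps_const_mult[symmetric] fps_of_nat fps_const_res_ind ..
        moreover have "fps_const (block N c (p ^ n) l)
          = - k * fps_const (\<Sum>d<N. of_nat d * res_ind N c (l + p ^ n * d) :: 'c)"
          by (simp add: block_def k_def)
        ultimately show ?thesis by simp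
      qed
      then show ?thesis
        unfolding F_def S0_def
        by (simp add: fps_binomial_add_mult U_power sum_distrib_left sum_negf algebra_simps)
    qed
    moreover have "D * A = k * fps_binomial a * (of_nat N * (U ^ c - 1))"
    proof -
      have "k * fps_binomial a * (of_nat N * (U ^ c - 1)) = k * of_nat N * (fps_binomial a * (U ^ c - 1))"
        by (simp only: mult_ac)
      then show ?thesis by (simp only: k DA mult_1)
    qed
    ultimately have "D * F n - D * A = - (k * fps_binomial a * (D * S0 + of_nat N * (U ^ c - 1)))"
      by (simp add: algebra_simps)
    \<comment> \<open>D * S1 is subtracted as it stands and added back in closed form, so that the
      error consists of differences between an integer and a geometric sum in W.\<close>
    also have "D * S0 + of_nat N * (U ^ c - 1) = D * (S0 - S1) + (U ^ c - 1) * (of_nat N - (\<Sum>j<N. W ^ j))"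
      unfolding right_diff_distrib[of D] S1 by (simp add: algebra_simps)
    finally have eq: "D * F n - D * A
      = - (k * fps_binomial a * (D * (S0 - S1) + (U ^ c - 1) * (of_nat N - (\<Sum>j<N. W ^ j))))" .
    have small_W: "small m ?e (1 - W ^ j)" for j
      unfolding small_def
    proof (intro allI impI)
      fix i assume i: "i \<le> m"
      have "W ^ j = U ^ (p ^ n * j)" by (simp add: W_def power_mult)
      then have "W ^ j = fps_binomial (q * of_nat (p ^ n * j))" by (simp only: U_power)
      then have "fps_nth (1 - W ^ j) i = (0 gchoose i) - ((q * of_nat (p ^ n * j)) gchoose i)"
        using fps_binomial_nth[of "0 :: 'c" i] by simp
      moreover have "cp_abs (0 - q * of_nat (p ^ n * j)) \<le> eps n"
        using mult_mono[OF Zp_abs[OF q(1)] mult_mono[OF order_refl[of "eps n"] cp_abs_of_nat[of j]]] eps_pos(2)[of n]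
        by (simp add: cp_abs_mult cp_abs_p_power)
      ultimately show "cp_abs (fps_nth (1 - W ^ j) i) \<le> ?e"
        using gbinomial_cong_bound[OF _ Zp_abs[OF int(2)] _ i, of 0 "p ^ n * j" n] by simp
    qed
    have small_d: "small m ?e (of_nat d - (\<Sum>j<d. W ^ j))" for d
    proof -
      have "of_nat d - (\<Sum>j<d. W ^ j) = (\<Sum>j<d. 1 - W ^ j)" by (simp add: sum_subtractf)
      then show ?thesis using small_sum[OF e small_W] by simp
    qed
    have "S0 - S1 = (\<Sum>l<p ^ n. \<Sum>d<N. U ^ l * (res_ind N c (l + p ^ n * d) * (of_nat d - (\<Sum>j<d. W ^ j))))"
      unfolding S0_def S1_def sum_subtractf[symmetric] by (intro sum.cong refl) (simp add: algebra_simps)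
    also have "small m ?e \<dots>"
      unfolding fps_const_res_ind[symmetric]
      by (intro small_sum e small_mult small_U small_d small_const cp_abs_res_ind)
    finally have "small m ?e (S0 - S1)" .
    then have "small m ?e (D * (S0 - S1) + (U ^ c - 1) * (of_nat N - (\<Sum>j<N. W ^ j)))"
      by (rule small_add[OF small_mult[OF small_D _ e] small_mult[OF small_minus_1 small_d e]])
    moreover have "small m 1 (k * fps_binomial a)"
      unfolding k_def using cp_abs_of_nat_inverse[of N] cop
      by (intro small_mult[OF small_const small_binomial[OF a]]) (simp_all add: coprime_commute)
    ultimately show ?thesis
      unfolding eq by (intro small_uminus) (rule small_mult[OF _ _ e])
  qed
  have "(\<lambda>n. fps_nth (D * F n) m - fps_nth (D * A) m) \<longlonglongrightarrow> 0" for m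
    using main[of m] by (intro tendsto_cp_zeroI[where C = "fact_bound m"]) (simp add: small_def)
  then have lim: "(\<lambda>n. fps_nth (F n) m) \<longlonglongrightarrow> fps_nth A m"
    by (rule fps_quotient_tendsto[OF D01 tendsto_cp_eqI[OF _ tendsto_const]])
  have "cp_abs ((\<Sum>l<p ^ n. (of_nat (res n (a + q * of_nat l)) gchoose m) * block N c (p ^ n) l) - fps_nth (F n) m)
      \<le> fact_bound m * eps n" for n
  proof -
    have "(\<Sum>l<p ^ n. (of_nat (res n (a + q * of_nat l)) gchoose m) * block N c (p ^ n) l) - fps_nth (F n) m
      = (\<Sum>l<p ^ n. ((of_nat (res n (a + q * of_nat l)) gchoose m) - ((a + q * of_nat l) gchoose m)) * block N c (p ^ n) l)"
      by (simp add: F_def fps_sum_nth sum_subtractf algebra_simps)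
    also have "cp_abs \<dots> \<le> fact_bound m * eps n"
    proof (intro cp_abs_sum_le cp_abs_mult_le cp_abs_block)
      fix l
      show "cp_abs ((of_nat (res n (a + q * of_nat l)) gchoose m) - ((a + q * of_nat l) gchoose m)) \<le> fact_bound m * eps n"
        using res_approx[OF int(1), of l n] cp_abs_commute[of "a + q * of_nat l"]
        by (intro gbinomial_cong_bound cp_abs_of_nat Zp_abs int) simp_all
      show "coprime N p" using cop by (simp add: coprime_commute)
    qed (use fact_bound(2) eps_pos(2) in simp)
    finally show ?thesis .
  qed
  then have "(\<lambda>n. (\<Sum>l<p ^ n. (of_nat (res n (a + q * of_nat l)) gchoose m) * block N c (p ^ n) l) - fps_nth (F n) m)
    \<longlonglongrightarrow> 0" by (rule tendsto_cp_zeroI)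
  then show ?thesis using lim unfolding q_def by (rule tendsto_cp_eqI)
qed

end

subsection \<open>Integral Mahler expansions of locally constant functions\<close>

definition fdiff :: "(nat \<Rightarrow> int) \<Rightarrow> nat \<Rightarrow> int" where
  "fdiff f b = f (Suc b) - f b"

lemma fdiff_power_Suc: "(fdiff ^^ Suc k) f b = (fdiff ^^ k) f (Suc b) - (fdiff ^^ k) f b"
  by (simp add: fdiff_def)

lemma fdiff_power_eq:
  "(fdiff ^^ k) f b = (\<Sum>j\<le>k. (-1) ^ (k + j) * int (k choose j) * f (b + j))"
proof (induction k arbitrary: b)
  case (Suc k)
  have "(\<Sum>j\<le>Suc k. (-1) ^ (Suc k + j) * int (Suc k choose j) * f (b + j))
    = (-1) ^ Suc k * f b + (\<Sum>j\<le>k. (-1) ^ (k + j) * (int (k choose j) + int (k choose Suc j)) * f (b + Suc j))"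
    by (subst sum.atMost_Suc_shift) simp
  also have "\<dots> = (\<Sum>j\<le>k. (-1) ^ (k + j) * int (k choose j) * f (Suc b + j))
    + ((-1) ^ Suc k * f b + (\<Sum>j\<le>k. (-1) ^ (k + j) * int (k choose Suc j) * f (b + Suc j)))"
    by (simp add: algebra_simps sum.distrib)
  also have "(-1) ^ Suc k * f b + (\<Sum>j\<le>k. (-1) ^ (k + j) * int (k choose Suc j) * f (b + Suc j))
    = (\<Sum>j\<le>Suc k. (-1) ^ (Suc k + j) * int (k choose j) * f (b + j))"
    by (subst sum.atMost_Suc_shift) simp
  also have "\<dots> = - (\<Sum>j\<le>k. (-1) ^ (k + j) * int (k choose j) * f (b + j))"
    by (simp add: binomial_eq_0 sum_negf)
  finally show ?case unfolding fdiff_power_Suc Suc.IH by simp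
qed simp

lemma fdiff_power_mult: "(fdiff ^^ k) (\<lambda>b. c * f b) b = c * (fdiff ^^ k) f b"
  by (simp add: fdiff_power_eq sum_distrib_left mult_ac)

lemma newton_expansion:
  "f b = (\<Sum>m\<le>b. (fdiff ^^ m) f 0 * int (b choose m))"
proof (induction b arbitrary: f)
  case (Suc b)
  have comm: "(fdiff ^^ m) (fdiff f) = (fdiff ^^ Suc m) f" for m
    by (simp add: funpow_swap1)
  have "f (Suc b) = fdiff f b + f b" by (simp add: fdiff_def)
  also have "\<dots> = (\<Sum>m\<le>b. (fdiff ^^ Suc m) f 0 * int (b choose m)) + (\<Sum>m\<le>b. (fdiff ^^ m) f 0 * int (b choose m))"
    using Suc[of f] Suc[of "fdiff f"] by (simp only: comm)
  also have "(\<Sum>m\<le>b. (fdiff ^^ m) f 0 * int (b choose m)) = (\<Sum>m\<le>Suc b. (fdiff ^^ m) f 0 * int (b choose m))"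
    by (simp add: binomial_eq_0)
  also have "\<dots> = f 0 + (\<Sum>m\<le>b. (fdiff ^^ Suc m) f 0 * int (b choose Suc m))"
    by (subst sum.atMost_Suc_shift) simp
  also have "(\<Sum>m\<le>b. (fdiff ^^ Suc m) f 0 * int (b choose m)) + (f 0 + (\<Sum>m\<le>b. (fdiff ^^ Suc m) f 0 * int (b choose Suc m)))
    = (\<Sum>m\<le>Suc b. (fdiff ^^ m) f 0 * int (Suc b choose m))"
  proof -
    have "(\<Sum>m\<le>Suc b. (fdiff ^^ m) f 0 * int (Suc b choose m))
      = f 0 + (\<Sum>m\<le>b. (fdiff ^^ Suc m) f 0 * int (Suc b choose Suc m))"
      by (subst sum.atMost_Suc_shift) simp
    then show ?thesis by (simp add: algebra_simps sum.distrib del: funpow.simps)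
  qed
  finally show ?case .
qed simp

text \<open>By absorption p^n divides j * (p^n choose j); if the coefficient were prime to p, p^n
  would divide j.\<close>

lemma prime_dvd_choose_power:
  assumes "Factorial_Ring.prime p" "0 < j" "j < p ^ n" shows "p dvd (p ^ n choose j)"
proof (rule ccontr)
  assume "\<not> p dvd (p ^ n choose j)"
  then have "coprime (p ^ n) (p ^ n choose j)" using assms(1) by (simp add: prime_imp_coprime)
  moreover have "p ^ n dvd j * (p ^ n choose j)"
    using binomial_absorption[of "j - 1" "p ^ n"] assms by (simp add: mult.commute)
  ultimately have "p ^ n dvd j" by (simp add: coprime_dvd_mult_left_iff)
  then show False using assms(2,3) by (simp add: nat_dvd_not_less)
qed

text \<open>With E the shift, only the outer terms in the expansion of (E - 1)^(p^n) survive modulo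
  p. By periodicity they add up to ((-1)^(p^n) + 1) f, which is 0 for odd p^n and 2 f otherwise,
  where p = 2.\<close>

lemma fdiff_power_prime_dvd:
  assumes p: "Factorial_Ring.prime p" and per: "\<And>b. f (b + p ^ n) = f b"
  shows "int p dvd (fdiff ^^ (p ^ n)) f b"
proof -
  have pos: "p ^ n > 0" using p prime_gt_0_nat by simp
  have "(fdiff ^^ (p ^ n)) f b = (\<Sum>j\<in>{..p ^ n}. (-1) ^ (p ^ n + j) * int (p ^ n choose j) * f (b + j))"
    by (rule fdiff_power_eq)
  also have "{..p ^ n} = insert 0 (insert (p ^ n) {0<..<p ^ n})" using pos by auto
  also have "(\<Sum>j\<in>\<dots>. (-1) ^ (p ^ n + j) * int (p ^ n choose j) * f (b + j))
    = (-1) ^ (p ^ n) * f b + f b + (\<Sum>j\<in>{0<..<p ^ n}. (-1) ^ (p ^ n + j) * int (p ^ n choose j) * f (b + j))"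
    using pos per[of b] by (simp flip: mult_2)
  finally have eq: "(fdiff ^^ (p ^ n)) f b
    = ((-1) ^ (p ^ n) + 1) * f b + (\<Sum>j\<in>{0<..<p ^ n}. (-1) ^ (p ^ n + j) * int (p ^ n choose j) * f (b + j))"
    by (simp add: algebra_simps)
  have "int p dvd (\<Sum>j\<in>{0<..<p ^ n}. (-1) ^ (p ^ n + j) * int (p ^ n choose j) * f (b + j))"
  proof (rule dvd_sum)
    fix j assume "j \<in> {0<..<p ^ n}"
    then have "int p dvd int (p ^ n choose j)" using prime_dvd_choose_power[OF p] by (simp add: int_dvd_int_iff)
    then show "int p dvd (-1) ^ (p ^ n + j) * int (p ^ n choose j) * f (b + j)" by simp
  qed
  moreover have "int p dvd (-1) ^ (p ^ n) + 1"
  proof (cases "odd (p ^ n)")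
    case False
    then have "p = 2" using p primes_dvd_imp_eq[of 2 p] by (auto simp: two_is_prime_nat)
    then show ?thesis using False by simp
  qed simp
  ultimately show ?thesis unfolding eq by simp
qed

text \<open>The p^n-th difference divided by p is again p^n-periodic, so every further p^n
  differences contribute another factor p.\<close>

lemma fdiff_power_dvd:
  assumes p: "Factorial_Ring.prime p"
  shows "(\<And>b. f (b + p ^ n) = f b) \<Longrightarrow> k \<ge> M * p ^ n \<Longrightarrow> int p ^ M dvd (fdiff ^^ k) f b"
proof (induction M arbitrary: f k)
  case (Suc M)
  let ?P = "p ^ n"
  define g where "g b = (fdiff ^^ ?P) f b div int p" for b
  have eq: "(fdiff ^^ ?P) f = (\<lambda>b. int p * g b)"
    using fdiff_power_prime_dvd[where f = f, OF p Suc.prems(1)] by (auto simp: g_def)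
  have "(fdiff ^^ ?P) f (b + ?P) = (fdiff ^^ ?P) f b" for b
  proof -
    have "f (b + ?P + j) = f (b + j)" for j using Suc.prems(1)[of "b + j"] by (simp add: ac_simps)
    then show ?thesis unfolding fdiff_power_eq by simp
  qed
  then have "g (b + ?P) = g b" for b by (simp add: g_def)
  then have "int p ^ M dvd (fdiff ^^ (k - ?P)) g b" using Suc.prems(2) by (intro Suc.IH) auto
  moreover have "(fdiff ^^ k) f b = int p * (fdiff ^^ (k - ?P)) g b"
  proof -
    have "k = k - ?P + ?P" using Suc.prems(2) by simp
    then have "(fdiff ^^ k) f = (fdiff ^^ (k - ?P)) ((fdiff ^^ ?P) f)"
      by (metis comp_apply funpow_add)
    then show ?thesis by (simp add: eq fdiff_power_mult)
  qed
  ultimately show ?case by simp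
qed simp

text \<open>Newton's expansion is finite at each b, and its terms with m >= M * p^n are divisible by
  p^M; the point of truncation is thus independent of b.\<close>

lemma mahler_approx:
  assumes p: "Factorial_Ring.prime p" and per: "\<And>b. f (b + p ^ n) = f b"
  shows "int p ^ M dvd f b - (\<Sum>m<M * p ^ n. (fdiff ^^ m) f 0 * int (b choose m))"
proof -
  let ?t = "\<lambda>m. (fdiff ^^ m) f 0 * int (b choose m)"
  have "f b = (\<Sum>m\<le>b. ?t m)" by (rule newton_expansion)
  also have "\<dots> = (\<Sum>m<M * p ^ n + Suc b. ?t m)"
    by (rule sum.mono_neutral_left) (auto simp: binomial_eq_0)
  also have "{..<M * p ^ n + Suc b} = {..<M * p ^ n} \<union> {M * p ^ n..<M * p ^ n + Suc b}" by auto
  also have "(\<Sum>m\<in>\<dots>. ?t m) = (\<Sum>m<M * p ^ n. ?t m) + (\<Sum>m=M * p ^ n..<M * p ^ n + Suc b. ?t m)"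
    by (rule sum.union_disjoint) auto
  finally have "f b - (\<Sum>m<M * p ^ n. ?t m) = (\<Sum>m=M * p ^ n..<M * p ^ n + Suc b. ?t m)" by simp
  moreover have "int p ^ M dvd (\<Sum>m=M * p ^ n..<M * p ^ n + Suc b. ?t m)"
    using fdiff_power_dvd[where f = f, OF p per] by (intro dvd_sum dvd_mult2) auto
  ultimately show ?thesis by simp
qed

context p_adic
begin

subsection \<open>Cells\<close>

text \<open>Compact open subsets of \<open>p^(-r) Z_p^k\<close> are finite unions of the cells \<open>(a + p^n Z_p^k) / p^r\<close>.\<close>

definition cell :: "nat \<Rightarrow> nat \<Rightarrow> ('k::finite \<Rightarrow> nat) \<Rightarrow> ('k \<Rightarrow> 'c) set" where
  "cell r n a = lattice_coset (\<lambda>i. of_nat (a i) / of_nat p ^ r) (of_nat p ^ n / of_nat p ^ r)"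

text \<open>The label of the cell of level n around \<gamma>.\<close>

definition digits :: "nat \<Rightarrow> nat \<Rightarrow> ('k::finite \<Rightarrow> 'c) \<Rightarrow> 'k \<Rightarrow> nat" where
  "digits r n \<gamma> = (\<lambda>i. res n (of_nat p ^ r * \<gamma> i))"

lemma mem_lattice_coset_iff:
  fixes \<alpha> \<gamma> :: "'k::finite \<Rightarrow> 'c"
  shows "\<gamma> \<in> lattice_coset \<alpha> (of_nat p ^ n / of_nat p ^ r) \<longleftrightarrow>
    (\<forall>i. of_nat p ^ r * (\<gamma> i - \<alpha> i) \<in> Zp \<and> cp_abs (of_nat p ^ r * (\<gamma> i - \<alpha> i)) \<le> eps n)"
proof
  assume "\<gamma> \<in> lattice_coset \<alpha> (of_nat p ^ n / of_nat p ^ r)"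
  then obtain \<beta> where \<beta>: "\<And>i. \<beta> i \<in> Zp" "\<gamma> = (\<lambda>i. \<alpha> i + of_nat p ^ n / of_nat p ^ r * \<beta> i)"
    by (auto simp: lattice_coset_def)
  have eq: "of_nat p ^ r * (\<gamma> i - \<alpha> i) = of_nat p ^ n * \<beta> i" for i
    using p_gt_1 by (simp add: \<beta>(2))
  have "of_nat p ^ n * \<beta> i \<in> Zp" for i using Zp_mult[OF Zp_of_nat[of "p ^ n"] \<beta>(1)] by simp
  moreover have "cp_abs (of_nat p ^ n * \<beta> i) \<le> eps n" for i
    using Zp_abs[OF \<beta>(1)] by (intro cp_abs_mult_le) (simp_all add: cp_abs_p_power)
  ultimately show "\<forall>i. of_nat p ^ r * (\<gamma> i - \<alpha> i) \<in> Zp \<and> cp_abs (of_nat p ^ r * (\<gamma> i - \<alpha> i)) \<le> eps n"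
    unfolding eq by blast
next
  assume *: "\<forall>i. of_nat p ^ r * (\<gamma> i - \<alpha> i) \<in> Zp \<and> cp_abs (of_nat p ^ r * (\<gamma> i - \<alpha> i)) \<le> eps n"
  define \<beta> where "\<beta> i = of_nat p ^ r * (\<gamma> i - \<alpha> i) / of_nat p ^ n" for i
  have "\<gamma> = (\<lambda>i. \<alpha> i + of_nat p ^ n / of_nat p ^ r * \<beta> i)"
    using p_gt_1 by (simp add: \<beta>_def fun_eq_iff)
  moreover have "\<beta> i \<in> Zp" for i using Zp_divide_power * unfolding \<beta>_def by blast
  ultimately show "\<gamma> \<in> lattice_coset \<alpha> (of_nat p ^ n / of_nat p ^ r)"
    by (auto simp: lattice_coset_def)
qed

lemma O_dagger_iff: "\<gamma> \<in> O_dagger p r \<longleftrightarrow> (\<forall>i. of_nat p ^ r * \<gamma> i \<in> (Zp :: 'c set))"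
  using mem_lattice_coset_iff[of \<gamma> "\<lambda>_. 0" 0 r] by (auto simp: O_dagger_def Zp_abs)

lemma Zp_diff_iff: "(z :: 'c) \<in> Zp \<Longrightarrow> y - z \<in> Zp \<longleftrightarrow> y \<in> Zp"
  using Zp_add[of "y - z" z] Zp_diff[of y z] by auto

text \<open>Any point of an ultrametric ball is a centre of it, so a centre with p-adic coordinates
  may be exchanged for one with integers over p^r.\<close>

lemma coset_eq_cell:
  fixes \<alpha> :: "'k::finite \<Rightarrow> 'c"
  assumes "\<alpha> \<in> O_dagger p r" "\<And>i. cp_abs (of_nat p ^ r * \<alpha> i - of_nat (a i)) \<le> eps n"
  shows "lattice_coset \<alpha> (of_nat p ^ n / of_nat p ^ r) = cell r n a"
proof (rule Set.set_eqI)
  fix \<gamma> :: "'k \<Rightarrow> 'c"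
  have "of_nat p ^ r * (\<gamma> i - \<alpha> i) \<in> Zp \<and> cp_abs (of_nat p ^ r * (\<gamma> i - \<alpha> i)) \<le> eps n \<longleftrightarrow>
    of_nat p ^ r * (\<gamma> i - of_nat (a i) / of_nat p ^ r) \<in> Zp \<and>
    cp_abs (of_nat p ^ r * (\<gamma> i - of_nat (a i) / of_nat p ^ r)) \<le> eps n" for i
  proof -
    let ?y = "of_nat p ^ r * \<gamma> i" and ?z = "of_nat p ^ r * \<alpha> i" and ?a = "of_nat (a i) :: 'c"
    have z: "?z \<in> Zp" using assms(1) by (simp add: O_dagger_iff)
    have "cp_abs (?y - ?z) \<le> eps n \<longleftrightarrow> cp_abs (?y - ?a) \<le> eps n"
      using cp_abs_triangle_le[of ?y ?z "eps n" ?a] cp_abs_triangle_le[of ?y ?a "eps n" ?z]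
        assms(2)[of i] cp_abs_commute[of ?z ?a] by auto
    then show ?thesis
      using Zp_diff_iff[OF z, of ?y] Zp_diff_iff[OF Zp_of_nat[of "a i"], of ?y] p_gt_1
      by (simp add: right_diff_distrib)
  qed
  then show "\<gamma> \<in> lattice_coset \<alpha> (of_nat p ^ n / of_nat p ^ r) \<longleftrightarrow> \<gamma> \<in> cell r n a"
    unfolding cell_def mem_lattice_coset_iff by blast
qed

lemma cell_iff:
  fixes \<gamma> :: "'k::finite \<Rightarrow> 'c"
  shows "\<gamma> \<in> cell r n a \<longleftrightarrow> \<gamma> \<in> O_dagger p r \<and> (\<forall>i. [a i = digits r n \<gamma> i] (mod p ^ n))"
proof -
  have "of_nat p ^ r * (\<gamma> i - of_nat (a i) / of_nat p ^ r) = of_nat p ^ r * \<gamma> i - of_nat (a i)" for i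
    using p_gt_1 by (simp add: right_diff_distrib)
  then have "\<gamma> \<in> cell r n a \<longleftrightarrow> (\<forall>i. of_nat p ^ r * \<gamma> i \<in> Zp \<and> cp_abs (of_nat p ^ r * \<gamma> i - of_nat (a i)) \<le> eps n)"
    unfolding cell_def mem_lattice_coset_iff using Zp_diff_iff[OF Zp_of_nat] by simp
  then show ?thesis
    using cp_abs_diff_le_iff_res unfolding O_dagger_iff digits_def by blast
qed

lemma digits_less: "\<gamma> \<in> O_dagger p r \<Longrightarrow> digits r n \<gamma> i < p ^ n"
  by (simp add: digits_def O_dagger_iff res_less)

lemma digits_mod:
  assumes "\<gamma> \<in> O_dagger p r" "n \<le> m" shows "[digits r m \<gamma> i = digits r n \<gamma> i] (mod p ^ n)"
proof -
  have y: "of_nat p ^ r * \<gamma> i \<in> Zp" using assms(1) by (simp add: O_dagger_iff)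
  have "cp_abs (of_nat p ^ r * \<gamma> i - of_nat (res m (of_nat p ^ r * \<gamma> i))) \<le> eps n"
    using res_approx[OF y, of m] eps_mono[OF assms(2)] by linarith
  then show ?thesis using cp_abs_diff_le_iff_res[OF y] by (simp add: digits_def)
qed

lemma cell_iff_box:
  assumes "\<forall>i. a i < p ^ n"
  shows "\<gamma> \<in> cell r n a \<longleftrightarrow> \<gamma> \<in> O_dagger p r \<and> digits r n \<gamma> = a"
proof (cases "\<gamma> \<in> O_dagger p r")
  case True
  then have "[a i = digits r n \<gamma> i] (mod p ^ n) \<longleftrightarrow> digits r n \<gamma> i = a i" for i
    using assms digits_less[OF True, of n i] by (auto simp: cong_def)
  then show ?thesis using True by (auto simp: cell_iff fun_eq_iff)
qed (simp add: cell_iff)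

lemma ex_cell_point: "\<exists>\<gamma>. \<gamma> \<in> cell r n (a :: 'k::finite \<Rightarrow> nat)"
proof
  have "0 \<in> (Zp :: 'c set)" using Zp_of_nat[of 0] by simp
  then show "(\<lambda>i. of_nat (a i) / of_nat p ^ r) \<in> cell r n a"
    using eps_pos(2)[of n] by (simp add: cell_def mem_lattice_coset_iff)
qed

lemma cell_subset_O_dagger: "cell r n a \<subseteq> O_dagger p r"
  by (auto simp: cell_iff)

lemma cell_subset_iff:
  assumes "n \<le> m" shows "cell r m b \<subseteq> cell r n a \<longleftrightarrow> (\<forall>i. [b i = a i] (mod p ^ n))"
proof -
  have key: "[b i = digits r n \<gamma> i] (mod p ^ n)" if "\<gamma> \<in> cell r m b" for \<gamma> i
    using that digits_mod[of \<gamma> r n m i] assms cong_dvd_modulus_nat[of "b i" "digits r m \<gamma> i" "p ^ m" "p ^ n"]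
    by (auto simp: cell_iff le_imp_power_dvd intro: cong_trans)
  show ?thesis
  proof
    assume sub: "cell r m b \<subseteq> cell r n a"
    obtain \<gamma> where \<gamma>: "\<gamma> \<in> cell r m b" using ex_cell_point by blast
    then have "\<gamma> \<in> cell r n a" using sub by blast
    then have "\<forall>i. [a i = digits r n \<gamma> i] (mod p ^ n)" by (simp add: cell_iff)
    then show "\<forall>i. [b i = a i] (mod p ^ n)" using key[OF \<gamma>] by (meson cong_sym cong_trans)
  next
    assume "\<forall>i. [b i = a i] (mod p ^ n)"
    then have "[a i = digits r n \<gamma> i] (mod p ^ n)" if "\<gamma> \<in> cell r m b" for \<gamma> i
      using key[OF that] by (meson cong_sym cong_trans)
    then show "cell r m b \<subseteq> cell r n a" unfolding cell_iff subset_iff using cell_iff by blast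
  qed
qed

lemma cell_cong: "(\<And>i. [a i = b i] (mod p ^ n)) \<Longrightarrow> cell r n a = cell r n b"
  using cell_subset_iff[of n n r] cong_sym by (intro subset_antisym) blast+

subsection \<open>Topology\<close>

text \<open>An ultrametric closed ball of radius e contains the ball of radius e around each of its
  points.\<close>

lemma open_cp_cball: "open {z :: 'c. cp_abs (z - y) \<le> e}" if "e > 0"
  unfolding open_dist
proof (intro ballI exI conjI allI impI)
  fix z w assume "z \<in> {z. cp_abs (z - y) \<le> e}" "dist w z < e"
  then have "cp_abs (w - z) \<le> e" "cp_abs (z - y) \<le> e" by (simp_all add: dist_cp)
  then show "w \<in> {z. cp_abs (z - y) \<le> e}" using cp_abs_triangle_le by blast
qed (rule that)

lemma open_digit_class:
  fixes \<gamma> :: "'k::finite \<Rightarrow> 'c"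
  shows "open {\<delta>. \<forall>i. cp_abs (of_nat p ^ r * (\<delta> i - \<gamma> i)) \<le> eps n}"
proof -
  have eq: "cp_abs (of_nat p ^ r * (\<delta> i - \<gamma> i)) \<le> eps n \<longleftrightarrow> cp_abs (\<delta> i - \<gamma> i) \<le> eps n / eps r" for \<delta> i
    unfolding cp_abs_mult cp_abs_p_power pos_le_divide_eq[OF eps_pos(1)] by (simp only: mult.commute)
  have "{\<delta>. \<forall>i. cp_abs (of_nat p ^ r * (\<delta> i - \<gamma> i)) \<le> eps n}
    = PiE UNIV (\<lambda>i. {z. cp_abs (z - \<gamma> i) \<le> eps n / eps r})"
    unfolding eq by (auto simp: PiE_def Pi_def)
  also have "open \<dots>"
    using eps_pos(1) by (intro open_PiE open_cp_cball) auto
  finally show ?thesis .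
qed

lemma mem_cell_digits:
  assumes "\<gamma> \<in> O_dagger p r"
  shows "\<delta> \<in> cell r n (digits r n \<gamma>) \<longleftrightarrow>
    \<delta> \<in> O_dagger p r \<and> (\<forall>i. cp_abs (of_nat p ^ r * (\<delta> i - \<gamma> i)) \<le> eps n)"
proof (cases "\<delta> \<in> O_dagger p r")
  case True
  have "digits r n \<delta> = digits r n \<gamma> \<longleftrightarrow> (\<forall>i. cp_abs (of_nat p ^ r * (\<delta> i - \<gamma> i)) \<le> eps n)"
    using assms True res_cong[of "of_nat p ^ r * \<delta> _" "of_nat p ^ r * \<gamma> _" n]
    by (auto simp: O_dagger_iff digits_def fun_eq_iff right_diff_distrib)
  then show ?thesis using True digits_less[OF assms] by (simp add: cell_iff_box)
qed (simp add: cell_iff)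

lemma open_in_cell: "openin (top_of_set (O_dagger p r)) (cell r n a)"
proof -
  obtain \<gamma> where \<gamma>: "\<gamma> \<in> cell r n a" using ex_cell_point by blast
  then have "\<gamma> \<in> O_dagger p r" "cell r n a = cell r n (digits r n \<gamma>)"
    by (auto simp: cell_iff intro!: cell_cong)
  then have "cell r n a = O_dagger p r \<inter> {\<delta>. \<forall>i. cp_abs (of_nat p ^ r * (\<delta> i - \<gamma> i)) \<le> eps n}"
    using mem_cell_digits by blast
  then show ?thesis unfolding openin_open using open_digit_class by blast
qed

lemma compact_lattice_coset: "compact (lattice_coset (\<alpha> :: 'k::finite \<Rightarrow> 'c) e)"
proof -
  have "lattice_coset \<alpha> e = PiE UNIV (\<lambda>i. (\<lambda>z. \<alpha> i + e * z) ` Zp)"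
  proof
    show "lattice_coset \<alpha> e \<subseteq> PiE UNIV (\<lambda>i. (\<lambda>z. \<alpha> i + e * z) ` Zp)"
      by (auto simp: lattice_coset_def)
    show "PiE UNIV (\<lambda>i. (\<lambda>z. \<alpha> i + e * z) ` Zp) \<subseteq> lattice_coset \<alpha> e"
    proof
      fix \<gamma> assume "\<gamma> \<in> PiE UNIV (\<lambda>i. (\<lambda>z. \<alpha> i + e * z) ` Zp)"
      then have "\<forall>i. \<exists>z. z \<in> Zp \<and> \<gamma> i = \<alpha> i + e * z" by (auto simp: PiE_def Pi_def)
      then obtain \<beta> where "\<And>i. \<beta> i \<in> Zp" "\<And>i. \<gamma> i = \<alpha> i + e * \<beta> i" by metis
      then show "\<gamma> \<in> lattice_coset \<alpha> e" by (auto simp: lattice_coset_def)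
    qed
  qed
  moreover have "compact ((\<lambda>z. \<alpha> i + e * z) ` Zp)" for i
  proof (rule compact_continuous_image[OF _ compact_Zp])
    have "(cp_abs e)-lipschitz_on Zp (\<lambda>z. \<alpha> i + e * z)"
      by (intro lipschitz_onI) (simp_all add: dist_cp cp_abs_mult flip: right_diff_distrib)
    then show "continuous_on Zp (\<lambda>z. \<alpha> i + e * z)" by (rule lipschitz_on_continuous_on)
  qed
  then have "compactin (product_topology (\<lambda>_. euclidean) UNIV) (PiE UNIV (\<lambda>i. (\<lambda>z. \<alpha> i + e * z) ` Zp))"
    by (simp add: compactin_PiE)
  ultimately show ?thesis by (simp add: euclidean_product_topology)
qed

lemma cell_in_compact_opens: "cell r n a \<in> compact_opens (O_dagger p r)"
  using cell_subset_O_dagger open_in_cell compact_lattice_coset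
  by (auto simp: compact_opens_def cell_def)

text \<open>A pointwise way to say that U is a union of cells of level n.\<close>

definition resolves :: "nat \<Rightarrow> nat \<Rightarrow> ('k::finite \<Rightarrow> 'c) set \<Rightarrow> bool" where
  "resolves r n U \<longleftrightarrow> U \<subseteq> O_dagger p r \<and> (\<forall>\<gamma>\<in>U. cell r n (digits r n \<gamma>) \<subseteq> U)"

lemma cell_digits_mono:
  "\<gamma> \<in> O_dagger p r \<Longrightarrow> n \<le> m \<Longrightarrow> cell r m (digits r m \<gamma>) \<subseteq> cell r n (digits r n \<gamma>)"
  by (simp add: cell_subset_iff digits_mod)

lemma resolves_mono: "resolves r n U \<Longrightarrow> n \<le> m \<Longrightarrow> resolves r m U"
  unfolding resolves_def by (meson cell_digits_mono subset_iff)

text \<open>The product topology puts a cell inside U around each point of U, and by compactness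
  finitely many of these cover U. The largest of their levels works for all points, since every
  point of a cell is a centre of it.\<close>

lemma ex_resolves:
  fixes U :: "('k::finite \<Rightarrow> 'c) set"
  assumes U: "U \<in> compact_opens (O_dagger p r)" shows "\<exists>n. resolves r n U"
proof -
  let ?B = "\<lambda>n \<gamma>. {\<delta>. \<forall>i. cp_abs (of_nat p ^ r * (\<delta> i - \<gamma> i)) \<le> eps n}"
  have sub: "U \<subseteq> O_dagger p r" and cpt: "compact U" and op: "openin (top_of_set (O_dagger p r)) U"
    using U by (auto simp: compact_opens_def)
  obtain W where W: "open W" "U = O_dagger p r \<inter> W" using op by (auto simp: openin_open)
  have "\<exists>n. cell r n (digits r n \<gamma>) \<subseteq> U" if \<gamma>: "\<gamma> \<in> U" for \<gamma>
  proof -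
    have "openin (product_topology (\<lambda>_. euclidean) UNIV) W" "\<gamma> \<in> W"
      using W \<gamma> by (auto simp: euclidean_product_topology)
    then obtain V where V: "\<gamma> \<in> PiE UNIV V" "\<And>i. open (V i)" "PiE UNIV V \<subseteq> W"
      using product_topology_open_contains_basis[of "\<lambda>_. euclidean" UNIV W \<gamma>] by auto
    have "\<exists>n. \<forall>z. cp_abs (of_nat p ^ r * (z - \<gamma> i)) \<le> eps n \<longrightarrow> z \<in> V i" for i
    proof -
      obtain e where e: "e > 0" "\<And>z. dist z (\<gamma> i) < e \<Longrightarrow> z \<in> V i"
        using V(1,2) unfolding open_dist by (metis PiE_mem UNIV_I)
      obtain n where n: "eps n < eps r * e" using ex_eps_less[of "eps r * e"] eps_pos(1) e(1) by auto
      have "z \<in> V i" if "cp_abs (of_nat p ^ r * (z - \<gamma> i)) \<le> eps n" for z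
      proof (rule e(2))
        have "eps r * cp_abs (z - \<gamma> i) < eps r * e"
          using that n by (simp add: cp_abs_mult cp_abs_p_power)
        then show "dist z (\<gamma> i) < e" using eps_pos(1)[of r] by (simp add: dist_cp)
      qed
      then show ?thesis by blast
    qed
    then obtain n where n: "\<And>i z. cp_abs (of_nat p ^ r * (z - \<gamma> i)) \<le> eps (n i) \<Longrightarrow> z \<in> V i" by metis
    define m where "m = Max (range n)"
    have m: "n i \<le> m" for i by (simp add: m_def)
    have "cell r m (digits r m \<gamma>) \<subseteq> U"
    proof
      fix \<delta> assume "\<delta> \<in> cell r m (digits r m \<gamma>)"
      then have \<delta>: "\<delta> \<in> O_dagger p r" "\<forall>i. cp_abs (of_nat p ^ r * (\<delta> i - \<gamma> i)) \<le> eps m"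
        using mem_cell_digits[of \<gamma> r \<delta> m] \<gamma> sub by blast+
      then have "\<delta> i \<in> V i" for i using n eps_mono[OF m] order_trans by blast
      then have "\<delta> \<in> PiE UNIV V" by auto
      then show "\<delta> \<in> U" using V(3) W(2) \<delta>(1) by blast
    qed
    then show ?thesis by blast
  qed
  then obtain n where n: "\<And>\<gamma>. \<gamma> \<in> U \<Longrightarrow> cell r (n \<gamma>) (digits r (n \<gamma>) \<gamma>) \<subseteq> U" by metis
  have cover: "U \<subseteq> (\<Union>\<gamma>\<in>U. ?B (n \<gamma>) \<gamma>)" using eps_pos(2) by auto
  obtain C where C: "C \<subseteq> U" "finite C" "U \<subseteq> (\<Union>\<gamma>\<in>C. ?B (n \<gamma>) \<gamma>)"
    by (rule compactE_image[OF cpt open_digit_class cover])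
  define m where "m = Max (insert 0 (n ` C))"
  have "cell r m (digits r m \<delta>) \<subseteq> U" if \<delta>: "\<delta> \<in> U" for \<delta>
  proof -
    obtain \<gamma> where \<gamma>: "\<gamma> \<in> C" "\<delta> \<in> ?B (n \<gamma>) \<gamma>" using C(3) \<delta> by blast
    have "n \<gamma> \<le> m" using \<gamma>(1) C(2) by (simp add: m_def)
    have "\<delta> \<in> cell r (n \<gamma>) (digits r (n \<gamma>) \<gamma>)"
      using mem_cell_digits[of \<gamma> r \<delta>] \<gamma> C(1) sub \<delta> by auto
    then have "cell r (n \<gamma>) (digits r (n \<gamma>) \<delta>) = cell r (n \<gamma>) (digits r (n \<gamma>) \<gamma>)"
      using cong_sym by (intro cell_cong) (auto simp: cell_iff)
    moreover have "cell r m (digits r m \<delta>) \<subseteq> cell r (n \<gamma>) (digits r (n \<gamma>) \<delta>)"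
      using cell_digits_mono \<open>n \<gamma> \<le> m\<close> \<delta> sub by blast
    ultimately show ?thesis using n[of \<gamma>] \<gamma>(1) C(1) by blast
  qed
  then show ?thesis using sub unfolding resolves_def by blast
qed

lemma resolves_cell: "n \<le> m \<Longrightarrow> resolves r m (cell r n a)"
proof -
  have "cell r n (digits r n \<gamma>) \<subseteq> cell r n a" if "\<gamma> \<in> cell r n a" for \<gamma>
    using that cong_sym by (auto simp: cell_subset_iff cell_iff)
  then have "resolves r n (cell r n a)"
    using cell_subset_O_dagger unfolding resolves_def by blast
  then show "n \<le> m \<Longrightarrow> resolves r m (cell r n a)" by (rule resolves_mono)
qed

end

context p_adic
begin

subsection \<open>Measures are determined by the cells\<close>

definition level_cells :: "nat \<Rightarrow> nat \<Rightarrow> ('k::finite \<Rightarrow> 'c) set \<Rightarrow> ('k \<Rightarrow> nat) set" where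
  "level_cells r n U = {a. (\<forall>i. a i < p ^ n) \<and> cell r n a \<subseteq> U}"

lemma finite_level_cells [simp]: "finite (level_cells r n U)"
  by (rule finite_subset[OF _ finite_box[of "p ^ n"]]) (auto simp: level_cells_def)

lemma cell_inter_empty:
  assumes "\<forall>i. a i < p ^ n" "\<forall>i. b i < p ^ n" "a \<noteq> b" shows "cell r n a \<inter> cell r n b = {}"
  using assms by (auto simp: cell_iff_box)

lemma union_level_cells:
  assumes "resolves r n U" shows "(\<Union>a\<in>level_cells r n U. cell r n a) = U"
proof
  show "U \<subseteq> (\<Union>a\<in>level_cells r n U. cell r n a)"
  proof
    fix \<gamma> assume "\<gamma> \<in> U"
    then have "\<gamma> \<in> O_dagger p r" "cell r n (digits r n \<gamma>) \<subseteq> U" using assms by (auto simp: resolves_def)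
    then have "digits r n \<gamma> \<in> level_cells r n U" "\<gamma> \<in> cell r n (digits r n \<gamma>)"
      by (auto simp: level_cells_def digits_less cell_iff)
    then show "\<gamma> \<in> (\<Union>a\<in>level_cells r n U. cell r n a)" by blast
  qed
qed (auto simp: level_cells_def)

lemma level_cells_cell:
  assumes "n \<le> m"
  shows "level_cells r m (cell r n a) = {b. (\<forall>i. b i < p ^ m) \<and> (\<forall>i. [b i = a i] (mod p ^ n))}"
  unfolding level_cells_def cell_subset_iff[OF assms] ..

lemma level_cells_cell_same:
  assumes "\<forall>i. a i < p ^ n" shows "level_cells r n (cell r n a) = {a}"
  using assms by (auto simp: level_cells_cell cong_def fun_eq_iff)

lemma compact_opens_Un:
  "U \<in> compact_opens A \<Longrightarrow> W \<in> compact_opens A \<Longrightarrow> U \<union> W \<in> compact_opens A"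
  by (auto simp: compact_opens_def intro: compact_Un openin_Un)

lemma measure_sum_cells:
  fixes mu :: "('k::finite \<Rightarrow> 'c) set \<Rightarrow> 'c"
  assumes mu: "is_measure R (O_dagger p r) mu" and res: "resolves r n U"
  shows "mu U = (\<Sum>a\<in>level_cells r n U. mu (cell r n a))"
proof -
  have add: "mu (U \<union> W) = mu U + mu W"
    if "U \<in> compact_opens (O_dagger p r)" "W \<in> compact_opens (O_dagger p r)" "U \<inter> W = {}" for U W
    using mu that by (auto simp: is_measure_def)
  have empty: "{} \<in> compact_opens (O_dagger p r :: ('k \<Rightarrow> 'c) set)" by (simp add: compact_opens_def)
  have "(\<Union>a\<in>A. cell r n a) \<in> compact_opens (O_dagger p r) \<and> mu (\<Union>a\<in>A. cell r n a) = (\<Sum>a\<in>A. mu (cell r n a))"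
    if "finite A" "A \<subseteq> {a. \<forall>i. a i < p ^ n}" for A
    using that
  proof induction
    case empty
    \<comment> \<open>The empty set is disjoint from itself, so mu {} = mu {} + mu {}.\<close>
    show ?case using add[of "{}" "{}"] \<open>{} \<in> compact_opens (O_dagger p r)\<close> by auto
  next
    case (insert a A)
    have "cell r n a \<inter> (\<Union>a\<in>A. cell r n a) = {}" using insert cell_inter_empty[of a n _ r] by blast
    moreover have IH: "(\<Union>a\<in>A. cell r n a) \<in> compact_opens (O_dagger p r)"
      "mu (\<Union>a\<in>A. cell r n a) = (\<Sum>a\<in>A. mu (cell r n a))" using insert by simp_all
    ultimately have "mu (cell r n a \<union> (\<Union>a\<in>A. cell r n a)) = mu (cell r n a) + (\<Sum>a\<in>A. mu (cell r n a))"
      using add[OF cell_in_compact_opens IH(1)] by simp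
    then show ?case
      using insert compact_opens_Un[OF cell_in_compact_opens[of r n a] IH(1)] by simp
  qed
  from this[of "level_cells r n U"] show ?thesis
    using union_level_cells[OF res] by (auto simp: level_cells_def)
qed

text \<open>The distribution relation, under which weights on cells extend to a finitely additive
  function.\<close>

definition consistent :: "(nat \<Rightarrow> ('k::finite \<Rightarrow> nat) \<Rightarrow> 'c) \<Rightarrow> bool" where
  "consistent w \<longleftrightarrow> (\<forall>n a. (\<forall>i. a i < p ^ n) \<longrightarrow>
     w n a = (\<Sum>b | (\<forall>i. b i < p ^ Suc n) \<and> (\<forall>i. [b i = a i] (mod p ^ n)). w (Suc n) b))"

text \<open>The least resolving level is merely a definite choice: by \<open>cell_measure_eq\<close>
  every resolving level gives the same value.\<close>

definition cell_measure :: "nat \<Rightarrow> (nat \<Rightarrow> ('k::finite \<Rightarrow> nat) \<Rightarrow> 'c) \<Rightarrow> ('k \<Rightarrow> 'c) set \<Rightarrow> 'c" where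
  "cell_measure r w = restrict (\<lambda>U. \<Sum>a\<in>level_cells r (LEAST n. resolves r n U) U. w (LEAST n. resolves r n U) a)
     (compact_opens (O_dagger p r))"

text \<open>Cells of level n + 1 are grouped by their labels modulo p^n. As U is resolved at level
  n, it contains a cell of level n as soon as it contains one of its subcells.\<close>

lemma sum_level_cells_Suc:
  assumes w: "consistent w" and U: "resolves r n U"
  shows "(\<Sum>b\<in>level_cells r (Suc n) U. w (Suc n) b) = (\<Sum>a\<in>level_cells r n U. w n a)"
proof -
  let ?g = "\<lambda>b i. b i mod p ^ n"
  have sub: "cell r n (?g b) \<subseteq> U \<longleftrightarrow> cell r (Suc n) b \<subseteq> U" for b
  proof
    have "cell r (Suc n) b \<subseteq> cell r n (?g b)" by (simp add: cell_subset_iff cong_def)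
    then show "cell r n (?g b) \<subseteq> U \<Longrightarrow> cell r (Suc n) b \<subseteq> U" by blast
    assume *: "cell r (Suc n) b \<subseteq> U"
    obtain \<gamma> where \<gamma>: "\<gamma> \<in> cell r (Suc n) b" using ex_cell_point by blast
    then have "\<gamma> \<in> cell r n (?g b)" using \<open>cell r (Suc n) b \<subseteq> cell r n (?g b)\<close> by blast
    then have "cell r n (?g b) = cell r n (digits r n \<gamma>)" by (intro cell_cong) (simp add: cell_iff)
    then show "cell r n (?g b) \<subseteq> U" using U * \<gamma> unfolding resolves_def by blast
  qed
  have "(\<Sum>b\<in>level_cells r (Suc n) U. w (Suc n) b)
    = (\<Sum>a\<in>level_cells r n U. \<Sum>b | b \<in> level_cells r (Suc n) U \<and> ?g b = a. w (Suc n) b)"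
  proof (rule sum.group[symmetric])
    show "?g ` level_cells r (Suc n) U \<subseteq> level_cells r n U"
      using sub p_gt_1 by (auto simp: level_cells_def)
  qed simp_all
  also have "\<dots> = (\<Sum>a\<in>level_cells r n U. w n a)"
  proof (rule sum.cong[OF refl])
    fix a assume a: "a \<in> level_cells r n U"
    then have "?g b = a \<longleftrightarrow> (\<forall>i. [b i = a i] (mod p ^ n))" for b
      by (auto simp: level_cells_def cong_def fun_eq_iff)
    moreover have "b \<in> level_cells r (Suc n) U \<and> ?g b = a \<longleftrightarrow> (\<forall>i. b i < p ^ Suc n) \<and> ?g b = a" for b
      using a sub[of b] by (auto simp: level_cells_def)
    ultimately have "{b. b \<in> level_cells r (Suc n) U \<and> ?g b = a}
      = {b. (\<forall>i. b i < p ^ Suc n) \<and> (\<forall>i. [b i = a i] (mod p ^ n))}" by simp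
    then show "(\<Sum>b | b \<in> level_cells r (Suc n) U \<and> ?g b = a. w (Suc n) b) = w n a"
      using w a by (simp add: consistent_def level_cells_def)
  qed
  finally show ?thesis .
qed

lemma cell_measure_eq:
  assumes w: "consistent w" and U: "U \<in> compact_opens (O_dagger p r)" and res: "resolves r n U"
  shows "cell_measure r w U = (\<Sum>a\<in>level_cells r n U. w n a)"
proof -
  define k where "k = (LEAST n. resolves r n U)"
  have k: "resolves r k U" unfolding k_def using res by (rule LeastI)
  have "k \<le> n" unfolding k_def using res by (rule Least_le)
  then have "(\<Sum>a\<in>level_cells r n U. w n a) = (\<Sum>a\<in>level_cells r k U. w k a)"
    by (induction n rule: dec_induct) (simp_all add: sum_level_cells_Suc[OF w] resolves_mono[OF k])
  then show ?thesis using U by (simp add: cell_measure_def k_def)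
qed

lemma cell_measure_cell:
  assumes "consistent w" "\<forall>i. a i < p ^ n" shows "cell_measure r w (cell r n a) = w n a"
  using cell_measure_eq[OF assms(1) cell_in_compact_opens resolves_cell[OF order_refl]]
  by (simp add: level_cells_cell_same[OF assms(2)])

lemma cell_measure_values:
  assumes w: "consistent w" and S: "0 \<in> S" "\<And>y z. y \<in> S \<Longrightarrow> z \<in> S \<Longrightarrow> y + z \<in> S"
    and val: "\<And>n a. (\<forall>i. a i < p ^ n) \<Longrightarrow> w n a \<in> S" and U: "U \<in> compact_opens (O_dagger p r)"
  shows "cell_measure r w U \<in> S"
proof -
  obtain n where n: "resolves r n U" using ex_resolves[OF U] by blast
  show ?thesis
    unfolding cell_measure_eq[OF w U n] by (rule sum_in_closed[OF S]) (simp_all add: val level_cells_def)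
qed

text \<open>At a level that resolves both sets, a cell inside the union lies inside one of them, so
  the cells of the union split into two disjoint families.\<close>

lemma is_measure_cell_measure:
  fixes w :: "nat \<Rightarrow> ('k::finite \<Rightarrow> nat) \<Rightarrow> 'c"
  assumes w: "consistent w" and R: "0 \<in> R" "\<And>y z. y \<in> R \<Longrightarrow> z \<in> R \<Longrightarrow> y + z \<in> R"
    and val: "\<And>n a. (\<forall>i. a i < p ^ n) \<Longrightarrow> w n a \<in> R"
  shows "is_measure R (O_dagger p r) (cell_measure r w)"
  unfolding is_measure_def
proof (intro conjI ballI impI)
  show "cell_measure r w \<in> extensional (compact_opens (O_dagger p r))" by (simp add: cell_measure_def)
  show "cell_measure r w U \<in> R" if "U \<in> compact_opens (O_dagger p r)" for U :: "('k \<Rightarrow> 'c) set"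
    using w R val that by (rule cell_measure_values)
  fix U W :: "('k \<Rightarrow> 'c) set" assume U: "U \<in> compact_opens (O_dagger p r)" and W: "W \<in> compact_opens (O_dagger p r)"
    and disj: "U \<inter> W = {}"
  obtain n1 n2 where "resolves r n1 U" "resolves r n2 W" using ex_resolves[OF U] ex_resolves[OF W] by blast
  then obtain n where n: "resolves r n U" "resolves r n W"
    using resolves_mono[of r n1 U "max n1 n2"] resolves_mono[of r n2 W "max n1 n2"] by auto
  then have UW: "resolves r n (U \<union> W)" by (auto simp: resolves_def)
  have "cell r n a \<subseteq> U \<or> cell r n a \<subseteq> W" if "cell r n a \<subseteq> U \<union> W" for a
  proof -
    obtain \<gamma> where \<gamma>: "\<gamma> \<in> cell r n a" using ex_cell_point by blast
    then have "cell r n a = cell r n (digits r n \<gamma>)" by (intro cell_cong) (simp add: cell_iff)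
    then show ?thesis using n \<gamma> that unfolding resolves_def by blast
  qed
  then have "level_cells r n (U \<union> W) = level_cells r n U \<union> level_cells r n W"
    by (auto simp: level_cells_def)
  moreover have "level_cells r n U \<inter> level_cells r n W = {}"
    using disj ex_cell_point by (fastforce simp: level_cells_def)
  ultimately show "cell_measure r w (U \<union> W) = cell_measure r w U + cell_measure r w W"
    using cell_measure_eq[OF w U n(1)] cell_measure_eq[OF w W n(2)]
      cell_measure_eq[OF w compact_opens_Un[OF U W] UW] by (simp add: sum.union_disjoint)
qed

lemma measure_eqI:
  fixes mu mu' :: "('k::finite \<Rightarrow> 'c) set \<Rightarrow> 'c"
  assumes mu: "is_measure R (O_dagger p r) mu" "is_measure R' (O_dagger p r) mu'"
    and eq: "\<And>n a. (\<forall>i. a i < p ^ n) \<Longrightarrow> mu (cell r n a) = mu' (cell r n a)"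
  shows "mu = mu'"
proof (rule extensionalityI)
  show "mu \<in> extensional (compact_opens (O_dagger p r))" "mu' \<in> extensional (compact_opens (O_dagger p r))"
    using mu by (auto simp: is_measure_def)
  fix U :: "('k \<Rightarrow> 'c) set" assume "U \<in> compact_opens (O_dagger p r)"
  then obtain n where n: "resolves r n U" using ex_resolves by blast
  have "(\<Sum>a\<in>level_cells r n U. mu (cell r n a)) = (\<Sum>a\<in>level_cells r n U. mu' (cell r n a))"
    by (rule sum.cong) (auto simp: level_cells_def eq)
  then show "mu U = mu' U"
    using measure_sum_cells[OF mu(1) n] measure_sum_cells[OF mu(2) n] by simp
qed

subsection \<open>The Amice transform\<close>

text \<open>The Riemann sum for coefficient m of the Amice transform: the scaled coordinates of the
  sample points are the integers a i.\<close>

definition riemann :: "nat \<Rightarrow> (('k::finite \<Rightarrow> 'c) set \<Rightarrow> 'c) \<Rightarrow> ('k \<Rightarrow> nat) \<Rightarrow> nat \<Rightarrow> 'c" where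
  "riemann r mu m n = (\<Sum>a | \<forall>i. a i < p ^ n. (\<Prod>i\<in>UNIV. of_nat (a i) gchoose (m i)) * mu (cell r n a))"

lemma mcoeff_amice: "mcoeff (amice p r mu) m = lim (riemann r mu m)"
proof -
  have "measure_integral p r mu (\<lambda>\<alpha>. mcoeff (tpow p r \<alpha>) m) = lim (\<lambda>n. riemann r mu m n)"
    unfolding measure_integral_def riemann_def Let_def cell_def[symmetric]
    using p_gt_1 by (simp add: tpow_def)
  then show ?thesis by (simp add: amice_def)
qed

lemma sum_cells_refine:
  fixes mu :: "('k::finite \<Rightarrow> 'c) set \<Rightarrow> 'c"
  assumes mu: "is_measure R (O_dagger p r) mu" and nm: "n \<le> m"
  shows "(\<Sum>a | \<forall>i. a i < p ^ n. f a * mu (cell r n a))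
    = (\<Sum>b | \<forall>i. b i < p ^ m. f (\<lambda>i. b i mod p ^ n) * mu (cell r m b))"
proof -
  let ?A = "{a :: 'k \<Rightarrow> nat. \<forall>i. a i < p ^ n}" and ?B = "{b :: 'k \<Rightarrow> nat. \<forall>i. b i < p ^ m}"
  let ?g = "\<lambda>b i. b i mod p ^ n"
  have "(\<Sum>b\<in>?B. f (?g b) * mu (cell r m b)) = (\<Sum>a\<in>?A. \<Sum>b | b \<in> ?B \<and> ?g b = a. f (?g b) * mu (cell r m b))"
    using p_gt_1 by (intro sum.group[symmetric]) auto
  also have "\<dots> = (\<Sum>a\<in>?A. f a * mu (cell r n a))"
  proof (rule sum.cong[OF refl])
    fix a assume a: "a \<in> ?A"
    then have "{b. b \<in> ?B \<and> ?g b = a} = level_cells r m (cell r n a)"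
      by (auto simp: level_cells_cell[OF nm] cong_def fun_eq_iff)
    then have "(\<Sum>b | b \<in> ?B \<and> ?g b = a. mu (cell r m b)) = mu (cell r n a)"
      using measure_sum_cells[OF mu resolves_cell[OF nm], of a] by simp
    moreover have "(\<Sum>b | b \<in> ?B \<and> ?g b = a. f (?g b) * mu (cell r m b))
      = (\<Sum>b | b \<in> ?B \<and> ?g b = a. f a * mu (cell r m b))"
      by (rule sum.cong) auto
    ultimately show "(\<Sum>b | b \<in> ?B \<and> ?g b = a. f (?g b) * mu (cell r m b)) = f a * mu (cell r n a)"
      by (simp flip: sum_distrib_left)
  qed
  finally show ?thesis by simp
qed

lemma cp_abs_measure:
  fixes mu :: "('k::finite \<Rightarrow> 'c) set \<Rightarrow> 'c"
  assumes "is_measure R (O_dagger p r) mu" "\<And>z. z \<in> R \<Longrightarrow> cp_abs z \<le> 1"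
  shows "cp_abs (mu (cell r n a)) \<le> 1"
  using assms cell_in_compact_opens unfolding is_measure_def by blast

lemma cp_abs_binomial_prod: "cp_abs (\<Prod>i\<in>(UNIV :: 'k::finite set). of_nat (a i) gchoose (m i) :: 'c) \<le> 1"
  by (intro cp_abs_prod_le_1 cp_abs_gbinomial Zp_of_nat)

text \<open>Rewritten at level n + 1, the sum of level n differs from the next one only in
  evaluating the binomials at b mod p^n instead of b.\<close>

lemma convergent_riemann:
  fixes mu :: "('k::finite \<Rightarrow> 'c) set \<Rightarrow> 'c"
  assumes mu: "is_measure R (O_dagger p r) mu" and R: "\<And>z. z \<in> R \<Longrightarrow> cp_abs z \<le> 1"
  shows "convergent (riemann r mu m)"
proof (rule convergent_cpI)
  define C where "C = (\<Sum>i\<in>UNIV. fact_bound (m i))"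
  have C: "fact_bound (m i) \<le> C" for i
    unfolding C_def using fact_bound(2) by (intro member_le_sum) auto
  then show "C \<ge> 0" using fact_bound(2) order_trans by blast
  fix n
  let ?t = "\<lambda>b. (\<Prod>i\<in>UNIV. of_nat (b i) gchoose (m i)) :: 'c"
  have "riemann r mu m (Suc n) - riemann r mu m n
    = (\<Sum>b | \<forall>i. b i < p ^ Suc n. (?t b - ?t (\<lambda>i. b i mod p ^ n)) * mu (cell r (Suc n) b))"
    unfolding riemann_def sum_cells_refine[OF mu le_SucI[OF order_refl], where n = n and f = "?t"]
    by (simp add: sum_subtractf left_diff_distrib)
  also have "cp_abs \<dots> \<le> C * eps n"
  proof (intro cp_abs_sum_le cp_abs_mult_le cp_abs_measure[OF mu R] cp_abs_prod_diff cp_abs_gbinomial Zp_of_nat)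
    show "C * eps n \<ge> 0" using \<open>C \<ge> 0\<close> eps_pos(2) by simp
    then show "C * eps n \<ge> 0" .
    fix b :: "'k \<Rightarrow> nat" and i
    have "cp_abs ((of_nat (b i) gchoose m i) - (of_nat (b i mod p ^ n) gchoose m i) :: 'c) \<le> fact_bound (m i) * eps n"
      by (intro gbinomial_cong_bound cp_abs_of_nat) (simp_all add: cp_abs_of_nat_diff_le_iff cong_def)
    also have "\<dots> \<le> C * eps n" using C eps_pos(2) by (intro mult_right_mono)
    finally show "cp_abs ((of_nat (b i) gchoose m i) - (of_nat (b i mod p ^ n) gchoose m i) :: 'c) \<le> C * eps n" .
  qed
  finally show "cp_abs (riemann r mu m (Suc n) - riemann r mu m n) \<le> C * eps n" .
qed

lemma tendsto_riemann:
  assumes "is_measure R (O_dagger p r) mu" "\<And>z. z \<in> R \<Longrightarrow> cp_abs z \<le> 1"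
  shows "riemann r mu m \<longlonglongrightarrow> mcoeff (amice p r mu) m"
  unfolding mcoeff_amice using convergent_riemann[OF assms] by (simp add: convergent_LIMSEQ_iff)

text \<open>Products of truncated Mahler expansions, one per coordinate, approximate the indicator
  of the cell within p^(-M). The order of the quantifiers is the point: L and c serve all measures
  and all levels n' at once, so two measures can be compared through their Riemann sums.\<close>

lemma measure_cell_approx:
  fixes a :: "'k::finite \<Rightarrow> nat"
  assumes a: "\<forall>i. a i < p ^ n"
  shows "\<exists>L c. \<forall>(mu :: ('k \<Rightarrow> 'c) set \<Rightarrow> 'c) R n'. is_measure R (O_dagger p r) mu \<longrightarrow> (\<forall>z\<in>R. cp_abs z \<le> 1) \<longrightarrow> n \<le> n' \<longrightarrow>
    cp_abs (mu (cell r n a) - (\<Sum>m | \<forall>i. m i < L. c m * riemann r mu m n')) \<le> eps M"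
proof -
  define f where "f i b = (of_bool (b mod p ^ n = a i) :: int)" for i b
  define L where "L = M * p ^ n"
  define e where "e i m = (fdiff ^^ m) (f i) 0" for i m
  define g :: "'k \<Rightarrow> nat \<Rightarrow> 'c" where "g i b = (\<Sum>m<L. of_int (e i m) * (of_nat b gchoose m))" for i b
  have "int p ^ M dvd f i b - (\<Sum>m<L. e i m * int (b choose m))" for i b
    unfolding e_def L_def by (rule mahler_approx[OF prime_p]) (simp add: f_def)
  then have "cp_abs (of_int (f i b - (\<Sum>m<L. e i m * int (b choose m))) :: 'c) \<le> eps M" for i b
    by (simp only: cp_abs_of_int_le_iff)
  moreover have "of_int (f i b - (\<Sum>m<L. e i m * int (b choose m))) = of_int (f i b) - g i b" for i b
    by (simp add: g_def binomial_gbinomial)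
  ultimately have approx: "cp_abs (of_int (f i b) - g i b) \<le> eps M" for i b by metis
  have g_le: "cp_abs (g i b) \<le> 1" for i b
    unfolding g_def by (intro cp_abs_sum_le cp_abs_mult_le cp_abs_of_int cp_abs_gbinomial Zp_of_nat) simp
  define c where "c m = (\<Prod>i\<in>UNIV. of_int (e i (m i)) :: 'c)" for m
  show ?thesis
  proof (intro exI[of _ L] exI[of _ c] allI impI)
    fix mu :: "('k \<Rightarrow> 'c) set \<Rightarrow> 'c" and R n'
    assume mu: "is_measure R (O_dagger p r) mu" and R': "\<forall>z\<in>R. cp_abs z \<le> 1" and n': "n \<le> n'"
    have R: "\<And>z. z \<in> R \<Longrightarrow> cp_abs z \<le> 1" using R' by blast
    let ?B = "{b :: 'k \<Rightarrow> nat. \<forall>i. b i < p ^ n'}"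
    have "mu (cell r n a) = (\<Sum>b\<in>?B. (\<Prod>i\<in>UNIV. of_int (f i (b i))) * mu (cell r n' b))"
    proof -
      have "mu (cell r n a) = (\<Sum>a' | \<forall>i. a' i < p ^ n. of_bool (a' = a) * mu (cell r n a'))"
      proof -
        have "(\<Sum>a' | \<forall>i. a' i < p ^ n. of_bool (a' = a) * mu (cell r n a'))
          = (\<Sum>a' | \<forall>i. a' i < p ^ n. if a' = a then mu (cell r n a) else 0)"
          by (rule sum.cong) auto
        then show ?thesis using a by simp
      qed
      also have "\<dots> = (\<Sum>b\<in>?B. of_bool ((\<lambda>i. b i mod p ^ n) = a) * mu (cell r n' b))"
        by (rule sum_cells_refine[OF mu n'])
      also have "\<dots> = (\<Sum>b\<in>?B. (\<Prod>i\<in>UNIV. of_int (f i (b i))) * mu (cell r n' b))"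
      proof (rule sum.cong[OF refl])
        fix b
        have "(\<Prod>i\<in>UNIV. of_int (f i (b i)) :: 'c) = of_bool ((\<lambda>i. b i mod p ^ n) = a)"
        proof (cases "(\<lambda>i. b i mod p ^ n) = a")
          case True
          then have "b i mod p ^ n = a i" for i by (rule fun_cong)
          then show ?thesis using True by (simp add: f_def)
        next
          case False
          then obtain i where "b i mod p ^ n \<noteq> a i" by auto
          then have "(\<Prod>i\<in>UNIV. of_int (f i (b i)) :: 'c) = 0"
            by (intro prod_zero bexI[of _ i]) (auto simp: f_def)
          then show ?thesis using False by simp
        qed
        then show "of_bool ((\<lambda>i. b i mod p ^ n) = a) * mu (cell r n' b)
          = (\<Prod>i\<in>UNIV. of_int (f i (b i))) * mu (cell r n' b)" by simp
      qed
      finally show ?thesis .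
    qed
    moreover have "(\<Sum>m | \<forall>i. m i < L. c m * riemann r mu m n')
      = (\<Sum>b\<in>?B. (\<Prod>i\<in>UNIV. g i (b i)) * mu (cell r n' b))"
    proof -
      have "(\<Prod>i\<in>UNIV. g i (b i)) = (\<Sum>m | \<forall>i. m i < L. c m * (\<Prod>i\<in>UNIV. of_nat (b i) gchoose (m i)))" for b
        unfolding g_def c_def prod_sum_box prod.distrib ..
      then show ?thesis
        unfolding riemann_def
        by (simp add: sum_distrib_left sum_distrib_right mult.assoc) (rule sum.swap)
    qed
    ultimately have "mu (cell r n a) - (\<Sum>m | \<forall>i. m i < L. c m * riemann r mu m n')
      = (\<Sum>b\<in>?B. ((\<Prod>i\<in>UNIV. of_int (f i (b i))) - (\<Prod>i\<in>UNIV. g i (b i))) * mu (cell r n' b))"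
      by (simp add: sum_subtractf left_diff_distrib)
    also have "cp_abs \<dots> \<le> eps M"
      by (intro cp_abs_sum_le cp_abs_mult_le cp_abs_measure[OF mu R] cp_abs_prod_diff cp_abs_of_int g_le approx eps_pos(2))
    finally show "cp_abs (mu (cell r n a) - (\<Sum>m | \<forall>i. m i < L. c m * riemann r mu m n')) \<le> eps M" .
  qed
qed

text \<open>For each M, both values on a cell lie within p^(-M) of the same finite combination of
  the respective Riemann sums at a high common level, and these sums have equal limits.\<close>

lemma amice_inject:
  fixes mu mu' :: "('k::finite \<Rightarrow> 'c) set \<Rightarrow> 'c"
  assumes mu: "is_measure R (O_dagger p r) mu" "is_measure R (O_dagger p r) mu'"
    and R: "\<And>z. z \<in> R \<Longrightarrow> cp_abs z \<le> 1" and eq: "amice p r mu = amice p r mu'"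
  shows "mu = mu'"
proof (rule measure_eqI[OF mu])
  fix n and a :: "'k \<Rightarrow> nat" assume a: "\<forall>i. a i < p ^ n"
  have "cp_abs (mu (cell r n a) - mu' (cell r n a)) \<le> eps M" for M
  proof -
    obtain L c where approx: "\<And>(mu :: ('k \<Rightarrow> 'c) set \<Rightarrow> 'c) R n'. is_measure R (O_dagger p r) mu \<Longrightarrow>
      \<forall>z\<in>R. cp_abs z \<le> 1 \<Longrightarrow> n \<le> n' \<Longrightarrow>
      cp_abs (mu (cell r n a) - (\<Sum>m | \<forall>i. m i < L. c m * riemann r mu m n')) \<le> eps M"
      using measure_cell_approx[OF a, of r M] by blast
    have "\<forall>z\<in>R. cp_abs z \<le> 1" using R by blast
    note Lc = approx[OF mu(1) this] approx[OF mu(2) this]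
    let ?s = "\<lambda>mu n'. \<Sum>m | \<forall>i. m i < L. c m * riemann r mu m n'"
    have lim: "(\<lambda>n'. ?s mu n') \<longlonglongrightarrow> (\<Sum>m | \<forall>i. m i < L. c m * mcoeff (amice p r mu) m)"
      "(\<lambda>n'. ?s mu' n') \<longlonglongrightarrow> (\<Sum>m | \<forall>i. m i < L. c m * mcoeff (amice p r mu) m)"
      using tendsto_riemann[OF mu(1) R] tendsto_riemann[OF mu(2) R]
      by (auto simp: eq intro!: tendsto_cp_sum tendsto_cp_mult)
    have "(\<lambda>n'. dist (?s mu n') (?s mu' n')) \<longlonglongrightarrow> 0"
      using tendsto_dist[OF lim] by simp
    then have "\<forall>\<^sub>F n' in sequentially. dist (?s mu n') (?s mu' n') < eps M"
      using eps_pos(1) by (rule order_tendstoD(2))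
    then obtain n0 where "\<And>n'. n' \<ge> n0 \<Longrightarrow> dist (?s mu n') (?s mu' n') < eps M"
      unfolding eventually_sequentially by blast
    then have s: "cp_abs (?s mu (max n n0) - ?s mu' (max n n0)) \<le> eps M"
      by (simp add: dist_cp less_imp_le)
    have "cp_abs (mu (cell r n a) - ?s mu' (max n n0)) \<le> eps M"
      by (rule cp_abs_triangle_le[OF Lc(1) s]) simp
    moreover have "cp_abs (?s mu' (max n n0) - mu' (cell r n a)) \<le> eps M"
      unfolding cp_abs_commute[of "?s mu' (max n n0)"] by (rule Lc(2)) simp
    ultimately show ?thesis by (rule cp_abs_triangle_le)
  qed
  then have "cp_abs (mu (cell r n a) - mu' (cell r n a)) \<le> 0"
    by (intro LIMSEQ_le_const[OF eps_tendsto_0]) auto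
  then show "mu (cell r n a) = mu' (cell r n a)"
    using cp_abs_nonneg[of "mu (cell r n a) - mu' (cell r n a)"] by (simp add: order_antisym_conv)
qed

end

lemma prod_sum_family:
  fixes f :: "'k::finite \<Rightarrow> nat \<Rightarrow> 'a::comm_semiring_1"
  assumes "\<And>i. finite (B i)"
  shows "(\<Prod>i\<in>UNIV. \<Sum>j\<in>B i. f i j) = (\<Sum>d | \<forall>i. d i \<in> B i. \<Prod>i\<in>UNIV. f i (d i))"
proof -
  have "{d :: 'k \<Rightarrow> nat. \<forall>i. d i \<in> B i} = PiE UNIV B" by (auto simp: PiE_def Pi_def)
  then show ?thesis using assms by (simp add: prod_sum_PiE)
qed

subsection \<open>The measure attached to a periodic function with vanishing sums\<close>

locale periodic_zero_sum =
  fixes N :: nat and g :: "('k::finite \<Rightarrow> nat) \<Rightarrow> 'a::field_char_0"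
  assumes N_pos: "N > 0"
    and periodic: "\<And>d d'. (\<And>i. [d i = d' i] (mod N)) \<Longrightarrow> g d = g d'"
    and zero_sum: "\<And>d i. (\<Sum>j<N. g (d(i := j))) = 0"
begin

text \<open>The terms for the class of 0 are constant in c, so \<open>zero_sum_prod_shift\<close>
  removes them; what remains is a Kronecker delta at c = d mod N.\<close>

lemma decomposition: "g d = (\<Sum>c | \<forall>i. c i < N. g c * (\<Prod>i\<in>UNIV. res_ind N (c i) (d i)))"
proof -
  have "(\<Sum>c | \<forall>i. c i < N. g c * (\<Prod>i\<in>UNIV. res_ind N (c i) (d i)))
    = (\<Sum>c | \<forall>i. c i < N. g c * (\<Prod>i\<in>UNIV. of_bool (d i mod N = c i mod N) + - of_bool (d i mod N = 0)))"
    by (simp add: res_ind_def)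
  also have "\<dots> = (\<Sum>c | \<forall>i. c i < N. g c * (\<Prod>i\<in>UNIV. of_bool (d i mod N = c i mod N)))"
    by (rule zero_sum_prod_shift[OF zero_sum N_pos])
  also have "\<dots> = (\<Sum>c | \<forall>i. c i < N. if c = (\<lambda>i. d i mod N) then g (\<lambda>i. d i mod N) else 0)"
  proof (rule sum.cong[OF refl])
    fix c :: "'k \<Rightarrow> nat" assume c: "c \<in> {c. \<forall>i. c i < N}"
    show "g c * (\<Prod>i\<in>UNIV. of_bool (d i mod N = c i mod N)) = (if c = (\<lambda>i. d i mod N) then g (\<lambda>i. d i mod N) else 0)"
    proof (cases "c = (\<lambda>i. d i mod N)")
      case False
      then obtain i where "c i \<noteq> d i mod N" by auto
      then have "(\<Prod>i\<in>UNIV. of_bool (d i mod N = c i mod N) :: 'a) = 0"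
        using c by (intro prod_zero bexI[of _ i]) auto
      then show ?thesis using False by simp
    qed simp
  qed
  also have "\<dots> = g (\<lambda>i. d i mod N)" using N_pos by simp
  also have "\<dots> = g d" by (rule periodic) simp
  finally show ?thesis by simp
qed

text \<open>Multiplying out the one-variable sums leaves, for each d, the decomposition of g at the
  point l + P d.\<close>

lemma sum_blocks:
  "(\<Sum>c | \<forall>i. c i < N. g c * (\<Prod>i\<in>UNIV. block N (c i) P (l i)))
    = (- 1) ^ CARD('k) / of_nat N ^ CARD('k) *
      (\<Sum>d | \<forall>i. d i < N. g (\<lambda>i. l i + P * d i) * (\<Prod>i\<in>UNIV. of_nat (d i)))"
proof -
  have "(\<Prod>i\<in>UNIV. block N (c i) P (l i) :: 'a) = (- 1) ^ CARD('k) / of_nat N ^ CARD('k) *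
    (\<Sum>d | \<forall>i. d i < N. (\<Prod>i\<in>UNIV. of_nat (d i)) * (\<Prod>i\<in>UNIV. res_ind N (c i) (l i + P * d i)))" for c
  proof -
    have "(\<Prod>i\<in>UNIV. block N (c i) P (l i) :: 'a)
      = (\<Prod>i\<in>UNIV. (- 1 / of_nat N) * (\<Sum>d<N. of_nat d * res_ind N (c i) (l i + P * d)))"
      by (simp add: block_def)
    also have "\<dots> = (- 1 / of_nat N) ^ CARD('k) *
      (\<Prod>i\<in>UNIV. \<Sum>d<N. of_nat d * res_ind N (c i) (l i + P * d))"
      by (simp only: prod.distrib prod_constant)
    finally show ?thesis by (simp only: prod_sum_box prod.distrib power_divide)
  qed
  then have "(\<Sum>c | \<forall>i. c i < N. g c * (\<Prod>i\<in>UNIV. block N (c i) P (l i)))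
    = (- 1) ^ CARD('k) / of_nat N ^ CARD('k) * (\<Sum>c | \<forall>i. c i < N. \<Sum>d | \<forall>i. d i < N.
      g c * (\<Prod>i\<in>UNIV. res_ind N (c i) (l i + P * d i)) * (\<Prod>i\<in>UNIV. of_nat (d i)))"
    by (simp add: sum_distrib_left mult_ac)
  also have "(\<Sum>c | \<forall>i. c i < N. \<Sum>d | \<forall>i. d i < N.
      g c * (\<Prod>i\<in>UNIV. res_ind N (c i) (l i + P * d i)) * (\<Prod>i\<in>UNIV. of_nat (d i)))
    = (\<Sum>d | \<forall>i. d i < N. g (\<lambda>i. l i + P * d i) * (\<Prod>i\<in>UNIV. of_nat (d i)))"
    unfolding decomposition[of "\<lambda>i. l i + P * _ i"] sum_distrib_right by (rule sum.swap)
  finally show ?thesis .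
qed

text \<open>For P congruent to 1, \<open>block_shift\<close> writes each factor as -(s / N + t). S
  collects the coordinates where the expanded product takes s / N; the others take t, a sum over d <
  l i. The decomposition of g then absorbs the sum over c.\<close>

lemma sum_blocks_one:
  assumes P: "[P = 1] (mod N)"
  shows "(\<Sum>c | \<forall>i. c i < N. g c * (\<Prod>i\<in>UNIV. block N (c i) P (l i)))
    = (- 1) ^ CARD('k) * (\<Sum>S\<in>UNIV. 1 / of_nat N ^ card S *
        (\<Sum>d | (\<forall>i\<in>S. d i < N) \<and> (\<forall>j\<in>- S. d j < l j). g d * (\<Prod>i\<in>S. of_nat (d i))))"
proof -
  define s where "s i c = (\<Sum>d<N. of_nat d * res_ind N c d :: 'a)" for i :: 'k and c
  define t where "t i c = (\<Sum>d<l i. res_ind N c d :: 'a)" for i and c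
  let ?box = "{c :: 'k \<Rightarrow> nat. \<forall>i. c i < N}"
  have block: "block N c P (l i) = - (s i c / of_nat N + t i c)" if "c < N" for i c
  proof -
    have "res_ind N c (l i + P * d) = (res_ind N c (l i + d) :: 'a)" for d
      using cong_add[OF cong_refl cong_mult[OF P cong_refl], of "l i" d] by (intro res_ind_mod) simp
    then show ?thesis using block_shift[OF that, of "l i", where 'a = 'a] by (simp add: block_def s_def t_def)
  qed
  have prod: "(\<Prod>i\<in>UNIV. block N (c i) P (l i))
    = (- 1) ^ CARD('k) * (\<Sum>S\<in>UNIV. 1 / of_nat N ^ card S * ((\<Prod>i\<in>S. s i (c i)) * (\<Prod>i\<in>- S. t i (c i))))"
    if "c \<in> ?box" for c
  proof -
    have "(\<Prod>i\<in>UNIV. block N (c i) P (l i)) = (\<Prod>i\<in>UNIV. - 1 * (s i (c i) / of_nat N + t i (c i)))"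
      using that block by simp
    also have "\<dots> = (- 1) ^ CARD('k) * (\<Prod>i\<in>UNIV. s i (c i) / of_nat N + t i (c i))"
      by (simp only: prod.distrib prod_constant)
    finally show ?thesis
      by (simp add: prod_add prod_dividef Compl_eq_Diff_UNIV)
  qed
  have inner: "(\<Sum>d | (\<forall>i\<in>S. d i < N) \<and> (\<forall>j\<in>- S. d j < l j). g d * (\<Prod>i\<in>S. of_nat (d i)))
    = (\<Sum>c\<in>?box. g c * ((\<Prod>i\<in>S. s i (c i)) * (\<Prod>i\<in>- S. t i (c i))))" for S
  proof -
    let ?D = "{d :: 'k \<Rightarrow> nat. \<forall>i. d i \<in> {..<if i \<in> S then N else l i}}"
    let ?u = "\<lambda>c i d. res_ind N (c i) d * (if i \<in> S then of_nat d else 1) :: 'a"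
    have "{d. (\<forall>i\<in>S. d i < N) \<and> (\<forall>j\<in>- S. d j < l j)} = ?D" by auto
    moreover have "g d * (\<Prod>i\<in>S. of_nat (d i)) = (\<Sum>c\<in>?box. g c * (\<Prod>i\<in>UNIV. ?u c i (d i)))" for d
    proof -
      have "(\<Prod>i\<in>S. of_nat (d i)) = (\<Prod>i\<in>UNIV. if i \<in> S then of_nat (d i) else 1 :: 'a)"
        by (simp add: prod.If_cases)
      then show ?thesis
        by (subst decomposition) (simp only: sum_distrib_right prod.distrib mult.assoc)
    qed
    ultimately have "(\<Sum>d | (\<forall>i\<in>S. d i < N) \<and> (\<forall>j\<in>- S. d j < l j). g d * (\<Prod>i\<in>S. of_nat (d i)))
      = (\<Sum>d\<in>?D. \<Sum>c\<in>?box. g c * (\<Prod>i\<in>UNIV. ?u c i (d i)))" by simp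
    also have "\<dots> = (\<Sum>c\<in>?box. g c * (\<Sum>d\<in>?D. \<Prod>i\<in>UNIV. ?u c i (d i)))"
      by (subst sum.swap) (simp only: sum_distrib_left)
    also have "\<dots> = (\<Sum>c\<in>?box. g c * (\<Prod>i\<in>UNIV. \<Sum>d<if i \<in> S then N else l i. ?u c i d))"
      by (subst prod_sum_family) simp_all
    also have "\<dots> = (\<Sum>c\<in>?box. g c * ((\<Prod>i\<in>S. s i (c i)) * (\<Prod>i\<in>- S. t i (c i))))"
    proof (rule sum.cong[OF refl])
      fix c
      have "(\<Prod>i\<in>UNIV. \<Sum>d<if i \<in> S then N else l i. ?u c i d)
        = (\<Prod>i\<in>UNIV. if i \<in> S then s i (c i) else t i (c i))"
        by (rule prod.cong) (auto simp: s_def t_def mult.commute)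
      then show "g c * (\<Prod>i\<in>UNIV. \<Sum>d<if i \<in> S then N else l i. ?u c i d)
        = g c * ((\<Prod>i\<in>S. s i (c i)) * (\<Prod>i\<in>- S. t i (c i)))"
        by (simp add: prod.If_cases Compl_eq)
    qed
    finally show ?thesis .
  qed
  have "(\<Sum>c\<in>?box. g c * (\<Prod>i\<in>UNIV. block N (c i) P (l i)))
    = (\<Sum>c\<in>?box. \<Sum>S\<in>UNIV. (- 1) ^ CARD('k) * (1 / of_nat N ^ card S * (g c * ((\<Prod>i\<in>S. s i (c i)) * (\<Prod>i\<in>- S. t i (c i))))))"
    by (rule sum.cong[OF refl]) (simp add: prod sum_distrib_left mult_ac)
  also have "\<dots> = (- 1) ^ CARD('k) * (\<Sum>S\<in>UNIV. 1 / of_nat N ^ card S *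
    (\<Sum>c\<in>?box. g c * ((\<Prod>i\<in>S. s i (c i)) * (\<Prod>i\<in>- S. t i (c i)))))"
    by (subst sum.swap) (simp only: sum_distrib_left)
  finally show ?thesis unfolding inner .
qed

end

section \<open>The measure and its power series\<close>

locale zero_sum_measure = p_adic p T + periodic_zero_sum N g
  for p :: nat and T :: "'c::{field_char_0,complete_space} itself" and N :: nat
    and g :: "('k::finite \<Rightarrow> nat) \<Rightarrow> 'c" +
  fixes r :: nat and a :: "'k \<Rightarrow> 'c"
  assumes coprime_p_N: "coprime p N" and g_le: "\<And>d. cp_abs (g d) \<le> 1" and a_Zp: "\<And>i. a i \<in> Zp"
begin

text \<open>With a i taken as p^r times the i-th coordinate of x, this is p^r times the i-th
  coordinate of x + l v_i.\<close>

abbreviation pt :: "'k \<Rightarrow> nat \<Rightarrow> 'c" where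
  "pt i l \<equiv> a i + of_nat p ^ r * of_nat l"

lemma pt_Zp: "pt i l \<in> Zp"
  using Zp_add[OF a_Zp Zp_mult[OF Zp_of_nat[of "p ^ r"] Zp_of_nat]] by simp

text \<open>The image of the block measure under the affine map \<open>l \<mapsto> a + p^r l\<close>.\<close>

definition pushed :: "nat \<Rightarrow> nat \<Rightarrow> 'k \<Rightarrow> nat \<Rightarrow> 'c" where
  "pushed n c i b = (\<Sum>l<p ^ n. of_bool (res n (pt i l) = b) * block N c (p ^ n) l)"

lemma res_pt_mod: "res (n + m) (pt i l) mod p ^ n = res n (pt i l)"
proof (rule sym, rule res_eqI[OF pt_Zp])
  show "res (n + m) (pt i l) mod p ^ n < p ^ n" using p_gt_1 by simp
  have "cp_abs (pt i l - of_nat (res (n + m) (pt i l))) \<le> eps n"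
    using res_approx[OF pt_Zp] eps_mono[of n "n + m"] order_trans le_add1 by blast
  then show "cp_abs (pt i l - of_nat (res (n + m) (pt i l) mod p ^ n)) \<le> eps n"
    unfolding cp_abs_diff_le_iff_res[OF pt_Zp] by (simp add: cong_def)
qed

lemma res_pt_add: "res n (pt i (l + p ^ n * j)) = res n (pt i l)"
proof -
  have "pt i (l + p ^ n * j) - pt i l = of_nat p ^ n * of_nat (p ^ r * j)"
    by (simp add: algebra_simps)
  then have "cp_abs (pt i (l + p ^ n * j) - pt i l) \<le> eps n"
    using cp_abs_mult_le[OF _ cp_abs_of_nat, of "of_nat p ^ n" "eps n" "p ^ r * j"]
    by (simp only: cp_abs_p_power order_refl)
  then show ?thesis using res_cong[OF pt_Zp pt_Zp] by blast
qed

text \<open>Summing over the refinements of b restores the condition modulo p^n, which depends only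
  on l modulo p^n; the remaining sum of blocks collapses by \<open>block_refine\<close>.\<close>

lemma pushed_refine:
  assumes c: "c < N" and b: "b < p ^ n"
  shows "(\<Sum>b' | b' < p ^ Suc n \<and> [b' = b] (mod p ^ n). pushed (Suc n) c i b') = pushed n c i b"
proof -
  let ?B = "{b'. b' < p ^ Suc n \<and> [b' = b] (mod p ^ n)}"
  have fin: "finite ?B" by simp
  have ind: "(\<Sum>b'\<in>?B. of_bool (res (Suc n) (pt i l) = b')) = (of_bool (res n (pt i l) = b) :: 'c)" for l
  proof -
    have "(\<Sum>b'\<in>?B. of_bool (res (Suc n) (pt i l) = b')) = (\<Sum>b'\<in>?B. if b' = res (Suc n) (pt i l) then 1 else 0 :: 'c)"
      by (rule sum.cong) auto
    also have "\<dots> = of_bool (res (Suc n) (pt i l) \<in> ?B)" using fin by simp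
    also have "res (Suc n) (pt i l) \<in> ?B \<longleftrightarrow> res n (pt i l) = b"
      using res_pt_mod[of n 1 i l] res_less[OF pt_Zp, of "Suc n"] b by (simp add: cong_def)
    finally show ?thesis .
  qed
  have "(\<Sum>b'\<in>?B. pushed (Suc n) c i b')
    = (\<Sum>l<p ^ Suc n. (\<Sum>b'\<in>?B. of_bool (res (Suc n) (pt i l) = b')) * block N c (p ^ Suc n) l)"
    unfolding pushed_def sum_distrib_right by (rule sum.swap)
  also have "\<dots> = (\<Sum>l<p ^ n * p. of_bool (res n (pt i l) = b) * block N c (p ^ n * p) l)"
    unfolding ind by (simp add: mult.commute)
  also have "\<dots> = (\<Sum>l<p ^ n. \<Sum>j<p. of_bool (res n (pt i l) = b) * block N c (p ^ n * p) (l + p ^ n * j))"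
    unfolding sum_nat_product res_pt_add ..
  also have "\<dots> = pushed n c i b"
    unfolding pushed_def sum_distrib_left[symmetric]
    using block_refine[OF c coprime_p_N, of "p ^ n", where 'a = 'c] coprime_p_N p_gt_1 by simp
  finally show ?thesis .
qed

text \<open>Because l is multiplied by p^r, the points congruent to \<open>pt i l\<close> modulo
  p^(n + r) are those with l' congruent to l modulo p^n. This is the origin of the shift of level by
  r.\<close>

lemma pushed_at_point:
  assumes c: "c < N" and l: "l < p ^ n"
  shows "pushed (n + r) c i (res (n + r) (pt i l)) = block N c (p ^ n) l"
proof -
  have iff: "res (n + r) (pt i l') = res (n + r) (pt i l) \<longleftrightarrow> [l' = l] (mod p ^ n)" for l'
  proof -
    have "pt i l' - pt i l = of_nat p ^ r * (of_nat l' - of_nat l)" by (simp add: algebra_simps)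
    then have "cp_abs (pt i l' - pt i l) \<le> eps (n + r) \<longleftrightarrow> eps r * cp_abs (of_nat l' - of_nat l :: 'c) \<le> eps r * eps n"
      by (simp add: cp_abs_mult cp_abs_p_power power_add mult.commute)
    also have "\<dots> \<longleftrightarrow> cp_abs (of_nat l' - of_nat l :: 'c) \<le> eps n"
      using eps_pos(1)[of r] by (rule mult_le_cancel_left_pos)
    finally show ?thesis unfolding res_cong[OF pt_Zp pt_Zp] cp_abs_of_nat_diff_le_iff .
  qed
  have "pushed (n + r) c i (res (n + r) (pt i l))
    = (\<Sum>l'<p ^ n * p ^ r. of_bool ([l' = l] (mod p ^ n)) * block N c (p ^ (n + r)) l')"
    unfolding pushed_def iff by (simp add: power_add)
  also have "\<dots> = (\<Sum>l'<p ^ n. \<Sum>j<p ^ r. of_bool (l' = l) * block N c (p ^ (n + r)) (l' + p ^ n * j))"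
    unfolding sum_nat_product using l by (intro sum.cong refl) (auto simp: cong_def)
  also have "\<dots> = (\<Sum>l'<p ^ n. of_bool (l' = l) * block N c (p ^ n) l')"
    unfolding sum_distrib_left[symmetric]
    using block_refine_power[OF c coprime_p_N, where 'a = 'c] p_gt_1 by simp
  also have "\<dots> = (\<Sum>l'<p ^ n. if l' = l then block N c (p ^ n) l else 0)" by (rule sum.cong) auto
  also have "\<dots> = block N c (p ^ n) l" using l by simp
  finally show ?thesis .
qed

definition weight :: "nat \<Rightarrow> ('k \<Rightarrow> nat) \<Rightarrow> 'c" where
  "weight n b = (\<Sum>c | \<forall>i. c i < N. g c * (\<Prod>i\<in>UNIV. pushed n (c i) i (b i)))"

lemma consistent_weight: "consistent weight"
  unfolding consistent_def
proof (intro allI impI)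
  fix n and b :: "'k \<Rightarrow> nat" assume b: "\<forall>i. b i < p ^ n"
  let ?B = "\<lambda>i. {b'. b' < p ^ Suc n \<and> [b' = b i] (mod p ^ n)}"
  have "(\<Sum>b' | (\<forall>i. b' i < p ^ Suc n) \<and> (\<forall>i. [b' i = b i] (mod p ^ n)). weight (Suc n) b')
    = (\<Sum>b' | \<forall>i. b' i \<in> ?B i. weight (Suc n) b')"
    by (rule sum.cong) auto
  also have "\<dots> = (\<Sum>c | \<forall>i. c i < N. g c * (\<Sum>b' | \<forall>i. b' i \<in> ?B i. \<Prod>i\<in>UNIV. pushed (Suc n) (c i) i (b' i)))"
    unfolding weight_def sum_distrib_left by (rule sum.swap)
  also have "\<dots> = (\<Sum>c | \<forall>i. c i < N. g c * (\<Prod>i\<in>UNIV. \<Sum>b'\<in>?B i. pushed (Suc n) (c i) i b'))"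
    by (subst prod_sum_family) simp_all
  also have "\<dots> = weight n b"
    unfolding weight_def using b by (intro sum.cong refl) (simp add: pushed_refine del: power_Suc)
  finally show "weight n b = (\<Sum>b' | (\<forall>i. b' i < p ^ Suc n) \<and> (\<forall>i. [b' i = b i] (mod p ^ n)). weight (Suc n) b')"
    by simp
qed

text \<open>Applied to three sets: the ring generated by 1 / N and the values of chi, the field K,
  and the unit ball.\<close>

lemma weight_closed:
  assumes S: "1 \<in> S" "\<And>y z. y \<in> S \<Longrightarrow> z \<in> S \<Longrightarrow> y + z \<in> S" "\<And>y z. y \<in> S \<Longrightarrow> z \<in> S \<Longrightarrow> y * z \<in> S"
      "\<And>y. y \<in> S \<Longrightarrow> - y \<in> S"
    and g: "\<And>d. g d \<in> S" and N: "1 / of_nat N \<in> S"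
  shows "0 \<in> S" "weight n b \<in> S"
proof -
  show zero: "0 \<in> S" using S(2)[OF S(1) S(4)[OF S(1)]] by simp
  have bool: "of_bool P \<in> S" for P using zero S(1) by simp
  have nat: "of_nat m \<in> S" for m by (induction m) (simp_all add: zero S)
  have res: "res_ind N c d \<in> S" for c d
    using S(2)[OF bool S(4)[OF bool]] by (simp add: res_ind_def)
  have "block N c P l = - (\<Sum>d<N. of_nat d * res_ind N c (l + P * d)) * (1 / of_nat N :: 'c)" for c P l
    by (simp add: block_def)
  moreover have "- (\<Sum>d<N. of_nat d * res_ind N c (l + P * d)) * (1 / of_nat N) \<in> S" for c P l
    by (intro S(3) S(4) sum_in_closed[OF zero S(2)] N nat res)
  ultimately have "block N c P l \<in> S" for c P l by metis
  then have "pushed n c i b \<in> S" for c i b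
    unfolding pushed_def by (intro sum_in_closed[OF zero S(2)] S(3) bool)
  then show "weight n b \<in> S" unfolding weight_def by (intro sum_in_closed[OF zero S(2)] S(3) g prod_in_closed[OF S(1,3)])
qed

lemma weight_le: "cp_abs (weight n b) \<le> 1"
proof -
  have "cp_abs (1 / of_nat N :: 'c) \<le> 1"
    using cp_abs_of_nat_inverse coprime_p_N by (simp add: coprime_commute)
  then show ?thesis
    using weight_closed(2)[of "{z. cp_abs z \<le> 1}" n b] g_le by (simp add: cp_abs_add_le cp_abs_mult_le)
qed

text \<open>The one-variable Amice transform of \<open>pushed\<close>. The quotient exists because
  the right-hand side vanishes in degree 0.\<close>

definition amice_coeff :: "'k \<Rightarrow> nat \<Rightarrow> 'c fps" where
  "amice_coeff i c = (SOME A. (1 - fps_binomial (of_nat p ^ r * of_nat N)) * A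
     = fps_binomial (pt i c) - fps_binomial (a i))"

lemma f_den_factor:
  "fps_nth (1 - fps_binomial (of_nat p ^ r * of_nat N) :: 'c fps) 0 = 0"
  "fps_nth (1 - fps_binomial (of_nat p ^ r * of_nat N) :: 'c fps) 1 \<noteq> 0"
  using N_pos p_gt_1 by simp_all

lemma amice_coeff:
  "(1 - fps_binomial (of_nat p ^ r * of_nat N)) * amice_coeff i c = fps_binomial (pt i c) - fps_binomial (a i)"
  unfolding amice_coeff_def
  by (rule someI_ex, rule ex_fps_quotient[OF f_den_factor]) simp

definition series :: "('k, 'c) mfps" where
  "series = (\<Sum>c | \<forall>i. c i < N. mconst (g c) * tens (\<lambda>i. amice_coeff i (c i)))"

text \<open>The Riemann sums factor over the coordinates, and exchanging the sum over b with the sum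
  over l inside \<open>pushed\<close> turns each factor into the one of
  \<open>block_quotient_tendsto\<close>.\<close>

lemma riemann_weight_tendsto: "riemann r (cell_measure r weight) m \<longlonglongrightarrow> mcoeff series m"
proof -
  have "riemann r (cell_measure r weight) m = (\<lambda>n. \<Sum>c | \<forall>i. c i < N. g c *
      (\<Prod>i\<in>UNIV. \<Sum>l<p ^ n. (of_nat (res n (pt i l)) gchoose (m i)) * block N (c i) (p ^ n) l))"
  proof
    fix n
    let ?B = "{b :: 'k \<Rightarrow> nat. \<forall>i. b i < p ^ n}"
    have inner: "(\<Sum>b<p ^ n. (of_nat b gchoose (m i)) * pushed n c i b)
      = (\<Sum>l<p ^ n. (of_nat (res n (pt i l)) gchoose (m i)) * block N c (p ^ n) l)" for i c
    proof -
      have "(\<Sum>b<p ^ n. (of_nat b gchoose (m i)) * pushed n c i b)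
        = (\<Sum>l<p ^ n. \<Sum>b<p ^ n. (of_nat b gchoose (m i)) * (of_bool (res n (pt i l) = b) * block N c (p ^ n) l))"
        unfolding pushed_def sum_distrib_left by (rule sum.swap)
      also have "\<dots> = (\<Sum>l<p ^ n. \<Sum>b<p ^ n. if b = res n (pt i l) then (of_nat b gchoose (m i)) * block N c (p ^ n) l else 0)"
        by (intro sum.cong refl) auto
      finally show ?thesis using res_less[OF pt_Zp] by simp
    qed
    have "riemann r (cell_measure r weight) m n = (\<Sum>b\<in>?B. (\<Prod>i\<in>UNIV. of_nat (b i) gchoose (m i)) * weight n b)"
      unfolding riemann_def by (rule sum.cong) (simp_all add: cell_measure_cell[OF consistent_weight])
    also have "\<dots> = (\<Sum>b\<in>?B. \<Sum>c | \<forall>i. c i < N. g c * (\<Prod>i\<in>UNIV. (of_nat (b i) gchoose (m i)) * pushed n (c i) i (b i)))"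
      by (simp add: weight_def sum_distrib_left prod.distrib mult_ac)
    also have "\<dots> = (\<Sum>c | \<forall>i. c i < N. g c * (\<Prod>i\<in>UNIV. \<Sum>b<p ^ n. (of_nat b gchoose (m i)) * pushed n (c i) i b))"
      unfolding prod_sum_box sum_distrib_left by (rule sum.swap)
    also have "\<dots> = (\<Sum>c | \<forall>i. c i < N. g c *
      (\<Prod>i\<in>UNIV. \<Sum>l<p ^ n. (of_nat (res n (pt i l)) gchoose (m i)) * block N (c i) (p ^ n) l))"
      unfolding inner ..
    finally show "riemann r (cell_measure r weight) m n = (\<Sum>c | \<forall>i. c i < N. g c *
      (\<Prod>i\<in>UNIV. \<Sum>l<p ^ n. (of_nat (res n (pt i l)) gchoose (m i)) * block N (c i) (p ^ n) l))" .
  qed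
  moreover have "(\<lambda>n. \<Sum>c | \<forall>i. c i < N. g c *
      (\<Prod>i\<in>UNIV. \<Sum>l<p ^ n. (of_nat (res n (pt i l)) gchoose (m i)) * block N (c i) (p ^ n) l))
    \<longlonglongrightarrow> (\<Sum>c | \<forall>i. c i < N. g c * (\<Prod>i\<in>UNIV. fps_nth (amice_coeff i (c i)) (m i)))"
    by (intro tendsto_cp_sum tendsto_cp_mult tendsto_const tendsto_cp_prod
        block_quotient_tendsto[OF a_Zp _ coprime_p_N amice_coeff]) simp
  ultimately show ?thesis by (simp add: series_def mcoeff_sum mcoeff_const_times mcoeff_tens)
qed

lemma amice_weight: "amice p r (cell_measure r weight) = series"
  by (rule mfps_eqI) (simp add: mcoeff_amice limI[OF riemann_weight_tendsto])

lemma series_le: "cp_abs (mcoeff series m) \<le> 1"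
proof -
  have "cp_abs (riemann r (cell_measure r weight) m n) \<le> 1" for n
    unfolding riemann_def
    by (intro cp_abs_sum_le cp_abs_mult_le cp_abs_binomial_prod)
       (simp_all add: cell_measure_cell[OF consistent_weight] weight_le)
  then have le: "dist (riemann r (cell_measure r weight) m n) 0 \<le> 1" for n by (simp add: dist_cp)
  have "dist (mcoeff series m) 0 \<le> 1"
    by (rule LIMSEQ_le_const2[OF tendsto_dist[OF riemann_weight_tendsto tendsto_const]]) (use le in auto)
  then show ?thesis by (simp add: dist_cp)
qed

text \<open>The coefficient recursion uses field operations only, so membership in K is obtained
  without passing to a limit.\<close>

lemma series_closed:
  assumes S: "1 \<in> S" "\<And>y z. y \<in> S \<Longrightarrow> z \<in> S \<Longrightarrow> y - z \<in> S" "\<And>y z. y \<in> S \<Longrightarrow> z \<in> S \<Longrightarrow> y * z \<in> S"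
      "\<And>y z. y \<in> S \<Longrightarrow> z \<in> S \<Longrightarrow> y / z \<in> S"
    and g: "\<And>d. g d \<in> S" and a: "\<And>i. a i \<in> S"
  shows "mcoeff series m \<in> S"
proof -
  have zero: "0 \<in> S" using S(2)[OF S(1) S(1)] by simp
  have uminus: "- y \<in> S" if "y \<in> S" for y using S(2)[OF zero that] by simp
  have add: "y + z \<in> S" if "y \<in> S" "z \<in> S" for y z using S(2)[OF that(1) uminus[OF that(2)]] by simp
  have nat: "of_nat j \<in> S" for j by (induction j) (simp_all add: zero add S)
  have binom: "(y gchoose j) \<in> S" if "y \<in> S" for y j
  proof -
    have "(\<Prod>i=0..<j. y - of_nat i) \<in> S" by (intro prod_in_closed[OF S(1,3)] S(2) that nat)
    then show ?thesis using S(4)[OF _ nat[of "fact j"]] by (simp add: gbinomial_prod_rev)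
  qed
  have q: "of_nat p ^ r * of_nat l \<in> S" for l using nat[of "p ^ r * l"] by simp
  have "fps_nth (amice_coeff i c) j \<in> S" for i c j
  proof (rule fps_quotient_coeff_closed[OF f_den_factor S(2,3,4) zero])
    show "fps_nth (1 - fps_binomial (of_nat p ^ r * of_nat N)) j \<in> S" for j
      using S(2) zero S(1) binom[OF q] by simp
    show "fps_nth ((1 - fps_binomial (of_nat p ^ r * of_nat N)) * amice_coeff i c) j \<in> S" for j
      unfolding amice_coeff using S(2)[OF binom[OF add[OF a q]] binom[OF a]] by simp
  qed
  then show ?thesis
    unfolding series_def mcoeff_sum mcoeff_const_times mcoeff_tens
    by (intro sum_in_closed[OF zero add] S(3) g prod_in_closed[OF S(1,3)])
qed

text \<open>Multiplication by the denominator produces a product of differences in which the terms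
  with a i alone are constant in c; \<open>zero_sum_prod_shift\<close> drops them and the numerator
  remains.\<close>

lemma series_times_den:
  assumes v: "rat_basis v" and a: "\<And>i. a i = of_nat p ^ r * emb v x i" and g: "\<And>d. g d = \<psi> (x + lin v d)"
  shows "series * f_den p r N v = f_num p r N v x \<psi>"
proof (rule mfps_eqI)
  fix m
  let ?D = "1 - fps_binomial (of_nat p ^ r * of_nat N) :: 'c fps"
  have "series * f_den p r N v = (\<Sum>c | \<forall>i. c i < N. mconst (g c) * tens (\<lambda>i. fps_binomial (pt i (c i)) - fps_binomial (a i)))"
  proof -
    have "amice_coeff i c * ?D = fps_binomial (pt i c) - fps_binomial (a i)" for i c
      using amice_coeff[of i c] by (simp only: mult.commute)
    then show ?thesis
      unfolding f_den_eq_tens[OF v] series_def sum_distrib_right mult.assoc tens_mult by simp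
  qed
  then have "mcoeff (series * f_den p r N v) m
    = (\<Sum>c | \<forall>i. c i < N. g c * (\<Prod>i\<in>UNIV. (pt i (c i) gchoose m i) + - (a i gchoose m i)))"
    by (simp add: mcoeff_sum mcoeff_const_times mcoeff_tens)
  also have "\<dots> = (\<Sum>c | \<forall>i. c i < N. g c * (\<Prod>i\<in>UNIV. pt i (c i) gchoose m i))"
    by (rule zero_sum_prod_shift[OF zero_sum N_pos])
  also have "\<dots> = mcoeff (f_num p r N v x \<psi>) m"
    unfolding f_num_coeff[OF v] by (simp add: g a distrib_left)
  finally show "mcoeff (series * f_den p r N v) m = mcoeff (f_num p r N v x \<psi>) m" .
qed

text \<open>Evaluates two definite descriptions. Existence comes from \<open>series\<close> and
  \<open>weight\<close>; the series is unique by \<open>mult_tens_eq_0\<close>, the measure by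
  \<open>amice_inject\<close>.\<close>

lemma mu_measure_eq:
  assumes v: "rat_basis v" and a: "\<And>i. a i = of_nat p ^ r * emb v x i" and g: "\<And>d. g d = \<psi> (x + lin v d)"
    and S: "1 \<in> K" "\<And>y z. y \<in> K \<Longrightarrow> z \<in> K \<Longrightarrow> y - z \<in> K" "\<And>y z. y \<in> K \<Longrightarrow> z \<in> K \<Longrightarrow> y * z \<in> K"
      "\<And>y z. y \<in> K \<Longrightarrow> z \<in> K \<Longrightarrow> y / z \<in> K"
    and gK: "\<And>d. g d \<in> K" and aK: "\<And>i. a i \<in> K"
  shows "mu_measure (integer_ring K) p r N v x \<psi> = cell_measure r weight"
proof -
  let ?R = "integer_ring K"
  have zero: "0 \<in> K" using S(2)[OF S(1) S(1)] by simp
  have uminus: "- y \<in> K" if "y \<in> K" for y using S(2)[OF zero that] by simp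
  have add: "y + z \<in> K" if "y \<in> K" "z \<in> K" for y z using S(2)[OF that(1) uminus[OF that(2)]] by simp
  have nat: "of_nat j \<in> K" for j by (induction j) (simp_all add: zero add S)
  have R: "cp_abs z \<le> 1" if "z \<in> ?R" for z using that by (simp add: integer_ring_def)
  have meas: "is_measure ?R (O_dagger p r) (cell_measure r weight)"
  proof (rule is_measure_cell_measure[OF consistent_weight])
    show "weight n b \<in> ?R" for n b
      using weight_closed(2)[of K n b] S add uminus gK S(4)[OF S(1) nat] weight_le
      by (simp add: integer_ring_def)
  qed (use zero add in \<open>auto simp: integer_ring_def cp_abs_add_le\<close>)
  have "f_series ?R p r N v x \<psi> = series"
    unfolding f_series_def
  proof (rule the_equality)
    show "series \<in> power_series_over ?R \<and> series * f_den p r N v = f_num p r N v x \<psi>"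
      using series_le series_closed[OF S gK aK] series_times_den[where v = v and x = x and \<psi> = \<psi>, OF v a g]
      by (simp add: power_series_over_def integer_ring_def)
    fix f assume f: "f \<in> power_series_over ?R \<and> f * f_den p r N v = f_num p r N v x \<psi>"
    have "(f - series) * tens (\<lambda>_. 1 - fps_binomial (of_nat p ^ r * of_nat N)) = 0"
      using f series_times_den[where v = v and x = x and \<psi> = \<psi>, OF v a g]
      by (simp add: left_diff_distrib flip: f_den_eq_tens[OF v])
    then have "f - series = 0" using f_den_factor by (rule mult_tens_eq_0)
    then show "f = series" by simp
  qed
  then show ?thesis
    unfolding mu_measure_def
  proof (intro the_equality)
    fix mu assume "is_measure ?R (O_dagger p r) mu \<and> amice p r mu = f_series ?R p r N v x \<psi>"
    then show "mu = cell_measure r weight"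
      using \<open>f_series ?R p r N v x \<psi> = series\<close> amice_weight by (intro amice_inject[OF _ meas R]) simp_all
  qed (simp add: meas amice_weight)
qed

text \<open>p^n O_V is p^(n + r) times the lattice of \<open>O_dagger\<close>, so the coset is a
  cell of level n + r, and \<open>pushed_at_point\<close> evaluates its weight.\<close>

lemma cell_measure_coset:
  assumes v: "rat_basis v" and a: "\<And>i. a i = of_nat p ^ r * emb v x i" and l: "\<forall>i. l i < p ^ n"
  shows "cell_measure r weight (lattice_coset (emb v (x + lin v l)) (of_nat p ^ n))
    = (\<Sum>c | \<forall>i. c i < N. g c * (\<Prod>i\<in>UNIV. block N (c i) (p ^ n) (l i)))"
proof -
  let ?b = "\<lambda>i. res (n + r) (pt i (l i))"
  have pt: "of_nat p ^ r * emb v (x + lin v l) i = pt i (l i)" for i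
    by (simp add: emb_add[OF v] emb_lin[OF v] a distrib_left)
  have "lattice_coset (emb v (x + lin v l)) (of_nat p ^ (n + r) / of_nat p ^ r) = cell r (n + r) ?b"
    using pt_Zp res_approx[OF pt_Zp] by (intro coset_eq_cell) (simp_all add: O_dagger_iff pt)
  then have "lattice_coset (emb v (x + lin v l)) (of_nat p ^ n) = cell r (n + r) ?b"
    using p_gt_1 by (simp add: power_add)
  then have "cell_measure r weight (lattice_coset (emb v (x + lin v l)) (of_nat p ^ n)) = weight (n + r) ?b"
    using cell_measure_cell[OF consistent_weight] res_less[OF pt_Zp] by simp
  then show ?thesis using l by (simp add: weight_def pushed_at_point)
qed

end

subsection \<open>The theorem\<close>

lemma principal_eq_PIdl: "principal z = PIdl\<^bsub>\<O>\<^esub> (z :: 'f::field_char_0)"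
  by (auto simp: principal_def cgenideal_def mult.commute)

lemma subfield_whole_closed:
  fixes K :: "'c::field_char_0 set"
  assumes "subfield K whole"
  shows "1 \<in> K" "y \<in> K \<Longrightarrow> z \<in> K \<Longrightarrow> y - z \<in> K" "y \<in> K \<Longrightarrow> z \<in> K \<Longrightarrow> y * z \<in> K"
    "y \<in> K \<Longrightarrow> z \<in> K \<Longrightarrow> y / z \<in> K"
proof -
  interpret W: ring "whole :: 'c ring" by rule
  interpret K: subfield K "whole :: 'c ring" by (rule assms)
  note sub = subringE[OF subcring.axioms(1)[OF K.subcring_axioms]]
  have uminus: "\<ominus>\<^bsub>whole\<^esub> y = - y" for y :: 'c using W.minus_equality[of "- y" y] by simp
  show "1 \<in> K" using sub(3) by simp
  show mult: "y * z \<in> K" if "y \<in> K" "z \<in> K" for y z using sub(6)[OF that] by simp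
  show "y - z \<in> K" if "y \<in> K" "z \<in> K" for y z
    using sub(7)[OF that(1) sub(5)[OF that(2)]] by (simp add: uminus)
  show "y / z \<in> K" if "y \<in> K" "z \<in> K" for y z
  proof (cases "z = 0")
    case True
    then show ?thesis using that by simp
  next
    case False
    then have "z \<in> Units (whole\<lparr>carrier := K\<rparr>)" using K.subfield_Units that(2) by simp
    then obtain w where "w \<in> K" "w * z = 1" by (auto simp: Units_def)
    moreover from this have "y / z = y * w" using False by (simp add: field_simps)
    ultimately show ?thesis using mult[OF that(1), of w] by simp
  qed
qed

theorem theorem4p4:
  fixes p N r :: nat
    and I :: "'f::field_char_0 set"
    and x :: 'f
    and v :: "'k::finite \<Rightarrow> 'f"
    and chi :: "'f set set \<Rightarrow> 'c::{field_char_0,complete_space}"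
    and K R :: "'c set"
    and mu :: "('k \<Rightarrow> 'c) set \<Rightarrow> 'c"
  assumes F: "totally_real_field TYPE('f) CARD('k)"
    and p: "Factorial_Ring.prime p"
    and I: "ideal I \<O>" "I \<noteq> {0}" "I \<noteq> carrier \<O>" "coprime_ideals I (PIdl\<^bsub>\<O>\<^esub> (of_nat p))"
    and N: "N = ideal_norm I" "\<O> Quot I \<simeq> ZFact (int N)"
    and x: "\<forall>Q \<in> primes_dividing (ideal_prod \<O> I (PIdl\<^bsub>\<O>\<^esub> (of_nat p))). integral_at Q x"
    and v: "rat_basis v" "\<forall>i. v i \<in> carrier \<O> \<and> totally_positive (v i) \<and> prime_to I (v i)"
    and C_p: "is_C_p TYPE('c) p"
    and chi: "chi \<in> hom (Cl_plus I) (mult_of Qbar)" "nontrivial_narrow_modulus chi I"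
    and K: "finite_ext_Qp K" "chi ` carrier (Cl_plus I) \<subseteq> K" "R = integer_ring K"
    and r: "(emb v x :: 'k \<Rightarrow> 'c) \<in> O_dagger p r"
    and mu: "mu = mu_measure R p r N v x (chi_val chi I)"
  shows "(\<forall>U \<in> compact_opens (O_dagger p r).
            mu U \<in> generate_ring whole (insert (1 / of_nat N) (chi ` carrier (Cl_plus I)))) \<and>
    (\<forall>n. \<forall>l :: 'k \<Rightarrow> nat. (\<forall>i. l i < p ^ n) \<longrightarrow>
       mu (lattice_coset (emb v (x + lin v l)) (of_nat p ^ n)) =
         (- 1) ^ CARD('k) / of_nat N ^ CARD('k) *
         (\<Sum>d | \<forall>i. d i < N.
            chi_val chi I (x + lin v (\<lambda>i. l i + p ^ n * d i)) * (\<Prod>i\<in>UNIV. of_nat (d i)))) \<and>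
    (\<forall>n. \<forall>l :: 'k \<Rightarrow> nat. (\<forall>i. l i < p ^ n) \<and> of_nat p ^ n - 1 \<in> I \<longrightarrow>
       mu (lattice_coset (emb v (x + lin v l)) (of_nat p ^ n)) =
         (- 1) ^ CARD('k) *
         (\<Sum>S\<in>UNIV. 1 / of_nat N ^ card S *
            (\<Sum>d | (\<forall>i\<in>S. d i < N) \<and> (\<forall>j\<in>- S. d j < l j).
               chi_val chi I (x + lin v d) * (\<Prod>i\<in>S. of_nat (d i)))))"
proof -
  have p_gt: "p > 1" using p by (rule prime_gt_1_nat)
  interpret ray_modulus I N by (rule ray_modulus_quotient(1)[OF I(1,3) N(2) p_gt I(4)])
  have cop: "coprime p N" by (rule ray_modulus_quotient(2)[OF I(1,3) N(2) p_gt I(4)])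
  interpret ray_character I N chi by unfold_locales (rule chi)+
  interpret p_adic p "TYPE('c)" by unfold_locales (rule p C_p)+
  have "of_nat p \<in> carrier (\<O> :: 'f ring)" using O_closed(1)[of "int p"] by simp
  then have "ideal (PIdl\<^bsub>\<O>\<^esub> (of_nat p)) (\<O> :: 'f ring)"
    using ideal_principal by (simp add: principal_eq_PIdl)
  then have xI: "\<forall>Q \<in> primes_dividing I. integral_at Q x"
    using x primes_dividing_ideal_prod[OF I(1)] by blast
  have vI: "v i \<in> carrier \<O>" "prime_to I (v i)" for i using v(2) by simp_all
  define g where "g d = chi_val chi I (x + lin v d)" for d
  define a :: "'k \<Rightarrow> 'c" where "a i = of_nat p ^ r * emb v x i" for i
  have g_values: "g d \<in> insert 0 (chi ` carrier (Cl_plus I))" for d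
    unfolding g_def by (rule chi_val_lin_values(1)[OF xI vI])
  \<comment> \<open>The nonzero values are roots of unity, of absolute value 1.\<close>
  have g_le: "cp_abs (g d) \<le> 1" for d
  proof -
    have "g d = 0 \<or> g d ^ totient N = 1" unfolding g_def by (rule chi_val_lin_values(2)[OF xI vI])
    moreover have "cp_abs y \<le> 1" if "y ^ totient N = 1" for y :: 'c
    proof -
      have "cp_abs y ^ totient N = 1" using that by (simp flip: cp_abs_power)
      moreover have "totient N > 0" using N_gt_1 by simp
      ultimately show ?thesis using one_less_power[of "cp_abs y" "totient N"] by fastforce
    qed
    ultimately show ?thesis by auto
  qed
  interpret zero_sum_measure p "TYPE('c)" N g r a
  proof
    show "N > 0" using N_gt_1 by simp
    show "g d = g d'" if "\<And>i. [d i = d' i] (mod N)" for d d'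
      unfolding g_def using that by (rule chi_val_lin_periodic[OF xI vI])
    show "(\<Sum>j<N. g (d(i := j))) = 0" for d i
      unfolding g_def by (rule sum_chi_val_lin[OF xI vI])
    show "a i \<in> Zp" for i using r by (simp add: O_dagger_iff a_def)
  qed (rule cop g_le)+
  have K_sub: "subfield K whole" "Qp \<subseteq> K" using K(1) by (auto simp: finite_ext_Qp_def)
  note K_closed = subfield_whole_closed[OF K_sub(1)]
  have zero_K: "0 \<in> K" using K_closed(2)[OF K_closed(1) K_closed(1)] by simp
  have gK: "g d \<in> K" for d using g_values[of d] K(2) zero_K by auto
  \<comment> \<open>The coordinates of x are rational numbers, and K contains the closure of the
    rationals.\<close>
  have rat_K: "of_rat s \<in> K" for s
    using K_sub(2) closure_subset Rats_of_rat[of s] unfolding Qp_def by blast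
  have aK: "a i \<in> K" for i
    unfolding a_def emb_def using K_closed(3)[OF rat_K[of "of_nat p ^ r"] rat_K] by (simp add: of_rat_power)
  have mu_eq: "mu = cell_measure r weight"
    unfolding mu K(3) by (rule mu_measure_eq[OF v(1) a_def g_def K_closed gK aK])
  show ?thesis
  proof (intro conjI ballI allI impI)
    let ?S = "generate_ring whole (insert (1 / of_nat N) (chi ` carrier (Cl_plus I)))"
    interpret W: ring "whole :: 'c ring" by rule
    have S: "1 \<in> ?S" "\<And>y z. y \<in> ?S \<Longrightarrow> z \<in> ?S \<Longrightarrow> y + z \<in> ?S" "\<And>y z. y \<in> ?S \<Longrightarrow> z \<in> ?S \<Longrightarrow> y * z \<in> ?S"
      "\<And>y. y \<in> ?S \<Longrightarrow> - y \<in> ?S"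
    proof -
      have "\<ominus>\<^bsub>whole\<^esub> y = - y" for y :: 'c using W.minus_equality[of "- y" y] by simp
      then show "- y \<in> ?S" if "y \<in> ?S" for y using generate_ring.a_inv[OF that] by simp
    qed (use generate_ring.one[of whole] generate_ring.eng_add[of _ whole] generate_ring.eng_mult[of _ whole]
        in \<open>simp_all\<close>)
    have zero_S: "0 \<in> ?S" using S(2)[OF S(1) S(4)[OF S(1)]] by simp
    have gS: "g d \<in> ?S" for d
    proof (cases "g d = 0")
      case False
      then have "g d \<in> insert (1 / of_nat N) (chi ` carrier (Cl_plus I))" using g_values[of d] by simp
      then show ?thesis by (rule generate_ring.incl)
    qed (simp add: zero_S)
    have NS: "1 / of_nat N \<in> ?S" by (rule generate_ring.incl) simp
    show "mu U \<in> ?S" if "U \<in> compact_opens (O_dagger p r)" for U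
      unfolding mu_eq
      by (rule cell_measure_values[OF consistent_weight weight_closed(1)[OF S gS NS] S(2) weight_closed(2)[OF S gS NS] that])
  next
    fix n and l :: "'k \<Rightarrow> nat" assume l: "\<forall>i. l i < p ^ n"
    show "mu (lattice_coset (emb v (x + lin v l)) (of_nat p ^ n)) =
      (- 1) ^ CARD('k) / of_nat N ^ CARD('k) * (\<Sum>d | \<forall>i. d i < N.
        chi_val chi I (x + lin v (\<lambda>i. l i + p ^ n * d i)) * (\<Prod>i\<in>UNIV. of_nat (d i)))"
      unfolding mu_eq cell_measure_coset[OF v(1) a_def l] sum_blocks by (simp add: g_def)
  next
    fix n and l :: "'k \<Rightarrow> nat" assume l: "(\<forall>i. l i < p ^ n) \<and> of_nat p ^ n - 1 \<in> I"
    \<comment> \<open>As I meets Z in NZ, the hypothesis on p^n is a congruence modulo N.\<close>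
    have "of_int (int p ^ n - 1) \<in> I" using l by simp
    then have "int N dvd int p ^ n - 1" by (simp only: of_int_mem_iff)
    then have "[int (p ^ n) = int 1] (mod int N)" by (simp add: cong_iff_dvd_diff)
    then have one: "[p ^ n = 1] (mod N)" by (simp only: cong_int_iff)
    show "mu (lattice_coset (emb v (x + lin v l)) (of_nat p ^ n)) =
      (- 1) ^ CARD('k) * (\<Sum>S\<in>UNIV. 1 / of_nat N ^ card S *
        (\<Sum>d | (\<forall>i\<in>S. d i < N) \<and> (\<forall>j\<in>- S. d j < l j).
           chi_val chi I (x + lin v d) * (\<Prod>i\<in>S. of_nat (d i))))"
      unfolding mu_eq cell_measure_coset[OF v(1) a_def conjunct1[OF l]] sum_blocks_one[OF one] by (simp add: g_def)
  qed
qed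

end
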